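(* Let $k>0$ and $\mathcal{B}_1,\mathcal{B}_3\in\{\mathbf{I}_d,\frac{\partial}{\partial\nu}\}$. Let $\{\tilde\mu_n\}_{n\in\mathbb{N}_0}$ be chosen according to the four-case rule in the context, and let $\{\tilde X_n\}_{n\in\mathbb{N}_0}$ be an associated system of eigenfunctions (either of the two choices in the context). Assume $g_1\in\mathcal{Z}^{\frac12}(\Gamma_1)$ if $\mathcal{B}_1=\frac{\partial}{\partial\nu}$, and $g_1\in\mathcal{Z}^{\frac32}(\Gamma_1)$ if $\mathcal{B}_1=\mathbf{I}_d$. Let $$\tilde u=\sum_{n=0}^\infty\widehat g_1(n)\,\tilde X_n(x)\,\tilde Y_n(y)\quad\text{with}\quad\widehat g_1(n):=\int_{\Gamma_1}g_1(x)\tilde X_n(x)\,dx,$$ where, for each $n\in\mathbb{N}_0$, $\tilde Y_n$ solves $$\tilde Y_n''(y)+(k^2-\tilde\mu_n^2)\tilde Y_n(y)=0\ \text{ in }(0,1),\qquad\mathcal{B}_1\tilde Y_n(0)=1,\quad\mathcal{B}_3\tilde Y_n(1)=0.$$ Then each term of $\tilde u$ is well defined (each of these boundary value problems has a unique solution $\tilde Y_n$), and $\tilde u$ satisfies $$\Delta\tilde u+k^2\tilde u=0\ \text{ in }\Omega=(0,1)^2,\qquad\mathcal{B}_1\tilde u=g_1\ \text{ on }\Gamma_1,\qquad\mathcal{B}_3\tilde u=0\ \text{ on }\Gamma_3.$$ Furthermore, $\tilde u\in H^1(\Omega)$, the (Dirichlet) trace of $\tilde u$ is in $H^{\frac12}(\partial\Omega)$,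 and the trace of $\tilde u_x=\partial\tilde u/\partial x$ (the Neumann trace in the $x$-direction of $\tilde u$) is in $L^2(\partial\Omega)$.
   Context: $\Omega:=(0,1)^2$, $\Gamma_1:=(0,1)\times\{0\}$, $\Gamma_3:=(0,1)\times\{1\}$, $\mathbb{N}_0=\{0,1,2,\dots\}$. $\mathbf{I}_du=u$ (Dirichlet), and $\frac{\partial}{\partial\nu}$ is the outward normal derivative (Neumann), so for functions of $y$ on $(0,1)$, $\frac{\partial}{\partial\nu}\tilde Y(0)=-\tilde Y'(0)$ and $\frac{\partial}{\partial\nu}\tilde Y(1)=\tilde Y'(1)$. $\mathcal{B}_1=\mathcal{B}_3$ means that both are $\mathbf{I}_d$ or both are $\frac{\partial}{\partial\nu}$. Choice of $\tilde\mu_n$: let $d_0:=\inf_{n\in\mathbb{Z}}|k^2-n\pi^2|\in[0,\frac12\pi^2]$. For all $n\in\mathbb{N}_0$, $$\tilde\mu_n=\begin{cases}(n+\frac12)\pi,&\text{if }\mathcal{B}_1=\mathcal{B}_3\text{ and }d_0\in[0,\frac18\pi^2],\\ n\pi,&\text{if }\mathcal{B}_1=\mathcal{B}_3\text{ and }d_0\notin[0,\frac18\pi^2],\\ n\pi,&\text{if }\mathcal{B}_1\ne\mathcal{B}_3\text{ and }d_0\in[0,\frac18\pi^2]\cup[\frac38\pi^2,\frac12\pi^2],\\ (n+\frac12)\pi,&\text{if }\mathcal{B}_1\ne\mathcal{B}_3\text{ and }d_0\notin[0,\frac18\pi^2]\cup[\frac38\pi^2,\frac12\pi^2].\end{cases}$$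 Choice of $\tilde X_n$: if $\tilde\mu_n=n\pi$, then either $\tilde X_0=0$, $\tilde X_n(x)=\sqrt2\sin(n\pi x)$ ($n\ge1$), or $\tilde X_0=1$, $\tilde X_n(x)=\sqrt2\cos(n\pi x)$ ($n\ge1$). If $\tilde\mu_n=(n+\frac12)\pi$, then either $\tilde X_n(x)=\sqrt2\sin((n+\frac12)\pi x)$ for all $n\ge0$, or $\tilde X_n(x)=\sqrt2\cos((n+\frac12)\pi x)$ for all $n\ge0$. For $s\ge0$, $g\in\mathcal{Z}^s(\Gamma_1)$ means $g\in L^2(\Gamma_1)$ and $\|g\|_{\mathcal{Z}^s(\Gamma_1)}^2:=\sum_{n=0}^\infty|\widehat g(n)|^2\tilde\mu_n^{2s}<\infty$, where $\widehat g(n)=\int_0^1g(x)\tilde X_n(x)\,dx$ (with the chosen pairs $(\tilde\mu_n,\tilde X_n)$). The series defining $\tilde u$ is understood in $L^2(\Omega)$, derivatives in the weak sense, and boundary conditions in the sense of traces. *)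

theory Defs
  imports "HOL-Analysis.Analysis"
begin

text \<open>
  Functions that depend on the boundary datum are complex-valued; the eigenfunctions
  \<open>X n\<close> and the solutions \<open>Y n\<close> of the boundary value problems in \<open>y\<close> are real-valued.
\<close>

section \<open>Square-integrable functions\<close>

definition L2 :: "'a measure \<Rightarrow> ('a \<Rightarrow> complex) set" where
  "L2 M = {f. f \<in> borel_measurable M \<and> integrable M (\<lambda>x. (cmod (f x))\<^sup>2)}"

definition L2_norm :: "'a measure \<Rightarrow> ('a \<Rightarrow> complex) \<Rightarrow> real" where
  "L2_norm M f = sqrt (\<integral>x. (cmod (f x))\<^sup>2 \<partial>M)"

definition L2_tendsto :: "'a measure \<Rightarrow> (nat \<Rightarrow> 'a \<Rightarrow> complex) \<Rightarrow> ('a \<Rightarrow> complex) \<Rightarrow> bool" where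
  "L2_tendsto M f g \<longleftrightarrow>
     (\<forall>j. f j \<in> L2 M) \<and> g \<in> L2 M \<and> (\<lambda>j. L2_norm M (\<lambda>x. f j x - g x)) \<longlonglongrightarrow> 0"

section \<open>Weak derivatives and the Sobolev space H1\<close>

definition dir_deriv :: "'a::euclidean_space \<Rightarrow> ('a \<Rightarrow> complex) \<Rightarrow> 'a \<Rightarrow> complex" where
  "dir_deriv e f = (\<lambda>x. frechet_derivative f (at x) e)"

fun C_k :: "nat \<Rightarrow> ('a::euclidean_space \<Rightarrow> complex) \<Rightarrow> bool" where
  "C_k 0 f \<longleftrightarrow> continuous_on UNIV f"
| "C_k (Suc k) f \<longleftrightarrow> (\<forall>x. f differentiable (at x)) \<and> (\<forall>e\<in>Basis. C_k k (dir_deriv e f))"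

definition smooth :: "('a::euclidean_space \<Rightarrow> complex) \<Rightarrow> bool" where
  "smooth f \<longleftrightarrow> (\<forall>k. C_k k f)"

definition test_fun :: "'a::euclidean_space set \<Rightarrow> ('a \<Rightarrow> complex) \<Rightarrow> bool" where
  "test_fun S \<phi> \<longleftrightarrow>
     smooth \<phi> \<and> compact (closure {x. \<phi> x \<noteq> 0}) \<and> closure {x. \<phi> x \<noteq> 0} \<subseteq> S"

definition locally_integrable :: "'a::euclidean_space set \<Rightarrow> ('a \<Rightarrow> complex) \<Rightarrow> bool" where
  "locally_integrable S u \<longleftrightarrow> (\<forall>K. compact K \<and> K \<subseteq> S \<longrightarrow> set_integrable lebesgue K u)"

text \<open>\<open>v\<close> is the weak derivative of \<open>u\<close> in the direction of the vector \<open>e\<close> on the open set \<open>S\<close>;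
  it is determined by \<open>u\<close> up to null sets.\<close>

definition weak_deriv ::
  "'a::euclidean_space set \<Rightarrow> 'a \<Rightarrow> ('a \<Rightarrow> complex) \<Rightarrow> ('a \<Rightarrow> complex) \<Rightarrow> bool" where
  "weak_deriv S e u v \<longleftrightarrow>
     locally_integrable S u \<and> locally_integrable S v \<and>
     (\<forall>\<phi>. test_fun S \<phi> \<longrightarrow>
        (LINT x:S|lebesgue. u x * dir_deriv e \<phi> x) = - (LINT x:S|lebesgue. v x * \<phi> x))"

definition H1 :: "'a::euclidean_space set \<Rightarrow> ('a \<Rightarrow> complex) set" where
  "H1 S = {u. u \<in> L2 (lebesgue_on S) \<and>
              (\<forall>e\<in>Basis. \<exists>v. weak_deriv S e u v \<and> v \<in> L2 (lebesgue_on S))}"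

definition H1_tendsto ::
  "'a::euclidean_space set \<Rightarrow> (nat \<Rightarrow> 'a \<Rightarrow> complex) \<Rightarrow> ('a \<Rightarrow> complex) \<Rightarrow> bool" where
  "H1_tendsto S \<phi> u \<longleftrightarrow>
     L2_tendsto (lebesgue_on S) \<phi> u \<and>
     (\<forall>e\<in>Basis. \<exists>v. weak_deriv S e u v \<and>
        L2_tendsto (lebesgue_on S) (\<lambda>j. dir_deriv e (\<phi> j)) v)"

section \<open>The unit square, its boundary, and traces\<close>

definition \<Omega> :: "(real \<times> real) set" where
  "\<Omega> = {0<..<1} \<times> {0<..<1}"

text \<open>Counterclockwise arc length parametrisation of the boundary of \<open>\<Omega>\<close> over \<open>{0..<4}\<close>.\<close>

definition bd_param :: "real \<Rightarrow> real \<times> real" where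
  "bd_param t =
     (if t < 1 then (t, 0) else if t < 2 then (1, t - 1)
      else if t < 3 then (3 - t, 1) else (0, 4 - t))"

text \<open>Arc length measure on the boundary of \<open>\<Omega>\<close>, as a Borel measure on the plane.\<close>

definition bd_measure :: "(real \<times> real) measure" where
  "bd_measure = distr (restrict_space lborel {0..<4}) borel bd_param"

text \<open>
  The trace operator from \<open>H1 \<Omega>\<close> to \<open>L2\<close> of the boundary is the continuous extension of the
  restriction of functions that are smooth up to the boundary. It is given here by its graph;
  by the trace theorem \<open>w\<close> exists for every \<open>u \<in> H1 \<Omega>\<close> and is unique up to null sets.
\<close>

definition has_trace :: "(real \<times> real \<Rightarrow> complex) \<Rightarrow> (real \<times> real \<Rightarrow> complex) \<Rightarrow> bool" where
  "has_trace u w \<longleftrightarrow> u \<in> H1 \<Omega> \<and>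
     (\<exists>\<phi>. (\<forall>j. smooth (\<phi> j)) \<and> H1_tendsto \<Omega> \<phi> u \<and> L2_tendsto bd_measure \<phi> w)"

text \<open>Sobolev--Slobodeckij space of order 1/2 on the (one-dimensional) boundary of \<open>\<Omega>\<close>.\<close>

definition H_half_bd :: "(real \<times> real \<Rightarrow> complex) set" where
  "H_half_bd = {w. w \<in> L2 bd_measure \<and>
     (\<integral>\<^sup>+ p. (\<integral>\<^sup>+ q. ennreal ((cmod (w p - w q))\<^sup>2 / (dist p q)\<^sup>2) \<partial>bd_measure) \<partial>bd_measure) < \<infinity>}"

section \<open>Boundary operators and the Helmholtz equation\<close>

datatype bc = Dirichlet | Neumann

text \<open>
  The boundary condition \<open>B u = g\<close>, in the sense of traces, on the edge parametrised by \<open>\<gamma>\<close>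
  over \<open>{0<..<1}\<close>, with outward unit normal \<open>\<nu>\<close>. The Neumann datum is the trace of the weak
  derivative of \<open>u\<close> in the direction \<open>\<nu>\<close>.
\<close>

definition boundary_cond ::
  "bc \<Rightarrow> real \<times> real \<Rightarrow> (real \<Rightarrow> real \<times> real) \<Rightarrow> (real \<times> real \<Rightarrow> complex) \<Rightarrow> (real \<Rightarrow> complex) \<Rightarrow> bool"
  where
  "boundary_cond B \<nu> \<gamma> u g \<longleftrightarrow>
     (case B of
        Dirichlet \<Rightarrow> \<exists>w. has_trace u w \<and> (AE t in lebesgue_on {0<..<1}. w (\<gamma> t) = g t)
      | Neumann \<Rightarrow> \<exists>v w. weak_deriv \<Omega> \<nu> u v \<and> has_trace v w \<and>
                     (AE t in lebesgue_on {0<..<1}. w (\<gamma> t) = g t))"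

abbreviation bc_\<Gamma>1 :: "bc \<Rightarrow> (real \<times> real \<Rightarrow> complex) \<Rightarrow> (real \<Rightarrow> complex) \<Rightarrow> bool" where
  "bc_\<Gamma>1 B \<equiv> boundary_cond B (0, -1) (\<lambda>x. (x, 0))"

abbreviation bc_\<Gamma>3 :: "bc \<Rightarrow> (real \<times> real \<Rightarrow> complex) \<Rightarrow> (real \<Rightarrow> complex) \<Rightarrow> bool" where
  "bc_\<Gamma>3 B \<equiv> boundary_cond B (0, 1) (\<lambda>x. (x, 1))"

definition weak_helmholtz :: "real \<Rightarrow> (real \<times> real \<Rightarrow> complex) \<Rightarrow> bool" where
  "weak_helmholtz k u \<longleftrightarrow>
     (\<exists>ux uy uxx uyy.
        weak_deriv \<Omega> (1, 0) u ux \<and> weak_deriv \<Omega> (1, 0) ux uxx \<and>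
        weak_deriv \<Omega> (0, 1) u uy \<and> weak_deriv \<Omega> (0, 1) uy uyy \<and>
        (AE p in lebesgue_on \<Omega>. uxx p + uyy p + of_real (k\<^sup>2) * u p = 0))"

section \<open>The eigensystem and the boundary value problems in y\<close>

definition d0 :: "real \<Rightarrow> real" where
  "d0 k = (INF n::int. \<bar>k\<^sup>2 - of_int n * pi\<^sup>2\<bar>)"

definition mu :: "real \<Rightarrow> bc \<Rightarrow> bc \<Rightarrow> nat \<Rightarrow> real" where
  "mu k B1 B3 n =
     (if B1 = B3
      then (if d0 k \<in> {0..pi\<^sup>2 / 8} then (real n + 1/2) * pi else real n * pi)
      else (if d0 k \<in> {0..pi\<^sup>2 / 8} \<union> {3 * pi\<^sup>2 / 8..pi\<^sup>2 / 2}
            then real n * pi else (real n + 1/2) * pi))"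

text \<open>In the sine system for \<open>\<mu> n = n * pi\<close> the function with index 0 vanishes.\<close>

definition eigensystem :: "(nat \<Rightarrow> real) \<Rightarrow> (nat \<Rightarrow> real \<Rightarrow> real) \<Rightarrow> bool" where
  "eigensystem \<mu> X \<longleftrightarrow>
     \<mu> = (\<lambda>n. real n * pi) \<and>
       (X = (\<lambda>n x. if n = 0 then 0 else sqrt 2 * sin (real n * pi * x)) \<or>
        X = (\<lambda>n x. if n = 0 then 1 else sqrt 2 * cos (real n * pi * x)))
   \<or> \<mu> = (\<lambda>n. (real n + 1/2) * pi) \<and>
       (X = (\<lambda>n x. sqrt 2 * sin ((real n + 1/2) * pi * x)) \<or>
        X = (\<lambda>n x. sqrt 2 * cos ((real n + 1/2) * pi * x)))"

definition coeff :: "(nat \<Rightarrow> real \<Rightarrow> real) \<Rightarrow> (real \<Rightarrow> complex) \<Rightarrow> nat \<Rightarrow> complex" where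
  "coeff X g n = (LINT x:{0<..<1}|lebesgue. g x * of_real (X n x))"

text \<open>Only orders \<open>s > 0\<close> are used; note that \<open>0 powr 0 = 0\<close>, which matters for \<open>s = 0\<close>, \<open>\<mu> 0 = 0\<close>.\<close>

definition Z_space :: "(nat \<Rightarrow> real) \<Rightarrow> (nat \<Rightarrow> real \<Rightarrow> real) \<Rightarrow> real \<Rightarrow> (real \<Rightarrow> complex) set" where
  "Z_space \<mu> X s = {g. g \<in> L2 (lebesgue_on {0<..<1}) \<and>
     summable (\<lambda>n. (cmod (coeff X g n))\<^sup>2 * \<mu> n powr (2 * s))}"

text \<open>Classical solutions, continuously differentiable up to the end points; the outward normal
  derivative is \<open>- Y' 0\<close> at 0 and \<open>Y' 1\<close> at 1.\<close>

definition bvp_solution :: "real \<Rightarrow> real \<Rightarrow> bc \<Rightarrow> bc \<Rightarrow> (real \<Rightarrow> real) \<Rightarrow> bool" where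
  "bvp_solution k m B1 B3 Y \<longleftrightarrow>
     (\<exists>Y' Y''.
        (\<forall>y\<in>{0..1}. (Y has_real_derivative Y' y) (at y within {0..1})) \<and>
        continuous_on {0..1} Y' \<and>
        (\<forall>y\<in>{0<..<1}. (Y' has_real_derivative Y'' y) (at y) \<and> Y'' y + (k\<^sup>2 - m\<^sup>2) * Y y = 0) \<and>
        (case B1 of Dirichlet \<Rightarrow> Y 0 | Neumann \<Rightarrow> - Y' 0) = 1 \<and>
        (case B3 of Dirichlet \<Rightarrow> Y 1 | Neumann \<Rightarrow> Y' 1) = 0)"

definition series_term ::
  "(nat \<Rightarrow> real \<Rightarrow> real) \<Rightarrow> (nat \<Rightarrow> real \<Rightarrow> real) \<Rightarrow> (real \<Rightarrow> complex) \<Rightarrow> nat \<Rightarrow> real \<times> real \<Rightarrow> complex"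
  where
  "series_term X Y g n = (\<lambda>(x, y). coeff X g n * of_real (X n x) * of_real (Y n y))"

definition L2_sums :: "(nat \<Rightarrow> real \<times> real \<Rightarrow> complex) \<Rightarrow> (real \<times> real \<Rightarrow> complex) \<Rightarrow> bool" where
  "L2_sums f u \<longleftrightarrow> L2_tendsto (lebesgue_on \<Omega>) (\<lambda>N p. \<Sum>n<N. f n p) u"

end

theory Submission
  imports Defs
begin

text \<open>
  The four-case rule for \<open>\<mu>\<^sub>n\<close> keeps \<open>k\<^sup>2 - \<mu>\<^sub>n\<^sup>2\<close> away from the eigenvalues of the problem in \<open>y\<close>: an
  eigenvalue would put \<open>k\<^sup>2 / pi\<^sup>2\<close> at distance 0, 1/4 or 1/2 from the integers, contradicting the choice
  of \<open>\<mu>\<^sub>n\<close>. For large \<open>n\<close> the solution \<open>Y n\<close> decays like \<open>exp (- \<mu>\<^sub>n y / 2)\<close>, with an additional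
  factor \<open>1 / \<mu>\<^sub>n\<close> for a Neumann datum. Since the \<open>X n\<close>, and also their derivatives, are orthogonal, the
  regularity of the datum is exactly what makes all second derivatives of the partial sums converge in
  \<open>L2 \<Omega>\<close>. The partial sums are smooth solutions of the equation, so the equation, weak derivatives and
  (by a trace inequality) the traces pass to the limit. On the first edge the partial sums reproduce
  those of the expansion of the datum, which converges to it because the eigensystem is complete.
  Finally the series converges uniformly to a function that is Hoelder continuous of exponent 3/4, and
  an exponent larger than 1/2 bounds the Gagliardo seminorm on the boundary.
\<close>

section \<open>Convergence in L2\<close>

text \<open>A trace is defined through approximants that are smooth on the whole plane, whereas a
  solution of the problem in y is prescribed on [0,1] only. The given solutions are therefore
  exchanged for the closed formula \<open>bvp_sol\<close>, which is smooth on the real line, and the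
  partial sums themselves serve as approximants. A Neumann datum, like the trace of the
  x-derivative, is a trace of a first derivative of u. That derivative must itself lie in H1, which
  is why second derivatives enter although u is only claimed to be in H1. The exponent 3/4 is a
  choice from an open interval. Write m for \<mu> n and w for \<open>bc_weight\<close>: the data
  condition says that c n * w * m^(3/2) is square summable. By Cauchy-Schwarz, c n * w * m^s is
  summable as soon as the sum of m^(2s - 3) converges, which holds for s < 1 because m grows
  linearly. On the other side, H^(1/2) of a curve asks for s > 1/2.\<close>

definition sqn :: "'a measure \<Rightarrow> ('a \<Rightarrow> complex) \<Rightarrow> real" where
  "sqn M f = (\<integral>x. (cmod (f x))\<^sup>2 \<partial>M)"

lemma sqn_nonneg [simp]: "0 \<le> sqn M f"
  by (simp add: sqn_def)

lemma sqn_cong: "(\<And>x. x \<in> space M \<Longrightarrow> f x = g x) \<Longrightarrow> sqn M f = sqn M g"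
  by (auto simp: sqn_def intro!: Bochner_Integration.integral_cong)

lemma sqn_minus_commute: "sqn M (\<lambda>x. f x - g x) = sqn M (\<lambda>x. g x - f x)"
  by (simp add: sqn_def norm_minus_commute)

lemma L2_cong: "(\<And>x. x \<in> space M \<Longrightarrow> f x = g x) \<Longrightarrow> f \<in> L2 M \<longleftrightarrow> g \<in> L2 M"
  unfolding L2_def mem_Collect_eq
  by (intro conj_cong measurable_cong Bochner_Integration.integrable_cong) auto

lemma L2_measurable: "f \<in> L2 M \<Longrightarrow> f \<in> borel_measurable M"
  by (simp add: L2_def)

lemma L2_integrable_power2: "f \<in> L2 M \<Longrightarrow> integrable M (\<lambda>x. (cmod (f x))\<^sup>2)"
  by (simp add: L2_def)

lemma power2_norm_add_le: "(cmod (a + b))\<^sup>2 \<le> 2 * (cmod a)\<^sup>2 + 2 * (cmod b)\<^sup>2"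
proof -
  have "(cmod (a + b))\<^sup>2 \<le> (cmod a + cmod b)\<^sup>2"
    by (intro power_mono norm_triangle_ineq) auto
  also have "\<dots> \<le> 2 * (cmod a)\<^sup>2 + 2 * (cmod b)\<^sup>2"
    using sum_squares_bound[of "cmod a" "cmod b"] by (simp add: power2_sum)
  finally show ?thesis .
qed

lemma L2_add [intro]:
  assumes "f \<in> L2 M" "g \<in> L2 M"
  shows "(\<lambda>x. f x + g x) \<in> L2 M"
proof -
  note [measurable] = L2_measurable[OF assms(1)] L2_measurable[OF assms(2)]
  have "integrable M (\<lambda>x. (cmod (f x + g x))\<^sup>2)"
    by (rule Bochner_Integration.integrable_bound
        [of _ "\<lambda>x. 2 * (cmod (f x))\<^sup>2 + 2 * (cmod (g x))\<^sup>2"])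
      (use assms power2_norm_add_le in \<open>auto intro!: Bochner_Integration.integrable_add
         integrable_mult_right L2_integrable_power2\<close>)
  then show ?thesis by (simp add: L2_def)
qed

lemma L2_cmult [intro]: "f \<in> L2 M \<Longrightarrow> (\<lambda>x. c * f x) \<in> L2 M"
  by (auto simp: L2_def norm_mult power_mult_distrib)

lemma L2_diff [intro]: "f \<in> L2 M \<Longrightarrow> g \<in> L2 M \<Longrightarrow> (\<lambda>x. f x - g x) \<in> L2 M"
  using L2_add[of f M "\<lambda>x. (-1) * g x"] L2_cmult[of g M "-1"] by simp

lemma L2_zero [simp, intro]: "(\<lambda>x. 0) \<in> L2 M"
  by (simp add: L2_def)

lemma L2_bounded:
  assumes "finite_measure M" "f \<in> borel_measurable M" "\<And>x. x \<in> space M \<Longrightarrow> cmod (f x) \<le> B"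
  shows "f \<in> L2 M"
proof -
  interpret finite_measure M by fact
  have "integrable M (\<lambda>x. (cmod (f x))\<^sup>2)"
    by (rule integrable_const_bound[where B = "B\<^sup>2"])
      (use assms in \<open>auto intro!: power_mono AE_I2\<close>)
  then show ?thesis using assms by (simp add: L2_def)
qed

lemma sqn_add_le:
  assumes "f \<in> L2 M" "g \<in> L2 M"
  shows "sqn M (\<lambda>x. f x + g x) \<le> 2 * sqn M f + 2 * sqn M g"
proof -
  have "sqn M (\<lambda>x. f x + g x) \<le> (\<integral>x. 2 * (cmod (f x))\<^sup>2 + 2 * (cmod (g x))\<^sup>2 \<partial>M)"
    unfolding sqn_def
    by (intro integral_mono Bochner_Integration.integrable_add integrable_mult_right
        L2_integrable_power2 assms L2_add power2_norm_add_le)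
  also have "\<dots> = 2 * sqn M f + 2 * sqn M g"
    using assms by (simp add: sqn_def L2_integrable_power2)
  finally show ?thesis .
qed

lemma sqn_diff_le:
  assumes "f \<in> L2 M" "g \<in> L2 M" "h \<in> L2 M"
  shows "sqn M (\<lambda>x. f x - h x) \<le> 2 * sqn M (\<lambda>x. f x - g x) + 2 * sqn M (\<lambda>x. h x - g x)"
proof -
  have "sqn M (\<lambda>x. (f x - g x) + (g x - h x))
          \<le> 2 * sqn M (\<lambda>x. f x - g x) + 2 * sqn M (\<lambda>x. g x - h x)"
    by (rule sqn_add_le) (use assms in auto)
  then show ?thesis by (simp add: sqn_minus_commute[of M g h])
qed

lemma sqn_cmult: "sqn M (\<lambda>x. c * f x) = (cmod c)\<^sup>2 * sqn M f"
  by (simp add: sqn_def norm_mult power_mult_distrib)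

lemma L2_norm_eq: "L2_norm M f = sqrt (sqn M f)"
  by (simp add: L2_norm_def sqn_def)

text \<open>Squared norms are used throughout because orthogonality makes them additive. The square
  root and its inverse are both continuous at 0, so the notion of convergence is the same.\<close>

lemma L2_tendsto_iff:
  "L2_tendsto M f g \<longleftrightarrow>
     (\<forall>j. f j \<in> L2 M) \<and> g \<in> L2 M \<and> (\<lambda>j. sqn M (\<lambda>x. f j x - g x)) \<longlonglongrightarrow> 0"
proof -
  have "(\<lambda>j. sqrt (sqn M (\<lambda>x. f j x - g x))) \<longlonglongrightarrow> 0 \<longleftrightarrow>
        (\<lambda>j. sqn M (\<lambda>x. f j x - g x)) \<longlonglongrightarrow> 0" (is "?L \<longleftrightarrow> ?R")
  proof
    assume ?L
    from tendsto_power[OF this, of 2] show ?R by simp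
  next
    assume ?R
    from tendsto_real_sqrt[OF this] show ?L by simp
  qed
  then show ?thesis by (simp add: L2_tendsto_def L2_norm_eq)
qed

lemma L2_tendstoD:
  assumes "L2_tendsto M f g"
  shows "f j \<in> L2 M" "g \<in> L2 M" "(\<lambda>j. sqn M (\<lambda>x. f j x - g x)) \<longlonglongrightarrow> 0"
  using assms by (auto simp: L2_tendsto_iff)

lemma L2_tendsto_cong:
  assumes "\<And>j x. x \<in> space M \<Longrightarrow> f j x = f' j x" "\<And>x. x \<in> space M \<Longrightarrow> g x = g' x"
  shows "L2_tendsto M f g \<longleftrightarrow> L2_tendsto M f' g'"
proof -
  have "f j \<in> L2 M \<longleftrightarrow> f' j \<in> L2 M" for j using assms by (intro L2_cong) auto
  moreover have "g \<in> L2 M \<longleftrightarrow> g' \<in> L2 M" using assms by (intro L2_cong) auto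
  moreover have "sqn M (\<lambda>x. f j x - g x) = sqn M (\<lambda>x. f' j x - g' x)" for j
    using assms by (intro sqn_cong) auto
  ultimately show ?thesis by (simp add: L2_tendsto_iff)
qed

lemma L2_tendsto_const: "g \<in> L2 M \<Longrightarrow> L2_tendsto M (\<lambda>_. g) g"
  by (simp add: L2_tendsto_iff sqn_def)

lemma L2_tendsto_add:
  assumes "L2_tendsto M f g" "L2_tendsto M f' g'"
  shows "L2_tendsto M (\<lambda>j x. f j x + f' j x) (\<lambda>x. g x + g' x)"
proof -
  note A = L2_tendstoD[OF assms(1)] and B = L2_tendstoD[OF assms(2)]
  have "(\<lambda>j. 2 * sqn M (\<lambda>x. f j x - g x) + 2 * sqn M (\<lambda>x. f' j x - g' x)) \<longlonglongrightarrow> 2 * 0 + 2 * 0"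
    by (intro tendsto_intros A B)
  then have lim: "(\<lambda>j. 2 * sqn M (\<lambda>x. f j x - g x) + 2 * sqn M (\<lambda>x. f' j x - g' x)) \<longlonglongrightarrow> 0"
    by simp
  have "sqn M (\<lambda>x. (f j x + f' j x) - (g x + g' x))
          \<le> 2 * sqn M (\<lambda>x. f j x - g x) + 2 * sqn M (\<lambda>x. f' j x - g' x)" for j
    using sqn_add_le[of "\<lambda>x. f j x - g x" M "\<lambda>x. f' j x - g' x"] A B
    by (auto simp: algebra_simps)
  then have "(\<lambda>j. sqn M (\<lambda>x. (f j x + f' j x) - (g x + g' x))) \<longlonglongrightarrow> 0"
    by (intro tendsto_sandwich[OF _ _ tendsto_const lim] always_eventually) auto
  then show ?thesis using A B by (auto simp: L2_tendsto_iff)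
qed

lemma L2_tendsto_cmult:
  assumes "L2_tendsto M f g"
  shows "L2_tendsto M (\<lambda>j x. c * f j x) (\<lambda>x. c * g x)"
proof -
  note A = L2_tendstoD[OF assms(1)]
  have "(\<lambda>j. (cmod c)\<^sup>2 * sqn M (\<lambda>x. f j x - g x)) \<longlonglongrightarrow> (cmod c)\<^sup>2 * 0"
    by (intro tendsto_intros A)
  moreover have "sqn M (\<lambda>x. c * f j x - c * g x) = (cmod c)\<^sup>2 * sqn M (\<lambda>x. f j x - g x)" for j
    by (simp add: sqn_cmult flip: right_diff_distrib)
  ultimately show ?thesis using A by (auto simp: L2_tendsto_iff)
qed

lemma L2_tendsto_unique:
  assumes "L2_tendsto M f g" "L2_tendsto M f h"
  shows "AE x in M. g x = h x"
proof -
  note A = L2_tendstoD[OF assms(1)] and B = L2_tendstoD[OF assms(2)]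
  have "(\<lambda>j. 2 * sqn M (\<lambda>x. f j x - g x) + 2 * sqn M (\<lambda>x. f j x - h x)) \<longlonglongrightarrow> 2 * 0 + 2 * 0"
    by (intro tendsto_intros A B)
  moreover have "sqn M (\<lambda>x. g x - h x) \<le> 2 * sqn M (\<lambda>x. f j x - g x) + 2 * sqn M (\<lambda>x. f j x - h x)"
    for j
    using sqn_diff_le[OF A(2) A(1) B(2), of j]
    unfolding sqn_minus_commute[of M g "f j"] sqn_minus_commute[of M h "f j"] .
  ultimately have "sqn M (\<lambda>x. g x - h x) \<le> 0"
    by (intro LIMSEQ_le_const[of _ 0]) auto
  then have "sqn M (\<lambda>x. g x - h x) = 0" using sqn_nonneg[of M "\<lambda>x. g x - h x"] by linarith
  then have "AE x in M. (cmod (g x - h x))\<^sup>2 = 0"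
    unfolding sqn_def
    by (subst (asm) integral_nonneg_eq_0_iff_AE)
      (use A(2) B(2) in \<open>auto intro!: L2_integrable_power2\<close>)
  then show ?thesis by simp
qed

text \<open>By the arithmetic-geometric mean inequality |f| * B is at most B^2 + |f|^2, which is
  integrable for a finite measure. With \<psi> = 1 this is the inclusion of L2 in L1.\<close>

lemma L2_imp_integrable:
  assumes "finite_measure M" "f \<in> L2 M" "\<psi> \<in> borel_measurable M" "\<And>x. x \<in> space M \<Longrightarrow> cmod (\<psi> x) \<le> B"
  shows "integrable M (\<lambda>x. f x * \<psi> x)"
proof -
  interpret finite_measure M by fact
  note [measurable] = L2_measurable[OF assms(2)] assms(3)
  show ?thesis
  proof (rule Bochner_Integration.integrable_bound[of _ "\<lambda>x. B\<^sup>2 + (cmod (f x))\<^sup>2"])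
    show "AE x in M. norm (f x * \<psi> x) \<le> norm (B\<^sup>2 + (cmod (f x))\<^sup>2)"
    proof (intro AE_I2)
      fix x assume x: "x \<in> space M"
      have "norm (f x * \<psi> x) \<le> cmod (f x) * B"
        using assms(4)[OF x] by (simp add: norm_mult mult_left_mono)
      also have "\<dots> \<le> B\<^sup>2 + (cmod (f x))\<^sup>2"
        using sum_squares_bound[of "cmod (f x)" B] zero_le_power2[of B] zero_le_power2[of "cmod (f x)"]
        by linarith
      finally show "norm (f x * \<psi> x) \<le> norm (B\<^sup>2 + (cmod (f x))\<^sup>2)" by simp
    qed
  qed (use assms(2) in \<open>auto intro!: L2_integrable_power2\<close>)
qed

text \<open>Cauchy-Schwarz against the constant 1: expanding the integral of (m * |f| - I)^2, where
  m is the total mass and I the L1 norm, leaves m * (m * \<open>sqn M f\<close> - I^2). A measure of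
  mass 0 has to be treated apart.\<close>

lemma L1_norm_le_sqn:
  assumes "finite_measure M" "f \<in> L2 M"
  shows "(\<integral>x. cmod (f x) \<partial>M)\<^sup>2 \<le> measure M (space M) * sqn M f"
proof -
  interpret finite_measure M by fact
  note [measurable] = L2_measurable[OF assms(2)]
  have int: "integrable M (\<lambda>x. cmod (f x))"
    using L2_imp_integrable[OF assms, of "\<lambda>_. 1" 1] by simp
  define m where "m = measure M (space M)"
  define I where "I = (\<integral>x. cmod (f x) \<partial>M)"
  have "0 \<le> (\<integral>x. (m * cmod (f x) - I)\<^sup>2 \<partial>M)" by simp
  also have "\<dots> = (\<integral>x. m\<^sup>2 * (cmod (f x))\<^sup>2 - 2 * m * I * cmod (f x) + I\<^sup>2 \<partial>M)"
    by (simp add: power2_diff power_mult_distrib algebra_simps)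
  also have "\<dots> = m\<^sup>2 * sqn M f - 2 * m * I * I + I\<^sup>2 * m"
    using int L2_integrable_power2[OF assms(2)] by (simp add: sqn_def I_def m_def)
  finally have "0 \<le> m * (m * sqn M f - I\<^sup>2)" by (simp add: power2_eq_square algebra_simps)
  moreover have "m \<ge> 0" by (simp add: m_def)
  moreover have "I\<^sup>2 \<le> m * sqn M f" if "m = 0"
  proof -
    have "AE x in M. cmod (f x) = 0"
      by (rule AE_I[of _ _ "space M"]) (use that in \<open>auto simp: m_def emeasure_eq_measure\<close>)
    then have "I = 0" unfolding I_def by (intro integral_eq_zero_AE)
    then show ?thesis by (simp add: that)
  qed
  ultimately show ?thesis
    unfolding I_def[symmetric] m_def[symmetric] by (cases "m = 0") (auto simp: zero_le_mult_iff)
qed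

text \<open>Pairing with a bounded function is continuous in L1, hence in L2. It transfers the weak
  formulation and the Fourier coefficients to limits.\<close>

lemma L2_tendsto_integral_mult:
  assumes "finite_measure M" "L2_tendsto M f g"
    and "\<psi> \<in> borel_measurable M" "\<And>x. x \<in> space M \<Longrightarrow> cmod (\<psi> x) \<le> B"
  shows "(\<lambda>j. \<integral>x. f j x * \<psi> x \<partial>M) \<longlonglongrightarrow> (\<integral>x. g x * \<psi> x \<partial>M)"
proof -
  interpret finite_measure M by fact
  note A = L2_tendstoD[OF assms(2)]
  note int = L2_imp_integrable[OF assms(1) _ assms(3,4)]
  define m where "m = measure M (space M)"
  have "norm ((\<integral>x. f j x * \<psi> x \<partial>M) - (\<integral>x. g x * \<psi> x \<partial>M))
          \<le> \<bar>B\<bar> * sqrt (m * sqn M (\<lambda>x. f j x - g x))" for j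
  proof -
    have d: "(\<lambda>x. f j x - g x) \<in> L2 M" using A by auto
    have "(\<integral>x. f j x * \<psi> x \<partial>M) - (\<integral>x. g x * \<psi> x \<partial>M) = (\<integral>x. (f j x - g x) * \<psi> x \<partial>M)"
      using int[OF A(1), of j] int[OF A(2)] by (simp add: left_diff_distrib)
    also have "norm \<dots> \<le> (\<integral>x. norm ((f j x - g x) * \<psi> x) \<partial>M)" by (rule integral_norm_bound)
    also have "\<dots> \<le> (\<integral>x. \<bar>B\<bar> * cmod (f j x - g x) \<partial>M)"
    proof (rule integral_mono)
      show "integrable M (\<lambda>x. norm ((f j x - g x) * \<psi> x))" using int[OF d] by (rule integrable_norm)
      have "integrable M (\<lambda>x. f j x - g x)"
        using L2_imp_integrable[OF assms(1) d, of "\<lambda>_. 1" 1] by simp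
      then show "integrable M (\<lambda>x. \<bar>B\<bar> * cmod (f j x - g x))" by simp
      fix x assume "x \<in> space M"
      then have "cmod (\<psi> x) \<le> \<bar>B\<bar>" using assms(4)[of x] by linarith
      then show "norm ((f j x - g x) * \<psi> x) \<le> \<bar>B\<bar> * cmod (f j x - g x)"
        by (simp add: norm_mult mult.commute[of "\<bar>B\<bar>"] mult_left_mono)
    qed
    also have "\<dots> = \<bar>B\<bar> * (\<integral>x. cmod (f j x - g x) \<partial>M)" by simp
    also have "(\<integral>x. cmod (f j x - g x) \<partial>M) \<le> sqrt (m * sqn M (\<lambda>x. f j x - g x))"
      unfolding m_def by (intro real_le_rsqrt L1_norm_le_sqn assms d)
    finally show ?thesis by (simp add: mult_left_mono)
  qed
  moreover have "(\<lambda>j. \<bar>B\<bar> * sqrt (m * sqn M (\<lambda>x. f j x - g x))) \<longlonglongrightarrow> 0"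
    using tendsto_mult[OF tendsto_const[of "\<bar>B\<bar>"]
        tendsto_real_sqrt[OF tendsto_mult[OF tendsto_const[of m] A(3)]]]
    by simp
  ultimately have "(\<lambda>j. (\<integral>x. f j x * \<psi> x \<partial>M) - (\<integral>x. g x * \<psi> x \<partial>M)) \<longlonglongrightarrow> 0"
    by (rule Lim_null_comparison[OF always_eventually[OF allI]])
  then show ?thesis by (simp add: LIM_zero_iff)
qed

text \<open>Riesz-Fischer: a Cauchy sequence in L2 is Cauchy in L1, so a subsequence converges
  almost everywhere, and Fatou's lemma along that subsequence bounds the distance of every late
  member to the pointwise limit.\<close>

lemma L2_complete:
  assumes "finite_measure M" "\<And>j. f j \<in> L2 M"
    and Cauchy: "\<And>e. e > 0 \<Longrightarrow> \<exists>N. \<forall>i\<ge>N. \<forall>j\<ge>N. sqn M (\<lambda>x. f i x - f j x) \<le> e"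
  shows "\<exists>g. L2_tendsto M f g"
proof -
  interpret finite_measure M by fact
  note [measurable] = L2_measurable[OF assms(2)]
  have d: "(\<lambda>x. f i x - f j x) \<in> L2 M" for i j using assms by auto
  define m where "m = measure M (space M)"
  have "m \<ge> 0" by (simp add: m_def)
  have "\<exists>N. \<forall>i\<ge>N. \<forall>j\<ge>N. (\<integral>x. norm (f i x - f j x) \<partial>M) < e" if e: "e > 0" for e
  proof -
    \<comment> \<open>The bound is chosen so that Cauchy-Schwarz yields e/2, which is strictly below
      e; m + 1 replaces m to keep the quotient meaningful when the mass is 0.\<close>
    obtain N where N: "\<And>i j. i \<ge> N \<Longrightarrow> j \<ge> N \<Longrightarrow> sqn M (\<lambda>x. f i x - f j x) \<le> (e/2)\<^sup>2 / (m + 1)"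
    proof -
      have "(e/2)\<^sup>2 / (m + 1) > 0" using e \<open>m \<ge> 0\<close> by simp
      from Cauchy[OF this] show ?thesis using that by blast
    qed
    have "(\<integral>x. norm (f i x - f j x) \<partial>M) < e" if "i \<ge> N" "j \<ge> N" for i j
    proof -
      have "(\<integral>x. norm (f i x - f j x) \<partial>M)\<^sup>2 \<le> m * sqn M (\<lambda>x. f i x - f j x)"
        unfolding m_def by (intro L1_norm_le_sqn assms d)
      also have "\<dots> \<le> (m + 1) * ((e/2)\<^sup>2 / (m + 1))"
        using N[OF that] \<open>m \<ge> 0\<close> by (intro mult_mono) auto
      also have "\<dots> = (e/2)\<^sup>2" using \<open>m \<ge> 0\<close> by simp
      finally have "(\<integral>x. norm (f i x - f j x) \<partial>M) \<le> e/2"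
        by (rule power2_le_imp_le) (use e in simp)
      then show ?thesis using e by simp
    qed
    then show ?thesis by blast
  qed
  moreover have "integrable M (f j)" for j
    using L2_imp_integrable[OF assms(1,2), of "\<lambda>_. 1" 1] by simp
  ultimately obtain r where r: "strict_mono r" and AE: "AE x in M. Cauchy (\<lambda>i. f (r i) x)"
    using cauchy_L1_AE_cauchy_subseq[of M f] by blast
  \<comment> \<open>Where the subsequence diverges \<open>lim\<close> has an unspecified value, but
    g is still measurable and only a null set is affected.\<close>
  define g where "g = (\<lambda>x. lim (\<lambda>i. f (r i) x))"
  have [measurable]: "g \<in> borel_measurable M"
    unfolding g_def by measurable
  have lim: "AE x in M. (\<lambda>i. f (r i) x) \<longlonglongrightarrow> g x"
    using AE by eventually_elim (simp add: g_def Cauchy_convergent_iff convergent_LIMSEQ_iff)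
  have fatou: "(\<integral>\<^sup>+x. ennreal ((cmod (f i x - g x))\<^sup>2) \<partial>M) \<le> ennreal e"
    if N: "\<And>i j. i \<ge> N \<Longrightarrow> j \<ge> N \<Longrightarrow> sqn M (\<lambda>x. f i x - f j x) \<le> e" and "i \<ge> N" for N i e
  proof -
    have "(\<integral>\<^sup>+x. ennreal ((cmod (f i x - g x))\<^sup>2) \<partial>M) =
          (\<integral>\<^sup>+x. liminf (\<lambda>k. ennreal ((cmod (f i x - f (r k) x))\<^sup>2)) \<partial>M)"
    proof (rule nn_integral_cong_AE)
      show "AE x in M. ennreal ((cmod (f i x - g x))\<^sup>2) =
          liminf (\<lambda>k. ennreal ((cmod (f i x - f (r k) x))\<^sup>2))"
        using lim
      proof eventually_elim
        case (elim x)
        have "(\<lambda>k. ennreal ((cmod (f i x - f (r k) x))\<^sup>2)) \<longlonglongrightarrow> ennreal ((cmod (f i x - g x))\<^sup>2)"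
          by (intro tendsto_intros elim tendsto_ennrealI)
        then show ?case by (intro lim_imp_Liminf[symmetric]) auto
      qed
    qed
    also have "\<dots> \<le> liminf (\<lambda>k. \<integral>\<^sup>+x. ennreal ((cmod (f i x - f (r k) x))\<^sup>2) \<partial>M)"
      by (rule nn_integral_liminf) measurable
    also have "\<dots> \<le> ennreal e"
    proof -
      have "eventually (\<lambda>k. (\<integral>\<^sup>+x. ennreal ((cmod (f i x - f (r k) x))\<^sup>2) \<partial>M) \<le> ennreal e) sequentially"
        using eventually_ge_at_top[of N]
      proof eventually_elim
        case (elim k)
        then have "r k \<ge> N" using seq_suble[OF r, of k] by simp
        then show ?case
          using N[OF \<open>i \<ge> N\<close>, of "r k"] L2_integrable_power2[OF d, of i "r k"]
          by (subst nn_integral_eq_integral) (auto simp: sqn_def intro!: ennreal_leI)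
      qed
      then have "liminf (\<lambda>k. \<integral>\<^sup>+x. ennreal ((cmod (f i x - f (r k) x))\<^sup>2) \<partial>M) \<le> liminf (\<lambda>k::nat. ennreal e)"
        by (rule Liminf_mono)
      then show ?thesis by (simp add: Liminf_const)
    qed
    finally show ?thesis .
  qed
  have diff: "(\<lambda>x. f i x - g x) \<in> L2 M \<and> sqn M (\<lambda>x. f i x - g x) \<le> e"
    if N: "\<And>i j. i \<ge> N \<Longrightarrow> j \<ge> N \<Longrightarrow> sqn M (\<lambda>x. f i x - f j x) \<le> e" and "i \<ge> N" for N i e
  proof -
    have "e \<ge> 0" using N[of i i] \<open>i \<ge> N\<close> by (simp add: sqn_def)
    have "integrable M (\<lambda>x. (cmod (f i x - g x))\<^sup>2)"
      using le_less_trans[OF fatou[OF that]] by (intro integrableI_bounded) auto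
    moreover have "sqn M (\<lambda>x. f i x - g x) \<le> e"
      unfolding sqn_def by (intro integral_real_bounded fatou[OF that] \<open>e \<ge> 0\<close>)
    ultimately show ?thesis by (simp add: L2_def)
  qed
  obtain N0 where N0: "\<And>i j. i \<ge> N0 \<Longrightarrow> j \<ge> N0 \<Longrightarrow> sqn M (\<lambda>x. f i x - f j x) \<le> 1"
    using Cauchy[of 1] by auto
  have "(\<lambda>x. f N0 x - g x) \<in> L2 M"
    using diff[of N0 1 N0] N0 by blast
  from L2_diff[OF assms(2)[of N0] this]
  have gL: "g \<in> L2 M" by simp
  have "(\<lambda>j. sqn M (\<lambda>x. f j x - g x)) \<longlonglongrightarrow> 0"
  proof (rule LIMSEQ_I)
    fix e :: real assume "e > 0"
    then obtain N where N: "\<And>i j. i \<ge> N \<Longrightarrow> j \<ge> N \<Longrightarrow> sqn M (\<lambda>x. f i x - f j x) \<le> e/2"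
      using Cauchy[of "e/2"] by auto
    have "norm (sqn M (\<lambda>x. f i x - g x) - 0) < e" if "i \<ge> N" for i
      using diff[of N "e/2" i] N that \<open>e > 0\<close> by auto
    then show "\<exists>no. \<forall>n\<ge>no. norm (sqn M (\<lambda>x. f n x - g x) - 0) < e" by blast
  qed
  then show ?thesis using gL assms(2) by (auto simp: L2_tendsto_iff)
qed

lemma L2_tendsto_Cauchy:
  assumes "L2_tendsto M f g" "e > 0"
  shows "\<exists>N. \<forall>i\<ge>N. \<forall>j\<ge>N. sqn M (\<lambda>x. f i x - f j x) \<le> e"
proof -
  note A = L2_tendstoD[OF assms(1)]
  obtain N where N: "\<And>j. j \<ge> N \<Longrightarrow> norm (sqn M (\<lambda>x. f j x - g x) - 0) < e/4"
    using LIMSEQ_D[OF A(3), of "e/4"] assms(2) by auto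
  have "sqn M (\<lambda>x. f i x - f j x) \<le> e" if "i \<ge> N" "j \<ge> N" for i j
    using sqn_diff_le[OF A(1) A(2) A(1), of i j] N[OF that(1)] N[OF that(2)] by simp
  then show ?thesis by blast
qed

text \<open>Only blocks of consecutive terms have to be controlled. For orthogonal terms
  \<open>b n\<close> is the squared norm of the n-th one, and the bound on blocks is
  Pythagoras.\<close>

lemma L2_series_converges:
  fixes h :: "nat \<Rightarrow> 'a \<Rightarrow> complex"
  assumes "finite_measure M" "\<And>n. h n \<in> L2 M" "summable b"
    and le: "\<And>i j. i \<le> j \<Longrightarrow> sqn M (\<lambda>x. \<Sum>n=i..<j. h n x) \<le> (\<Sum>n=i..<j. b n)"
  shows "\<exists>g. L2_tendsto M (\<lambda>N x. \<Sum>n<N. h n x) g"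
proof (rule L2_complete)
  show "(\<lambda>x. \<Sum>n<j. h n x) \<in> L2 M" for j
    by (induction j) (auto simp: assms)
  fix e :: real assume "e > 0"
  then obtain N where N: "\<And>m n. m \<ge> N \<Longrightarrow> norm (sum b {m..<n}) < e"
    using \<open>summable b\<close> unfolding summable_Cauchy by blast
  have *: "sqn M (\<lambda>x. (\<Sum>n<j. h n x) - (\<Sum>n<i. h n x)) \<le> e" if "i \<ge> N" "i \<le> j" for i j
  proof -
    have "(\<Sum>n<j. h n x) - (\<Sum>n<i. h n x) = (\<Sum>n=i..<j. h n x)" for x
      using that(2) by (simp add: sum_diff_nat_ivl flip: atLeast0LessThan)
    then show ?thesis using le[OF that(2)] N[OF that(1), of j] by simp
  qed
  have "sqn M (\<lambda>x. (\<Sum>n<i. h n x) - (\<Sum>n<j. h n x)) \<le> e" if "i \<ge> N" "j \<ge> N" for i j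
    using *[of i j] *[of j i] that sqn_minus_commute[of M "\<lambda>x. \<Sum>n<i. h n x" "\<lambda>x. \<Sum>n<j. h n x"]
    by (cases "i \<le> j") auto
  then show "\<exists>N. \<forall>i\<ge>N. \<forall>j\<ge>N. sqn M (\<lambda>x. (\<Sum>n<i. h n x) - (\<Sum>n<j. h n x)) \<le> e" by blast
qed (use assms in auto)

section \<open>Integration over the square and its boundary\<close>

lemma Omega_eq_box: "\<Omega> = box (0, 0) (1, 1)"
  by (auto simp: \<Omega>_def box_def Basis_prod_def)

lemma open_Omega: "open \<Omega>"
  unfolding Omega_eq_box by (rule open_box)

lemma Omega_sets [simp, measurable]: "\<Omega> \<in> sets lebesgue"
  by (simp add: open_Omega)

lemma finite_measure_lebesgue_on_bounded:
  fixes S :: "'a::euclidean_space set"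
  assumes "S \<in> sets lebesgue" "bounded S"
  shows "finite_measure (lebesgue_on S)"
proof
  have "S \<in> lmeasurable" using assms by (rule bounded_set_imp_lmeasurable[rotated])
  then show "emeasure (lebesgue_on S) (space (lebesgue_on S)) \<noteq> \<infinity>"
    using assms by (auto simp: emeasure_restrict_space fmeasurable_def)
qed

lemma finite_measure_Omega: "finite_measure (lebesgue_on \<Omega>)"
  by (intro finite_measure_lebesgue_on_bounded) (auto simp: Omega_eq_box)

lemma finite_measure_unit: "finite_measure (lebesgue_on {0<..<1::real})"
  by (intro finite_measure_lebesgue_on_bounded) auto

lemma continuous_on_bounded_square:
  fixes f :: "real \<times> real \<Rightarrow> 'b::real_normed_vector"
  assumes "continuous_on UNIV f"
  obtains B where "\<And>p. p \<in> {0..1} \<times> {0..1} \<Longrightarrow> norm (f p) \<le> B"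
proof -
  have "compact (f ` ({0..1} \<times> {0..1}))"
    by (intro compact_continuous_image continuous_on_subset[OF assms] compact_Times) auto
  then have "bounded (f ` ({0..1} \<times> {0..1}))" by (rule compact_imp_bounded)
  then show ?thesis using that by (auto simp: bounded_iff)
qed

lemma Omega_subset: "\<Omega> \<subseteq> {0..1} \<times> {0..1}"
  by (auto simp: \<Omega>_def)

lemma continuous_measurable_lebesgue_on:
  fixes f :: "'a::euclidean_space \<Rightarrow> 'b::euclidean_space"
  assumes "continuous_on UNIV f" "S \<in> sets lebesgue"
  shows "f \<in> borel_measurable (lebesgue_on S)"
  using borel_measurable_continuous_onI[OF assms(1)]
  by (intro measurable_restrict_space1 measurable_completion) simp

lemma L2_Omega_continuous:
  assumes "continuous_on UNIV f"
  shows "f \<in> L2 (lebesgue_on \<Omega>)"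
proof -
  obtain B where "\<And>p. p \<in> {0..1} \<times> {0..1} \<Longrightarrow> norm (f p) \<le> B"
    using continuous_on_bounded_square[OF assms] by blast
  then show ?thesis
    using Omega_subset
    by (intro L2_bounded[where B = B] finite_measure_Omega continuous_measurable_lebesgue_on assms) auto
qed

lemma sqn_Omega_continuous:
  assumes "continuous_on UNIV f"
  shows "sqn (lebesgue_on \<Omega>) f
           = integral {0..1} (\<lambda>x. integral {0..1} (\<lambda>y. (cmod (f (x, y)))\<^sup>2))"
    and "sqn (lebesgue_on \<Omega>) f
           = integral {0..1} (\<lambda>y. integral {0..1} (\<lambda>x. (cmod (f (x, y)))\<^sup>2))"
proof -
  have cont: "continuous_on S (\<lambda>p. (cmod (f p))\<^sup>2)" for S
    by (intro continuous_intros continuous_on_subset[OF assms]) auto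
  have "sqn (lebesgue_on \<Omega>) f = integral \<Omega> (\<lambda>p. (cmod (f p))\<^sup>2)"
    unfolding sqn_def
    by (intro lebesgue_integral_eq_integral L2_integrable_power2 L2_Omega_continuous assms) simp
  also have "\<dots> = integral (cbox (0, 0) (1, 1)) (\<lambda>p. (cmod (f p))\<^sup>2)"
    unfolding Omega_eq_box by (rule integral_open_interval)
  finally have eq: "sqn (lebesgue_on \<Omega>) f = integral (cbox (0, 0) (1, 1)) (\<lambda>p. (cmod (f p))\<^sup>2)" .
  show 1: "sqn (lebesgue_on \<Omega>) f
           = integral {0..1} (\<lambda>x. integral {0..1} (\<lambda>y. (cmod (f (x, y)))\<^sup>2))"
    unfolding eq by (subst integral_prod_continuous) (auto intro: cont simp: cbox_interval)
  also have "\<dots> = integral {0..1} (\<lambda>y. integral {0..1} (\<lambda>x. (cmod (f (x, y)))\<^sup>2))"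
    using integral_swap_continuous[of 0 0 1 1 "\<lambda>x y. (cmod (f (x, y)))\<^sup>2"] cont
    by (simp add: cbox_interval)
  finally show "sqn (lebesgue_on \<Omega>) f
           = integral {0..1} (\<lambda>y. integral {0..1} (\<lambda>x. (cmod (f (x, y)))\<^sup>2))" .
qed

section \<open>Arc length measure on the boundary of the square\<close>

lemma measurable_bd_param [measurable]: "bd_param \<in> borel_measurable borel"
  unfolding bd_param_def by measurable

lemma sets_bd_measure [simp, measurable_cong]: "sets bd_measure = sets borel"
  by (simp add: bd_measure_def)

lemma space_bd_measure [simp]: "space bd_measure = UNIV"
  by (simp add: bd_measure_def)

text \<open>The parametrisation produces half-open intervals of both kinds and the boundary
  conditions use open ones. End points are null, so everything is reduced to closed
  intervals.\<close>

lemma nn_integral_closed_unit: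
  "(\<integral>\<^sup>+t. h t * indicator {0..<1::real} t \<partial>lborel) = (\<integral>\<^sup>+t. h t * indicator {0..1} t \<partial>lborel)"
  "(\<integral>\<^sup>+t. h t * indicator {0<..1::real} t \<partial>lborel) = (\<integral>\<^sup>+t. h t * indicator {0..1} t \<partial>lborel)"
  "(\<integral>\<^sup>+t. h t * indicator {0<..<1::real} t \<partial>lborel) = (\<integral>\<^sup>+t. h t * indicator {0..1} t \<partial>lborel)"
proof -
  have "AE t in lborel. t \<noteq> (0::real)" "AE t in lborel. t \<noteq> (1::real)"
    by (rule AE_lborel_singleton)+
  then have AE: "AE t in lborel. t \<noteq> (0::real) \<and> t \<noteq> 1" by eventually_elim auto
  show "(\<integral>\<^sup>+t. h t * indicator {0..<1::real} t \<partial>lborel) = (\<integral>\<^sup>+t. h t * indicator {0..1} t \<partial>lborel)"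
    by (rule nn_integral_cong_AE) (use AE in \<open>eventually_elim, auto simp: indicator_def\<close>)
  show "(\<integral>\<^sup>+t. h t * indicator {0<..1::real} t \<partial>lborel) = (\<integral>\<^sup>+t. h t * indicator {0..1} t \<partial>lborel)"
    by (rule nn_integral_cong_AE) (use AE in \<open>eventually_elim, auto simp: indicator_def\<close>)
  show "(\<integral>\<^sup>+t. h t * indicator {0<..<1::real} t \<partial>lborel) = (\<integral>\<^sup>+t. h t * indicator {0..1} t \<partial>lborel)"
    by (rule nn_integral_cong_AE) (use AE in \<open>eventually_elim, auto simp: indicator_def\<close>)
qed

lemma nn_integral_bd_measure:
  fixes h :: "real \<times> real \<Rightarrow> ennreal"
  assumes [measurable]: "h \<in> borel_measurable borel"
  shows "(\<integral>\<^sup>+p. h p \<partial>bd_measure) =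
     (\<integral>\<^sup>+t. h (t, 0) * indicator {0..1} t \<partial>lborel) + (\<integral>\<^sup>+t. h (1, t) * indicator {0..1} t \<partial>lborel) +
     (\<integral>\<^sup>+t. h (t, 1) * indicator {0..1} t \<partial>lborel) + (\<integral>\<^sup>+t. h (0, t) * indicator {0..1} t \<partial>lborel)"
proof -
  have "(\<integral>\<^sup>+p. h p \<partial>bd_measure) = (\<integral>\<^sup>+t. h (bd_param t) * indicator {0..<4} t \<partial>lborel)"
    unfolding bd_measure_def
    by (subst nn_integral_distr) (auto simp: nn_integral_restrict_space measurable_restrict_space1)
  also have "\<dots> = (\<integral>\<^sup>+t. (h (t, 0) * indicator {0..<1} t + h (1, t - 1) * indicator {1..<2} t) +
      (h (3 - t, 1) * indicator {2..<3} t + h (0, 4 - t) * indicator {3..<4} t) \<partial>lborel)"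
    by (intro nn_integral_cong) (auto simp: bd_param_def indicator_def)
  also have "\<dots> = ((\<integral>\<^sup>+t. h (t, 0) * indicator {0..<1} t \<partial>lborel)
        + (\<integral>\<^sup>+t. h (1, t - 1) * indicator {1..<2} t \<partial>lborel)) +
      ((\<integral>\<^sup>+t. h (3 - t, 1) * indicator {2..<3} t \<partial>lborel)
        + (\<integral>\<^sup>+t. h (0, 4 - t) * indicator {3..<4} t \<partial>lborel))"
    by (simp add: nn_integral_add)
  also have "(\<integral>\<^sup>+t. h (1, t - 1) * indicator {1..<2} t \<partial>lborel) =
      (\<integral>\<^sup>+t. h (1, t) * indicator {0..<1} t \<partial>lborel)"
    by (subst nn_integral_real_affine[where c = 1 and t = 1])
      (auto intro!: nn_integral_cong simp: indicator_def)
  \<comment> \<open>The top and left edges are traversed backwards, so the substitution has slope -1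
    and turns the half-open interval around.\<close>
  also have "(\<integral>\<^sup>+t. h (3 - t, 1) * indicator {2..<3} t \<partial>lborel) =
      (\<integral>\<^sup>+t. h (t, 1) * indicator {0<..1} t \<partial>lborel)"
    by (subst nn_integral_real_affine[where c = "-1" and t = 3])
      (auto intro!: nn_integral_cong simp: indicator_def)
  also have "(\<integral>\<^sup>+t. h (0, 4 - t) * indicator {3..<4} t \<partial>lborel) =
      (\<integral>\<^sup>+t. h (0, t) * indicator {0<..1} t \<partial>lborel)"
    by (subst nn_integral_real_affine[where c = "-1" and t = 4])
      (auto intro!: nn_integral_cong simp: indicator_def)
  finally show ?thesis by (simp add: nn_integral_closed_unit add.assoc)
qed

lemma finite_measure_bd: "finite_measure bd_measure"
proof
  have "emeasure bd_measure (space bd_measure) = (\<integral>\<^sup>+p. 1 \<partial>bd_measure)" by simp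
  also have "\<dots> = 4" by (subst nn_integral_bd_measure) auto
  finally show "emeasure bd_measure (space bd_measure) \<noteq> \<infinity>" by simp
qed

definition edges :: "(real \<Rightarrow> real \<times> real) set" where
  "edges = {\<lambda>t. (t, 0), \<lambda>t. (1, t), \<lambda>t. (t, 1), \<lambda>t. (0, t)}"

lemma edges_measurable: "\<gamma> \<in> edges \<Longrightarrow> \<gamma> \<in> borel_measurable borel"
  by (auto simp: edges_def)

lemma nn_integral_edge_le:
  fixes h :: "real \<times> real \<Rightarrow> ennreal"
  assumes "\<gamma> \<in> edges" "h \<in> borel_measurable borel"
  shows "(\<integral>\<^sup>+t. h (\<gamma> t) \<partial>lebesgue_on {0<..<1}) \<le> (\<integral>\<^sup>+p. h p \<partial>bd_measure)"
proof -
  have "(\<integral>\<^sup>+t. h (\<gamma> t) \<partial>lebesgue_on {0<..<1}) = (\<integral>\<^sup>+t. h (\<gamma> t) * indicator {0<..<1} t \<partial>lborel)"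
    by (simp add: nn_integral_restrict_space nn_integral_completion)
  also have "\<dots> = (\<integral>\<^sup>+t. h (\<gamma> t) * indicator {0..1} t \<partial>lborel)"
    by (rule nn_integral_closed_unit)
  also have "\<dots> \<le> (\<integral>\<^sup>+p. h p \<partial>bd_measure)"
    unfolding nn_integral_bd_measure[OF assms(2)] using assms(1) unfolding edges_def
    by (elim insertE emptyE) (simp_all add: add_increasing add_increasing2)
  finally show ?thesis .
qed

lemma L2_edge:
  assumes "w \<in> L2 bd_measure" "\<gamma> \<in> edges"
  shows "(\<lambda>t. w (\<gamma> t)) \<in> L2 (lebesgue_on {0<..<1})"
    and "sqn (lebesgue_on {0<..<1}) (\<lambda>t. w (\<gamma> t)) \<le> sqn bd_measure w"
proof -
  have [measurable]: "w \<in> borel_measurable borel"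
    using L2_measurable[OF assms(1)] measurable_cong_sets[OF sets_bd_measure refl] by blast
  have "(\<lambda>t. w (\<gamma> t)) \<in> borel_measurable borel"
    by (rule measurable_compose[OF edges_measurable[OF assms(2)]]) fact
  then have m: "(\<lambda>t. w (\<gamma> t)) \<in> borel_measurable (lebesgue_on {0<..<1})"
    by (intro measurable_restrict_space1 measurable_completion) simp
  have int: "(\<integral>\<^sup>+p. ennreal ((cmod (w p))\<^sup>2) \<partial>bd_measure) = ennreal (sqn bd_measure w)"
    unfolding sqn_def by (intro nn_integral_eq_integral L2_integrable_power2 assms) simp
  have le: "(\<integral>\<^sup>+t. ennreal ((cmod (w (\<gamma> t)))\<^sup>2) \<partial>lebesgue_on {0<..<1}) \<le> ennreal (sqn bd_measure w)"
    using nn_integral_edge_le[OF assms(2), of "\<lambda>p. ennreal ((cmod (w p))\<^sup>2)"] unfolding int by simp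
  have "integrable (lebesgue_on {0<..<1}) (\<lambda>t. (cmod (w (\<gamma> t)))\<^sup>2)"
    using le_less_trans[OF le] m by (intro integrableI_bounded) auto
  with m show "(\<lambda>t. w (\<gamma> t)) \<in> L2 (lebesgue_on {0<..<1})" by (simp add: L2_def)
  show "sqn (lebesgue_on {0<..<1}) (\<lambda>t. w (\<gamma> t)) \<le> sqn bd_measure w"
    unfolding sqn_def[of "lebesgue_on {0<..<1}"] by (rule integral_real_bounded[OF _ le]) simp
qed

lemma L2_tendsto_edge:
  assumes "L2_tendsto bd_measure f w" "\<gamma> \<in> edges"
  shows "L2_tendsto (lebesgue_on {0<..<1}) (\<lambda>j t. f j (\<gamma> t)) (\<lambda>t. w (\<gamma> t))"
proof -
  note A = L2_tendstoD[OF assms(1)]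
  have "(\<lambda>j. sqn (lebesgue_on {0<..<1}) (\<lambda>t. f j (\<gamma> t) - w (\<gamma> t))) \<longlonglongrightarrow> 0"
    using L2_edge(2)[OF L2_diff[OF A(1,2)] assms(2)]
    by (intro tendsto_sandwich[OF _ _ tendsto_const A(3)] always_eventually) auto
  then show ?thesis using A L2_edge(1)[OF _ assms(2)] by (auto simp: L2_tendsto_iff)
qed

lemma L2_bd_continuous:
  assumes "continuous_on UNIV f"
  shows "f \<in> L2 bd_measure"
    and "sqn bd_measure f = integral {0..1} (\<lambda>t. (cmod (f (t, 0)))\<^sup>2) + integral {0..1} (\<lambda>t. (cmod (f (1, t)))\<^sup>2)
      + integral {0..1} (\<lambda>t. (cmod (f (t, 1)))\<^sup>2) + integral {0..1} (\<lambda>t. (cmod (f (0, t)))\<^sup>2)" (is "_ = ?R")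
proof -
  have [measurable]: "f \<in> borel_measurable borel"
    using assms by (rule borel_measurable_continuous_onI)
  have e: "(\<integral>\<^sup>+t. ennreal ((cmod (f (\<gamma> t)))\<^sup>2) * indicator {0..1} t \<partial>lborel)
      = ennreal (integral {0..1} (\<lambda>t. (cmod (f (\<gamma> t)))\<^sup>2))" if "continuous_on UNIV \<gamma>" for \<gamma> :: "real \<Rightarrow> real \<times> real"
  proof -
    have "continuous_on {0..1} (\<lambda>t. (cmod (f (\<gamma> t)))\<^sup>2)"
      by (intro continuous_intros continuous_on_compose2[OF assms] continuous_on_subset[OF that]) auto
    then have "((\<lambda>t. (cmod (f (\<gamma> t)))\<^sup>2) has_integral integral {0..1} (\<lambda>t. (cmod (f (\<gamma> t)))\<^sup>2)) {0..1}"
      by (intro integrable_integral integrable_continuous_interval)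
    from nn_integral_has_integral_lebesgue[OF _ this]
    have "(\<integral>\<^sup>+t. ennreal (indicator {0..1} t * (cmod (f (\<gamma> t)))\<^sup>2) \<partial>lborel)
       = ennreal (integral {0..1} (\<lambda>t. (cmod (f (\<gamma> t)))\<^sup>2))" by simp
    then show ?thesis by (simp add: ennreal_mult' mult.commute ennreal_indicator)
  qed
  \<comment> \<open>An integral that does not exist has the value 0, so nonnegativity holds for
    every \<gamma>, continuous or not.\<close>
  have nn: "0 \<le> integral {0..1} (\<lambda>t. (cmod (f (\<gamma> t)))\<^sup>2)" for \<gamma> :: "real \<Rightarrow> real \<times> real"
    by (cases "(\<lambda>t. (cmod (f (\<gamma> t)))\<^sup>2) integrable_on {0..1}")
      (auto intro: integral_nonneg simp: not_integrable_integral)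
  have eq: "(\<integral>\<^sup>+p. ennreal ((cmod (f p))\<^sup>2) \<partial>bd_measure) = ennreal ?R"
    using nn[of "\<lambda>t. (t, 0)"] nn[of "\<lambda>t. (1, t)"] nn[of "\<lambda>t. (t, 1)"] nn[of "\<lambda>t. (0, t)"]
    by (subst nn_integral_bd_measure) (simp_all add: e ennreal_plus continuous_intros)
  then have "integrable bd_measure (\<lambda>p. (cmod (f p))\<^sup>2)"
    by (intro integrableI_bounded) auto
  then show L: "f \<in> L2 bd_measure" by (simp add: L2_def)
  have "ennreal (sqn bd_measure f) = ennreal ?R"
    unfolding sqn_def eq[symmetric]
    by (intro nn_integral_eq_integral[symmetric] L2_integrable_power2 L) simp
  then show "sqn bd_measure f = ?R"
    using nn[of "\<lambda>t. (t, 0)"] nn[of "\<lambda>t. (1, t)"] nn[of "\<lambda>t. (t, 1)"] nn[of "\<lambda>t. (0, t)"]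
    by (subst (asm) ennreal_inj) auto
qed

section \<open>Smooth functions: traces and weak derivatives\<close>

lemma dir_deriv_eqI: "(f has_derivative D) (at x) \<Longrightarrow> dir_deriv e f x = D e"
  by (auto simp: dir_deriv_def dest: frechet_derivative_at)

lemma C_k_Suc_differentiable: "C_k (Suc k) f \<Longrightarrow> f differentiable (at x)"
  by simp

lemma has_derivative_frechet: "C_k (Suc k) f \<Longrightarrow> (f has_derivative frechet_derivative f (at x)) (at x)"
  using C_k_Suc_differentiable frechet_derivative_works by blast

lemma C_k_Suc_continuous: "C_k (Suc k) f \<Longrightarrow> continuous_on S f"
  by (intro continuous_at_imp_continuous_on ballI differentiable_imp_continuous_within C_k_Suc_differentiable)

lemma C_1_dir_deriv_continuous:
  "C_k (Suc 0) f \<Longrightarrow> e \<in> Basis \<Longrightarrow> continuous_on UNIV (dir_deriv e f)"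
  by auto

lemma smooth_C_k: "smooth f \<Longrightarrow> C_k k f"
  by (simp add: smooth_def)

lemma dir_deriv_diff:
  assumes "C_k (Suc k) f" "C_k (Suc k) g"
  shows "dir_deriv e (\<lambda>x. f x - g x) = (\<lambda>x. dir_deriv e f x - dir_deriv e g x)"
proof
  fix x
  have "((\<lambda>x. f x - g x) has_derivative
      (\<lambda>h. frechet_derivative f (at x) h - frechet_derivative g (at x) h)) (at x)"
    by (intro has_derivative_diff has_derivative_frechet[OF assms(1)] has_derivative_frechet[OF assms(2)])
  from dir_deriv_eqI[OF this] show "dir_deriv e (\<lambda>x. f x - g x) x = dir_deriv e f x - dir_deriv e g x"
    by (simp add: dir_deriv_def)
qed

lemma C_1_diff:
  assumes "C_k (Suc 0) f" "C_k (Suc 0) g"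
  shows "C_k (Suc 0) (\<lambda>x. f x - g x)"
proof -
  have "continuous_on UNIV (dir_deriv e (\<lambda>x. f x - g x))" if "e \<in> Basis" for e
    unfolding dir_deriv_diff[OF assms]
    by (intro continuous_on_diff C_1_dir_deriv_continuous assms that)
  then show ?thesis using assms by simp
qed

lemma Basis_real_pair: "(Basis :: (real \<times> real) set) = {(1, 0), (0, 1)}"
  by (auto simp: Basis_prod_def)

section \<open>Restriction to lines and the trace inequality\<close>

lemma dir_deriv_horizontal:
  fixes f :: "real \<times> real \<Rightarrow> complex"
  assumes "C_k (Suc k) f"
  shows "((\<lambda>x. f (x, y)) has_vector_derivative dir_deriv (1, 0) f (x, y)) (at x within S)"
proof -
  have "((\<lambda>x. f (x, y)) has_derivative (\<lambda>h. frechet_derivative f (at (x, y)) (h, 0))) (at x within S)"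
    by (rule has_derivative_compose[where f = "\<lambda>x. (x, y)" and g = f, OF _ has_derivative_frechet[OF assms], simplified])
      (auto intro!: derivative_eq_intros)
  moreover have "frechet_derivative f (at (x, y)) (h, 0) = h *\<^sub>R frechet_derivative f (at (x, y)) (1, 0)" for h
    using linear_scale[OF linear_frechet_derivative[OF C_k_Suc_differentiable[OF assms]], of "(x, y)" h "(1, 0)"]
    by simp
  ultimately show ?thesis
    unfolding has_vector_derivative_def dir_deriv_def by (rule has_derivative_eq_rhs[OF _ ext])
qed

lemma dir_deriv_vertical:
  fixes f :: "real \<times> real \<Rightarrow> complex"
  assumes "C_k (Suc k) f"
  shows "((\<lambda>y. f (x, y)) has_vector_derivative dir_deriv (0, 1) f (x, y)) (at y within S)"
proof -
  have "((\<lambda>y. f (x, y)) has_derivative (\<lambda>h. frechet_derivative f (at (x, y)) (0, h))) (at y within S)"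
    by (rule has_derivative_compose[where f = "\<lambda>y. (x, y)" and g = f, OF _ has_derivative_frechet[OF assms], simplified])
      (auto intro!: derivative_eq_intros)
  moreover have "frechet_derivative f (at (x, y)) (0, h) = h *\<^sub>R frechet_derivative f (at (x, y)) (0, 1)" for h
    using linear_scale[OF linear_frechet_derivative[OF C_k_Suc_differentiable[OF assms]], of "(x, y)" h "(0, 1)"]
    by simp
  ultimately show ?thesis
    unfolding has_vector_derivative_def dir_deriv_def by (rule has_derivative_eq_rhs[OF _ ext])
qed

text \<open>Obtained by integrating the derivative of \<open>(1 - x) * |f x|\<^sup>2\<close>, respectively \<open>x * |f x|\<^sup>2\<close>.\<close>

lemma endpoint_bound:
  fixes f :: "real \<Rightarrow> complex"
  assumes f: "\<And>x. x \<in> {0..1} \<Longrightarrow> (f has_vector_derivative f' x) (at x within {0..1})"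
    and f': "continuous_on {0..1} f'"
  shows "(cmod (f 0))\<^sup>2 \<le> 2 * integral {0..1} (\<lambda>x. (cmod (f x))\<^sup>2) + integral {0..1} (\<lambda>x. (cmod (f' x))\<^sup>2)"
    and "(cmod (f 1))\<^sup>2 \<le> 2 * integral {0..1} (\<lambda>x. (cmod (f x))\<^sup>2) + integral {0..1} (\<lambda>x. (cmod (f' x))\<^sup>2)"
proof -
  have fc: "continuous_on {0..1} f"
    using f by (meson continuous_on_eq_continuous_within has_vector_derivative_continuous)
  have int: "(\<lambda>x. 2 * (cmod (f x))\<^sup>2 + (cmod (f' x))\<^sup>2) integrable_on {0..1}"
    by (intro integrable_continuous_interval continuous_intros fc f')
  have R: "integral {0..1} (\<lambda>x. 2 * (cmod (f x))\<^sup>2 + (cmod (f' x))\<^sup>2)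
      = 2 * integral {0..1} (\<lambda>x. (cmod (f x))\<^sup>2) + integral {0..1} (\<lambda>x. (cmod (f' x))\<^sup>2)"
    by (subst integral_add) (auto intro!: integrable_continuous_interval continuous_intros fc f')
  have ff: "((\<lambda>x. f x \<bullet> f x) has_vector_derivative 2 * (f x \<bullet> f' x)) (at x within {0..1})" if "x \<in> {0..1}" for x
    using bounded_bilinear.has_vector_derivative[OF bounded_bilinear_inner f[OF that] f[OF that]]
    by (simp add: inner_commute)
  have key: "\<bar>2 * (z \<bullet> w)\<bar> \<le> z \<bullet> z + w \<bullet> w" for z w :: complex
    using inner_ge_zero[of "z + w"] inner_ge_zero[of "z - w"]
    by (simp add: inner_add inner_diff inner_commute algebra_simps abs_le_iff)
  have key2: "\<bar>c * (2 * (z \<bullet> w))\<bar> \<le> (cmod z)\<^sup>2 + (cmod w)\<^sup>2" if "c \<le> 1" "0 \<le> c" for c and z w :: complex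
    using mult_mono[OF that(1) key[of z w]] that by (simp add: abs_mult power2_norm_eq_inner)
  have pw0: "- (- (f x \<bullet> f x) + (1 - x) * (2 * (f x \<bullet> f' x))) \<le> 2 * (cmod (f x))\<^sup>2 + (cmod (f' x))\<^sup>2"
    if "x \<in> {0..1}" for x
    using key2[of "1 - x" "f x" "f' x"] that by (simp only: power2_norm_eq_inner) auto
  have pw1: "f x \<bullet> f x + x * (2 * (f x \<bullet> f' x)) \<le> 2 * (cmod (f x))\<^sup>2 + (cmod (f' x))\<^sup>2"
    if "x \<in> {0..1}" for x
    using key2[of x "f x" "f' x"] that by (simp only: power2_norm_eq_inner) auto
  have "((\<lambda>x. - (- (f x \<bullet> f x) + (1 - x) * (2 * (f x \<bullet> f' x)))) has_integral
      - ((1 - 1) * (f 1 \<bullet> f 1) - (1 - 0) * (f 0 \<bullet> f 0))) {0..1}"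
    by (intro has_integral_neg fundamental_theorem_of_calculus)
      (auto intro!: derivative_eq_intros has_vector_derivative_mult[THEN has_vector_derivative_eq_rhs] ff)
  from has_integral_le[OF this integrable_integral[OF int]]
  have "f 0 \<bullet> f 0 \<le> integral {0..1} (\<lambda>x. 2 * (cmod (f x))\<^sup>2 + (cmod (f' x))\<^sup>2)"
    using pw0 by simp
  then show "(cmod (f 0))\<^sup>2 \<le> 2 * integral {0..1} (\<lambda>x. (cmod (f x))\<^sup>2) + integral {0..1} (\<lambda>x. (cmod (f' x))\<^sup>2)"
    unfolding R[symmetric] by (simp only: power2_norm_eq_inner)
  have "((\<lambda>x. f x \<bullet> f x + x * (2 * (f x \<bullet> f' x))) has_integral
      1 * (f 1 \<bullet> f 1) - 0 * (f 0 \<bullet> f 0)) {0..1}"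
    by (intro fundamental_theorem_of_calculus)
      (auto intro!: derivative_eq_intros has_vector_derivative_mult[THEN has_vector_derivative_eq_rhs] ff)
  from has_integral_le[OF this integrable_integral[OF int]]
  have "f 1 \<bullet> f 1 \<le> integral {0..1} (\<lambda>x. 2 * (cmod (f x))\<^sup>2 + (cmod (f' x))\<^sup>2)"
    using pw1 by simp
  then show "(cmod (f 1))\<^sup>2 \<le> 2 * integral {0..1} (\<lambda>x. (cmod (f x))\<^sup>2) + integral {0..1} (\<lambda>x. (cmod (f' x))\<^sup>2)"
    unfolding R[symmetric] by (simp only: power2_norm_eq_inner)
qed

lemma integral_slice_continuous:
  fixes h :: "real \<times> real \<Rightarrow> 'b::banach"
  assumes "continuous_on UNIV h"
  shows "continuous_on {0..1} (\<lambda>x. integral {0..1} (\<lambda>y. h (x, y)))"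
    and "continuous_on {0..1} (\<lambda>y. integral {0..1} (\<lambda>x. h (x, y)))"
proof -
  have "continuous_on ({0..1} \<times> cbox 0 1) (\<lambda>(x, y). h (x, y))"
    using continuous_on_subset[OF assms] by simp
  from integral_continuous_on_param[OF this]
  show "continuous_on {0..1} (\<lambda>x. integral {0..1} (\<lambda>y. h (x, y)))" by (simp add: cbox_interval)
  have "continuous_on ({0..1} \<times> cbox 0 1) (\<lambda>(y, x). h (x, y))"
    unfolding case_prod_beta by (intro continuous_on_compose2[OF assms] continuous_intros) auto
  from integral_continuous_on_param[OF this]
  show "continuous_on {0..1} (\<lambda>y. integral {0..1} (\<lambda>x. h (x, y)))" by (simp add: cbox_interval)
qed

text \<open>On each line perpendicular to an edge, \<open>endpoint_bound\<close> controls the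
  boundary value; integrating over the lines bounds each edge by twice the square of f plus the
  square of the normal derivative. Four edges, two for each direction, give the factors 8, 2 and
  2.\<close>

lemma trace_inequality:
  assumes "C_k (Suc 0) f"
  shows "sqn bd_measure f \<le> 8 * sqn (lebesgue_on \<Omega>) f
     + 2 * sqn (lebesgue_on \<Omega>) (dir_deriv (1, 0) f) + 2 * sqn (lebesgue_on \<Omega>) (dir_deriv (0, 1) f)"
proof -
  let ?M = "lebesgue_on \<Omega>"
  have c: "continuous_on UNIV f" by (rule C_k_Suc_continuous[OF assms])
  have cx: "continuous_on UNIV (dir_deriv (1, 0) f)" and cy: "continuous_on UNIV (dir_deriv (0, 1) f)"
    by (rule C_1_dir_deriv_continuous[OF assms]; simp add: Basis_real_pair)+
  have sq: "continuous_on UNIV (\<lambda>p. (cmod (h p))\<^sup>2)" if "continuous_on UNIV h" for h :: "real \<times> real \<Rightarrow> complex"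
    by (intro continuous_intros that)
  have int: "continuous_on {0..1} (\<lambda>x. 2 * integral {0..1} (\<lambda>y. (cmod (f (x, y)))\<^sup>2)
      + integral {0..1} (\<lambda>y. (cmod (dir_deriv (0, 1) f (x, y)))\<^sup>2))"
    "continuous_on {0..1} (\<lambda>y. 2 * integral {0..1} (\<lambda>x. (cmod (f (x, y)))\<^sup>2)
      + integral {0..1} (\<lambda>x. (cmod (dir_deriv (1, 0) f (x, y)))\<^sup>2))"
    by (intro continuous_intros integral_slice_continuous[OF sq] c cx cy)+
  have I: "integral {0..1} (\<lambda>x. 2 * integral {0..1} (\<lambda>y. (cmod (f (x, y)))\<^sup>2)
      + integral {0..1} (\<lambda>y. (cmod (dir_deriv (0, 1) f (x, y)))\<^sup>2))
      = 2 * sqn ?M f + sqn ?M (dir_deriv (0, 1) f)"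
    "integral {0..1} (\<lambda>y. 2 * integral {0..1} (\<lambda>x. (cmod (f (x, y)))\<^sup>2)
      + integral {0..1} (\<lambda>x. (cmod (dir_deriv (1, 0) f (x, y)))\<^sup>2))
      = 2 * sqn ?M f + sqn ?M (dir_deriv (1, 0) f)"
    unfolding sqn_Omega_continuous(1)[OF c] sqn_Omega_continuous(1)[OF cy]
    by (subst integral_add; auto intro!: integrable_continuous_interval continuous_intros
          integral_slice_continuous(1)[OF sq] c cy)
      (subst sqn_Omega_continuous(2)[OF c] sqn_Omega_continuous(2)[OF cx] sqn_Omega_continuous(1)[OF c, symmetric],
        subst integral_add; auto intro!: integrable_continuous_interval continuous_intros
          integral_slice_continuous(2)[OF sq] c cx simp: sqn_Omega_continuous(2)[OF c] sqn_Omega_continuous(2)[OF cx])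
  have slice: "continuous_on {0..1} (\<lambda>x. (cmod (f (x, b)))\<^sup>2)" "continuous_on {0..1} (\<lambda>y. (cmod (f (b, y)))\<^sup>2)" for b
    by (intro continuous_intros continuous_on_compose2[OF c]; auto)+
  have slice': "continuous_on {0..1} (\<lambda>x. dir_deriv (1, 0) f (x, b))" "continuous_on {0..1} (\<lambda>y. dir_deriv (0, 1) f (b, y))" for b
    by (intro continuous_intros continuous_on_compose2[OF cx] continuous_on_compose2[OF cy]; auto)+
  have h: "integral {0..1} (\<lambda>x. (cmod (f (x, b)))\<^sup>2) \<le> 2 * sqn ?M f + sqn ?M (dir_deriv (0, 1) f)"
    if "b \<in> {0, 1}" for b
    unfolding I(1)[symmetric]
    by (intro integral_le integrable_continuous_interval slice int)
      (use that endpoint_bound[OF dir_deriv_vertical[OF assms] slice'(2)] in auto)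
  have v: "integral {0..1} (\<lambda>y. (cmod (f (b, y)))\<^sup>2) \<le> 2 * sqn ?M f + sqn ?M (dir_deriv (1, 0) f)"
    if "b \<in> {0, 1}" for b
    unfolding I(2)[symmetric]
    by (intro integral_le integrable_continuous_interval slice int)
      (use that endpoint_bound[OF dir_deriv_horizontal[OF assms] slice'(1)] in auto)
  show ?thesis
    unfolding L2_bd_continuous(2)[OF c] using h[of 0] h[of 1] v[of 0] v[of 1] by simp
qed

text \<open>The trace inequality applied to differences makes the boundary values Cauchy. The
  thresholds e / 12 match 8 + 2 + 2 = 12.\<close>

lemma H1_tendsto_trace:
  assumes "\<And>j. smooth (\<phi> j)" "H1_tendsto \<Omega> \<phi> u"
  shows "\<exists>w. L2_tendsto bd_measure \<phi> w"
proof (rule L2_complete[OF finite_measure_bd])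
  let ?M = "lebesgue_on \<Omega>"
  note C1 = smooth_C_k[OF assms(1)]
  show "\<phi> j \<in> L2 bd_measure" for j
    by (rule L2_bd_continuous(1)[OF C_k_Suc_continuous[OF C1]])
  fix e :: real assume "e > 0"
  obtain vx vy where t: "L2_tendsto ?M \<phi> u" "L2_tendsto ?M (\<lambda>j. dir_deriv (1, 0) (\<phi> j)) vx"
    "L2_tendsto ?M (\<lambda>j. dir_deriv (0, 1) (\<phi> j)) vy"
    using assms(2) unfolding H1_tendsto_def Basis_real_pair by auto
  obtain N1 where N1: "\<And>i j. i \<ge> N1 \<Longrightarrow> j \<ge> N1 \<Longrightarrow> sqn ?M (\<lambda>x. \<phi> i x - \<phi> j x) \<le> e / 12"
    using L2_tendsto_Cauchy[OF t(1), of "e / 12"] \<open>e > 0\<close> by auto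
  obtain N2 where N2: "\<And>i j. i \<ge> N2 \<Longrightarrow> j \<ge> N2 \<Longrightarrow>
      sqn ?M (\<lambda>x. dir_deriv (1, 0) (\<phi> i) x - dir_deriv (1, 0) (\<phi> j) x) \<le> e / 12"
    using L2_tendsto_Cauchy[OF t(2), of "e / 12"] \<open>e > 0\<close> by auto
  obtain N3 where N3: "\<And>i j. i \<ge> N3 \<Longrightarrow> j \<ge> N3 \<Longrightarrow>
      sqn ?M (\<lambda>x. dir_deriv (0, 1) (\<phi> i) x - dir_deriv (0, 1) (\<phi> j) x) \<le> e / 12"
    using L2_tendsto_Cauchy[OF t(3), of "e / 12"] \<open>e > 0\<close> by auto
  have "sqn bd_measure (\<lambda>x. \<phi> i x - \<phi> j x) \<le> e" if "i \<ge> Max {N1, N2, N3}" "j \<ge> Max {N1, N2, N3}" for i j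
    using trace_inequality[OF C_1_diff[OF C1 C1], of i j] N1[of i j] N2[of i j] N3[of i j] that
    by (simp add: dir_deriv_diff[OF C1 C1])
  then show "\<exists>N. \<forall>i\<ge>N. \<forall>j\<ge>N. sqn bd_measure (\<lambda>x. \<phi> i x - \<phi> j x) \<le> e" by blast
qed

lemma H1_tendsto_imp_H1: "H1_tendsto S \<phi> u \<Longrightarrow> u \<in> H1 S"
  unfolding H1_tendsto_def H1_def using L2_tendstoD(2) by blast

lemma has_traceI:
  assumes "\<And>j. smooth (\<phi> j)" "H1_tendsto \<Omega> \<phi> u" "L2_tendsto bd_measure \<phi> w"
  shows "has_trace u w"
  unfolding has_trace_def by (intro conjI exI[of _ \<phi>] allI H1_tendsto_imp_H1[OF assms(2)] assms)

section \<open>Integration by parts and weak derivatives of limits\<close>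

lemma integral_Omega_continuous:
  fixes h :: "real \<times> real \<Rightarrow> complex"
  assumes "continuous_on UNIV h"
  shows "integral\<^sup>L (lebesgue_on \<Omega>) h = integral {0..1} (\<lambda>x. integral {0..1} (\<lambda>y. h (x, y)))"
    and "integral\<^sup>L (lebesgue_on \<Omega>) h = integral {0..1} (\<lambda>y. integral {0..1} (\<lambda>x. h (x, y)))"
proof -
  have cont: "continuous_on S h" for S using continuous_on_subset[OF assms] by blast
  have "integrable (lebesgue_on \<Omega>) h"
    using L2_imp_integrable[OF finite_measure_Omega L2_Omega_continuous[OF assms], of "\<lambda>_. 1" 1] by simp
  then have "integral\<^sup>L (lebesgue_on \<Omega>) h = integral \<Omega> h"
    by (intro lebesgue_integral_eq_integral) auto
  also have "\<dots> = integral (cbox (0, 0) (1, 1)) h"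
    unfolding Omega_eq_box by (rule integral_open_interval)
  finally have eq: "integral\<^sup>L (lebesgue_on \<Omega>) h = integral (cbox (0, 0) (1, 1)) h" .
  show 1: "integral\<^sup>L (lebesgue_on \<Omega>) h = integral {0..1} (\<lambda>x. integral {0..1} (\<lambda>y. h (x, y)))"
    unfolding eq by (subst integral_prod_continuous) (auto intro: cont simp: cbox_interval)
  also have "\<dots> = integral {0..1} (\<lambda>y. integral {0..1} (\<lambda>x. h (x, y)))"
    using integral_swap_continuous[of 0 0 1 1 "\<lambda>x y. h (x, y)"] cont
    by (simp add: cbox_interval)
  finally show "integral\<^sup>L (lebesgue_on \<Omega>) h = integral {0..1} (\<lambda>y. integral {0..1} (\<lambda>x. h (x, y)))" .
qed

text \<open>The sum of the two integrands is the derivative of the product in the direction e.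
  Integrating first along e leaves the values of the product at two boundary points, where \<psi>
  vanishes because its support lies in the open square.\<close>

lemma integration_by_parts_Omega:
  assumes f: "C_k (Suc 0) f" and \<psi>: "test_fun \<Omega> \<psi>" and e: "e \<in> Basis"
  shows "integral\<^sup>L (lebesgue_on \<Omega>) (\<lambda>p. f p * dir_deriv e \<psi> p)
       = - integral\<^sup>L (lebesgue_on \<Omega>) (\<lambda>p. dir_deriv e f p * \<psi> p)"
proof -
  have \<psi>1: "C_k (Suc 0) \<psi>" using \<psi> unfolding test_fun_def by (blast intro: smooth_C_k)
  have zero: "\<psi> p = 0" if "p \<notin> \<Omega>" for p
    using \<psi> that closure_subset[of "{x. \<psi> x \<noteq> 0}"] unfolding test_fun_def by blast
  note c = C_k_Suc_continuous[OF f] C_k_Suc_continuous[OF \<psi>1]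
    C_1_dir_deriv_continuous[OF f e] C_1_dir_deriv_continuous[OF \<psi>1 e]
  have c1: "continuous_on UNIV (\<lambda>p. f p * dir_deriv e \<psi> p)" by (intro continuous_intros c)
  have c2: "continuous_on UNIV (\<lambda>p. dir_deriv e f p * \<psi> p)" by (intro continuous_intros c)
  have c3: "continuous_on UNIV (\<lambda>p. f p * dir_deriv e \<psi> p + dir_deriv e f p * \<psi> p)"
    by (intro continuous_intros c1 c2)
  have i: "integrable (lebesgue_on \<Omega>) h" if "continuous_on UNIV h" for h :: "real \<times> real \<Rightarrow> complex"
    using L2_imp_integrable[OF finite_measure_Omega L2_Omega_continuous[OF that], of "\<lambda>_. 1" 1] by simp
  have "integral\<^sup>L (lebesgue_on \<Omega>) (\<lambda>p. f p * dir_deriv e \<psi> p + dir_deriv e f p * \<psi> p) = 0"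
  proof (cases "e = (1, 0)")
    case True
    have "integral {0..1} (\<lambda>x. f (x, y) * dir_deriv e \<psi> (x, y) + dir_deriv e f (x, y) * \<psi> (x, y)) = 0" for y
    proof -
      have "((\<lambda>x. f (x, y) * dir_deriv e \<psi> (x, y) + dir_deriv e f (x, y) * \<psi> (x, y)) has_integral
          f (1, y) * \<psi> (1, y) - f (0, y) * \<psi> (0, y)) {0..1}"
        unfolding True
        by (intro fundamental_theorem_of_calculus has_vector_derivative_mult
            dir_deriv_horizontal[OF f] dir_deriv_horizontal[OF \<psi>1]) simp
      then show ?thesis by (simp add: zero \<Omega>_def integral_unique)
    qed
    then show ?thesis by (simp add: integral_Omega_continuous(2)[OF c3])
  next
    case False
    then have e01: "e = (0, 1)" using e by (auto simp: Basis_real_pair)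
    have "integral {0..1} (\<lambda>y. f (x, y) * dir_deriv e \<psi> (x, y) + dir_deriv e f (x, y) * \<psi> (x, y)) = 0" for x
    proof -
      have "((\<lambda>y. f (x, y) * dir_deriv e \<psi> (x, y) + dir_deriv e f (x, y) * \<psi> (x, y)) has_integral
          f (x, 1) * \<psi> (x, 1) - f (x, 0) * \<psi> (x, 0)) {0..1}"
        unfolding e01
        by (intro fundamental_theorem_of_calculus has_vector_derivative_mult
            dir_deriv_vertical[OF f] dir_deriv_vertical[OF \<psi>1]) simp
      then show ?thesis by (simp add: zero \<Omega>_def integral_unique)
    qed
    then show ?thesis by (simp add: integral_Omega_continuous(1)[OF c3])
  qed
  then show ?thesis using i[OF c1] i[OF c2] by (simp add: eq_neg_iff_add_eq_0)
qed

lemma set_integral_Omega: "(LINT x:\<Omega>|lebesgue. h x) = integral\<^sup>L (lebesgue_on \<Omega>) h"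
  for h :: "real \<times> real \<Rightarrow> complex"
  unfolding set_lebesgue_integral_def by (rule integral_restrict_space[symmetric]) simp

lemma locally_integrable_Omega:
  assumes "u \<in> L2 (lebesgue_on \<Omega>)"
  shows "locally_integrable \<Omega> u"
proof -
  have "integrable (lebesgue_on \<Omega>) u"
    using L2_imp_integrable[OF finite_measure_Omega assms, of "\<lambda>_. 1" 1] by simp
  then have *: "set_integrable lebesgue \<Omega> u"
    unfolding set_integrable_def by (subst (asm) integrable_restrict_space) auto
  show ?thesis
    unfolding locally_integrable_def
    by (auto intro!: set_integrable_subset[OF *] lmeasurable_compact fmeasurableD)
qed

text \<open>A test function and its derivative are bounded on the square, so both sides of the
  integration by parts formula are continuous under L2 convergence.\<close>

lemma weak_deriv_limit:
  assumes f: "\<And>j. C_k (Suc 0) (f j)" and e: "e \<in> Basis"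
    and u: "L2_tendsto (lebesgue_on \<Omega>) f u"
    and v: "L2_tendsto (lebesgue_on \<Omega>) (\<lambda>j. dir_deriv e (f j)) v"
  shows "weak_deriv \<Omega> e u v"
  unfolding weak_deriv_def set_integral_Omega
proof (intro conjI allI impI locally_integrable_Omega)
  show "u \<in> L2 (lebesgue_on \<Omega>)" "v \<in> L2 (lebesgue_on \<Omega>)"
    using L2_tendstoD(2)[OF u] L2_tendstoD(2)[OF v] .
  fix \<psi> assume \<psi>: "test_fun \<Omega> \<psi>"
  have \<psi>1: "C_k (Suc 0) \<psi>" using \<psi> unfolding test_fun_def by (blast intro: smooth_C_k)
  note c1 = C_k_Suc_continuous[OF \<psi>1] and c2 = C_1_dir_deriv_continuous[OF \<psi>1 e]
  obtain B1 B2 where B1: "\<And>p. p \<in> {0..1} \<times> {0..1} \<Longrightarrow> norm (\<psi> p) \<le> B1"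
    and B2: "\<And>p. p \<in> {0..1} \<times> {0..1} \<Longrightarrow> norm (dir_deriv e \<psi> p) \<le> B2"
    using continuous_on_bounded_square[OF c1] continuous_on_bounded_square[OF c2] by metis
  have "(\<lambda>j. integral\<^sup>L (lebesgue_on \<Omega>) (\<lambda>p. f j p * dir_deriv e \<psi> p)) \<longlonglongrightarrow>
      integral\<^sup>L (lebesgue_on \<Omega>) (\<lambda>p. u p * dir_deriv e \<psi> p)"
    by (rule L2_tendsto_integral_mult[OF finite_measure_Omega u continuous_measurable_lebesgue_on[OF c2], of B2])
      (use B2 Omega_subset in auto)
  moreover have "(\<lambda>j. - integral\<^sup>L (lebesgue_on \<Omega>) (\<lambda>p. dir_deriv e (f j) p * \<psi> p)) \<longlonglongrightarrow>
      - integral\<^sup>L (lebesgue_on \<Omega>) (\<lambda>p. v p * \<psi> p)"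
    by (rule tendsto_minus[OF L2_tendsto_integral_mult[OF finite_measure_Omega v continuous_measurable_lebesgue_on[OF c1], of B1]])
      (use B1 Omega_subset in auto)
  ultimately show "integral\<^sup>L (lebesgue_on \<Omega>) (\<lambda>p. u p * dir_deriv e \<psi> p)
      = - integral\<^sup>L (lebesgue_on \<Omega>) (\<lambda>p. v p * \<psi> p)"
    unfolding integration_by_parts_Omega[OF f \<psi> e] by (rule LIMSEQ_unique)
qed

text \<open>Needed for the bottom edge, whose outward normal (0, -1) is the negative of a basis
  vector.\<close>

lemma weak_deriv_uminus:
  assumes "weak_deriv \<Omega> e u v"
  shows "weak_deriv \<Omega> (- e) u (\<lambda>x. - v x)"
proof -
  have "dir_deriv (- e) \<psi> p = - dir_deriv e \<psi> p" if "test_fun \<Omega> \<psi>" for \<psi> p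
  proof -
    have "C_k (Suc 0) \<psi>" using that unfolding test_fun_def by (blast intro: smooth_C_k)
    from linear_neg[OF linear_frechet_derivative[OF C_k_Suc_differentiable[OF this]]]
    show ?thesis by (simp add: dir_deriv_def)
  qed
  then show ?thesis
    using assms unfolding weak_deriv_def set_integral_Omega
    by (auto simp: locally_integrable_def set_integrable_def)
qed

lemma H1_tendsto_OmegaI:
  assumes "\<And>j. smooth (\<phi> j)" "L2_tendsto (lebesgue_on \<Omega>) \<phi> u"
    "L2_tendsto (lebesgue_on \<Omega>) (\<lambda>j. dir_deriv (1, 0) (\<phi> j)) ux"
    "L2_tendsto (lebesgue_on \<Omega>) (\<lambda>j. dir_deriv (0, 1) (\<phi> j)) uy"
  shows "H1_tendsto \<Omega> \<phi> u"
proof -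
  have "weak_deriv \<Omega> (1, 0) u ux" "weak_deriv \<Omega> (0, 1) u uy"
    by (rule weak_deriv_limit[OF smooth_C_k[OF assms(1)] _ assms(2,3)], simp add: Basis_real_pair)
      (rule weak_deriv_limit[OF smooth_C_k[OF assms(1)] _ assms(2,4)], simp add: Basis_real_pair)
  then show ?thesis
    unfolding H1_tendsto_def Basis_real_pair using assms(2-4) by blast
qed

section \<open>Separated series and the eigenfunctions\<close>

text \<open>The two factors are separate arguments because differentiating a partial sum in x or y
  merely exchanges F or G for its derivative and keeps the coefficients.\<close>

definition sepsum ::
  "(nat \<Rightarrow> complex) \<Rightarrow> (nat \<Rightarrow> real \<Rightarrow> real) \<Rightarrow> (nat \<Rightarrow> real \<Rightarrow> real) \<Rightarrow> nat \<Rightarrow> real \<times> real \<Rightarrow> complex"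
  where "sepsum c F G N = (\<lambda>p. \<Sum>n<N. c n * of_real (F n (fst p)) * of_real (G n (snd p)))"

text \<open>Carrying the function together with its derivative makes the notion closed under
  differentiation: (f', \<kappa> * f) is again a pair for the same \<kappa>. Smoothness of all
  orders follows from this closure.\<close>

definition ode_pair :: "real \<Rightarrow> (real \<Rightarrow> real) \<Rightarrow> (real \<Rightarrow> real) \<Rightarrow> bool" where
  "ode_pair \<kappa> f f' \<longleftrightarrow> (\<forall>x. (f has_real_derivative f' x) (at x)) \<and>
     (\<forall>x. (f' has_real_derivative \<kappa> * f x) (at x))"

lemma ode_pair_deriv: "ode_pair \<kappa> f f' \<Longrightarrow> ode_pair \<kappa> f' (\<lambda>x. \<kappa> * f x)"
  by (auto simp: ode_pair_def intro!: DERIV_cmult)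

lemma ode_pair_DERIV:
  assumes "ode_pair \<kappa> f f'"
  shows "(f has_real_derivative f' x) (at x within S)" "(f' has_real_derivative \<kappa> * f x) (at x within S)"
  using assms by (auto simp: ode_pair_def intro: has_field_derivative_at_within)

lemma ode_pair_continuous:
  assumes "ode_pair \<kappa> f f'"
  shows "continuous_on S f" "continuous_on S f'"
  using ode_pair_DERIV[OF assms] by (meson DERIV_continuous_on)+

lemma sepsum_has_derivative:
  assumes F: "\<And>n x. (F n has_real_derivative F' n x) (at x)"
    and G: "\<And>n y. (G n has_real_derivative G' n y) (at y)"
  shows "(sepsum c F G N has_derivative
    (\<lambda>h. of_real (fst h) * sepsum c F' G N p + of_real (snd h) * sepsum c F G' N p)) (at p)"
proof -
  have f: "((\<lambda>p. complex_of_real (F n (fst p))) has_derivative (\<lambda>h. of_real (fst h * F' n (fst p)))) (at p)" for n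
    by (intro has_derivative_of_real DERIV_compose_FDERIV[OF F] has_derivative_fst has_derivative_ident)
  have g: "((\<lambda>p. complex_of_real (G n (snd p))) has_derivative (\<lambda>h. of_real (snd h * G' n (snd p)))) (at p)" for n
    by (intro has_derivative_of_real DERIV_compose_FDERIV[OF G] has_derivative_snd has_derivative_ident)
  have "((\<lambda>p. \<Sum>n<N. c n * (of_real (F n (fst p)) * of_real (G n (snd p)))) has_derivative
     (\<lambda>h. \<Sum>n<N. c n * (of_real (F n (fst p)) * of_real (snd h * G' n (snd p))
        + of_real (fst h * F' n (fst p)) * of_real (G n (snd p))))) (at p)"
    by (intro has_derivative_sum has_derivative_mult_right has_derivative_mult f g)
  then show ?thesis
    unfolding sepsum_def mult.assoc
    by (rule has_derivative_eq_rhs) (simp add: fun_eq_iff sum_distrib_left algebra_simps flip: sum.distrib)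
qed

lemma dir_deriv_sepsum:
  assumes "\<And>n x. (F n has_real_derivative F' n x) (at x)"
    and "\<And>n y. (G n has_real_derivative G' n y) (at y)"
  shows "dir_deriv (1, 0) (sepsum c F G N) = sepsum c F' G N"
    and "dir_deriv (0, 1) (sepsum c F G N) = sepsum c F G' N"
proof -
  note D = dir_deriv_eqI[OF sepsum_has_derivative[OF assms]]
  show "dir_deriv (1, 0) (sepsum c F G N) = sepsum c F' G N"
    by (rule ext) (simp add: D)
  show "dir_deriv (0, 1) (sepsum c F G N) = sepsum c F G' N"
    by (rule ext) (simp add: D)
qed

lemma sepsum_continuous:
  assumes "\<And>n. continuous_on UNIV (F n)" "\<And>n. continuous_on UNIV (G n)"
  shows "continuous_on UNIV (sepsum c F G N)"
  unfolding sepsum_def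
  by (intro continuous_intros continuous_on_compose2[OF assms(1)] continuous_on_compose2[OF assms(2)]) auto

text \<open>The factors are generalised in the induction because each partial derivative of a
  separated sum is a separated sum of other factors, which again form pairs.\<close>

lemma sepsum_C_k:
  assumes "\<And>n. ode_pair (\<kappa> n) (F n) (F' n)" "\<And>n. ode_pair (l n) (G n) (G' n)"
  shows "C_k k (sepsum c F G N)"
  using assms
proof (induction k arbitrary: F F' G G')
  case 0
  then show ?case by (auto intro!: sepsum_continuous intro: ode_pair_continuous)
next
  case (Suc k)
  have d: "\<And>n x. (F n has_real_derivative F' n x) (at x)" "\<And>n y. (G n has_real_derivative G' n y) (at y)"
    using ode_pair_DERIV(1)[OF Suc.prems(1)] ode_pair_DERIV(1)[OF Suc.prems(2)] by auto
  have "sepsum c F G N differentiable (at p)" for p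
    using sepsum_has_derivative[of F F' G G', OF d] by (rule differentiableI)
  moreover have "C_k k (dir_deriv e (sepsum c F G N))" if "e \<in> Basis" for e
    using that Suc.IH[OF ode_pair_deriv[OF Suc.prems(1)] Suc.prems(2)]
      Suc.IH[OF Suc.prems(1) ode_pair_deriv[OF Suc.prems(2)]]
    by (auto simp: Basis_real_pair dir_deriv_sepsum[OF d])
  ultimately show ?case by simp
qed

lemma sepsum_smooth:
  assumes "\<And>n. ode_pair (\<kappa> n) (F n) (F' n)" "\<And>n. ode_pair (l n) (G n) (G' n)"
  shows "smooth (sepsum c F G N)"
  unfolding smooth_def using sepsum_C_k[of \<kappa> F F' l G G', OF assms] by blast

section \<open>Orthogonal expansions on the interval and on the square\<close>

lemma orthogonal_sum_integral:
  fixes F :: "nat \<Rightarrow> real \<Rightarrow> real" and b :: "nat \<Rightarrow> complex"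
  assumes "finite I" and c: "\<And>n. continuous_on {0..1} (F n)"
    and orth: "\<And>n m. n \<noteq> m \<Longrightarrow> integral {0..1} (\<lambda>x. F n x * F m x) = 0"
  shows "integral {0..1} (\<lambda>x. (cmod (\<Sum>n\<in>I. b n * of_real (F n x)))\<^sup>2)
     = (\<Sum>n\<in>I. (cmod (b n))\<^sup>2 * integral {0..1} (\<lambda>x. (F n x)\<^sup>2))"
proof -
  have "(cmod (\<Sum>n\<in>I. b n * of_real (F n x)))\<^sup>2 = (\<Sum>n\<in>I. \<Sum>m\<in>I. (b n \<bullet> b m) * (F n x * F m x))" for x
  proof -
    have "b n * of_real (F n x) = F n x *\<^sub>R b n" for n by (simp add: scaleR_conv_of_real)
    then show ?thesis
      by (simp add: power2_norm_eq_inner inner_sum_left inner_sum_right sum_distrib_left inner_commute mult_ac)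
  qed
  then have "integral {0..1} (\<lambda>x. (cmod (\<Sum>n\<in>I. b n * of_real (F n x)))\<^sup>2)
     = integral {0..1} (\<lambda>x. \<Sum>n\<in>I. \<Sum>m\<in>I. (b n \<bullet> b m) * (F n x * F m x))" by simp
  also have "\<dots> = (\<Sum>n\<in>I. \<Sum>m\<in>I. (b n \<bullet> b m) * integral {0..1} (\<lambda>x. F n x * F m x))"
    using \<open>finite I\<close>
    by (simp add: integral_sum integrable_continuous_interval continuous_intros c integrable_sum)
  also have "\<dots> = (\<Sum>n\<in>I. \<Sum>m\<in>I. if m = n then (b n \<bullet> b n) * integral {0..1} (\<lambda>x. F n x * F n x) else 0)"
    by (intro sum.cong refl) (auto simp: orth)
  also have "\<dots> = (\<Sum>n\<in>I. (b n \<bullet> b n) * integral {0..1} (\<lambda>x. F n x * F n x))"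
    using \<open>finite I\<close> by (simp add: sum.delta)
  also have "\<dots> = (\<Sum>n\<in>I. (cmod (b n))\<^sup>2 * integral {0..1} (\<lambda>x. (F n x)\<^sup>2))"
    by (simp only: power2_norm_eq_inner power2_eq_square[of "F _ _"])
  finally show ?thesis .
qed

lemma sqn_unit_continuous:
  fixes f :: "real \<Rightarrow> complex"
  assumes "continuous_on UNIV f"
  shows "f \<in> L2 (lebesgue_on {0<..<1})"
    and "sqn (lebesgue_on {0<..<1}) f = integral {0..1} (\<lambda>x. (cmod (f x))\<^sup>2)"
proof -
  have "bounded (f ` {0..1})"
    by (intro compact_imp_bounded compact_continuous_image continuous_on_subset[OF assms]) auto
  then obtain B where "\<forall>y\<in>f ` {0..1}. cmod y \<le> B" unfolding bounded_iff by blast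
  then have "\<And>x. x \<in> {0..1} \<Longrightarrow> cmod (f x) \<le> B" by blast
  then show L: "f \<in> L2 (lebesgue_on {0<..<1})"
    by (intro L2_bounded[where B = B] finite_measure_unit continuous_measurable_lebesgue_on assms) auto
  have "sqn (lebesgue_on {0<..<1}) f = integral {0<..<1} (\<lambda>x. (cmod (f x))\<^sup>2)"
    unfolding sqn_def
    by (intro lebesgue_integral_eq_integral L2_integrable_power2 L) simp
  also have "\<dots> = integral {0..1} (\<lambda>x. (cmod (f x))\<^sup>2)"
    using integral_open_interval[of 0 1 "\<lambda>x. (cmod (f x))\<^sup>2"] by (simp add: cbox_interval)
  finally show "sqn (lebesgue_on {0<..<1}) f = integral {0..1} (\<lambda>x. (cmod (f x))\<^sup>2)" .
qed

text \<open>Orthogonality is available in x only. It is applied on each horizontal line, with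
  \<open>c n * G n y\<close> as coefficients, and the squares are integrated over y afterwards; the
  functions G n may be arbitrary continuous ones.\<close>

lemma sepsum_converges:
  assumes F: "\<And>n. continuous_on UNIV (F n)" and G: "\<And>n. continuous_on UNIV (G n)"
    and orth: "\<And>n m. n \<noteq> m \<Longrightarrow> integral {0..1} (\<lambda>x. F n x * F m x) = 0"
    and sum: "summable (\<lambda>n. (cmod (c n))\<^sup>2 * integral {0..1} (\<lambda>x. (F n x)\<^sup>2) * integral {0..1} (\<lambda>y. (G n y)\<^sup>2))"
  shows "\<exists>v. L2_tendsto (lebesgue_on \<Omega>) (sepsum c F G) v"
proof -
  let ?h = "\<lambda>n p. c n * of_real (F n (fst p)) * of_real (G n (snd p))"
  have ch: "continuous_on UNIV (\<lambda>p. \<Sum>n\<in>I. ?h n p)" for I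
    by (intro continuous_intros continuous_on_compose2[OF F] continuous_on_compose2[OF G]) auto
  have FS: "continuous_on {0..1} (F n)" and GS: "continuous_on {0..1} (G n)" for n
    by (auto intro: continuous_on_subset[OF F] continuous_on_subset[OF G])
  have "\<exists>v. L2_tendsto (lebesgue_on \<Omega>) (\<lambda>N p. \<Sum>n<N. ?h n p) v"
  proof (rule L2_series_converges[where h = ?h, OF finite_measure_Omega _ sum])
    show "?h n \<in> L2 (lebesgue_on \<Omega>)" for n
      using L2_Omega_continuous[OF ch[of "{n}"]] by simp
    fix i j :: nat
    have "sqn (lebesgue_on \<Omega>) (\<lambda>p. \<Sum>n=i..<j. ?h n p)
       = integral {0..1} (\<lambda>y. integral {0..1} (\<lambda>x. (cmod (\<Sum>n=i..<j. (c n * of_real (G n y)) * of_real (F n x)))\<^sup>2))"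
      unfolding sqn_Omega_continuous(2)[OF ch] by (simp add: mult_ac)
    also have "\<dots> = integral {0..1} (\<lambda>y. \<Sum>n=i..<j. (cmod (c n * of_real (G n y)))\<^sup>2 * integral {0..1} (\<lambda>x. (F n x)\<^sup>2))"
      by (subst orthogonal_sum_integral[OF _ FS orth]) auto
    also have "\<dots> = (\<Sum>n=i..<j. (cmod (c n))\<^sup>2 * integral {0..1} (\<lambda>x. (F n x)\<^sup>2) * integral {0..1} (\<lambda>y. (G n y)\<^sup>2))"
      by (subst integral_sum)
        (auto simp: norm_mult power_mult_distrib mult_ac intro!: sum.cong integrable_continuous_interval continuous_intros GS)
    finally show "sqn (lebesgue_on \<Omega>) (\<lambda>p. \<Sum>n=i..<j. ?h n p)
      \<le> (\<Sum>n=i..<j. (cmod (c n))\<^sup>2 * integral {0..1} (\<lambda>x. (F n x)\<^sup>2) * integral {0..1} (\<lambda>y. (G n y)\<^sup>2))"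
      by simp
  qed
  then show ?thesis by (simp add: sepsum_def[abs_def])
qed

lemma orthogonal_series_converges:
  fixes F :: "nat \<Rightarrow> real \<Rightarrow> real"
  assumes F: "\<And>n. continuous_on UNIV (F n)"
    and orth: "\<And>n m. n \<noteq> m \<Longrightarrow> integral {0..1} (\<lambda>x. F n x * F m x) = 0"
    and sum: "summable (\<lambda>n. (cmod (c n))\<^sup>2 * integral {0..1} (\<lambda>x. (F n x)\<^sup>2))"
  shows "\<exists>v. L2_tendsto (lebesgue_on {0<..<1}) (\<lambda>N x. \<Sum>n<N. c n * of_real (F n x)) v"
proof (rule L2_series_converges[where h = "\<lambda>n x. c n * of_real (F n x)", OF finite_measure_unit _ sum])
  have ch: "continuous_on UNIV (\<lambda>x. \<Sum>n\<in>I. c n * of_real (F n x))" for I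
    by (intro continuous_intros continuous_on_compose2[OF F]) auto
  show "(\<lambda>x. c n * of_real (F n x)) \<in> L2 (lebesgue_on {0<..<1})" for n
    using sqn_unit_continuous(1)[OF ch[of "{n}"]] by simp
  fix i j :: nat
  show "sqn (lebesgue_on {0<..<1}) (\<lambda>x. \<Sum>n=i..<j. c n * of_real (F n x))
    \<le> (\<Sum>n=i..<j. (cmod (c n))\<^sup>2 * integral {0..1} (\<lambda>x. (F n x)\<^sup>2))"
    unfolding sqn_unit_continuous(2)[OF ch]
    by (subst orthogonal_sum_integral[OF _ continuous_on_subset[OF F] orth]) auto
qed

text \<open>Integrating \<open>(f' h)'\<close> and \<open>(h' f)'\<close>: orthogonality of the eigenfunctions and of their
  derivatives needs only that the boundary terms vanish.\<close>

lemma sturm_orthogonal: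
  assumes f: "ode_pair (- \<mu>\<^sup>2) f f'" and h: "ode_pair (- \<nu>\<^sup>2) h h'"
    and bd: "f' 0 * h 0 = 0" "f' 1 * h 1 = 0" "h' 0 * f 0 = 0" "h' 1 * f 1 = 0"
  shows "(\<mu>\<^sup>2 - \<nu>\<^sup>2) * integral {0..1} (\<lambda>x. f x * h x) = 0"
    and "integral {0..1} (\<lambda>x. f' x * h' x) = \<mu>\<^sup>2 * integral {0..1} (\<lambda>x. f x * h x)"
proof -
  note c [continuous_intros] = ode_pair_continuous[OF f] ode_pair_continuous[OF h]
  have e: "integral {0..1} (\<lambda>x. u' x * v' x) = \<kappa>\<^sup>2 * integral {0..1} (\<lambda>x. u x * v x)"
    if u: "ode_pair (- \<kappa>\<^sup>2) u u'" and v: "ode_pair (- \<kappa>'\<^sup>2) v v'"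
      and b: "u' 0 * v 0 = 0" "u' 1 * v 1 = 0" for u u' v v' \<kappa> \<kappa>'
  proof -
    note [continuous_intros] = ode_pair_continuous[OF u] ode_pair_continuous[OF v]
    have "((\<lambda>x. u' x * v' x - \<kappa>\<^sup>2 * (u x * v x)) has_integral u' 1 * v 1 - u' 0 * v 0) {0..1}"
      by (intro fundamental_theorem_of_calculus)
        (auto intro!: derivative_eq_intros ode_pair_DERIV[OF u] ode_pair_DERIV[OF v]
          simp: algebra_simps simp flip: has_real_derivative_iff_has_vector_derivative)
    then have "integral {0..1} (\<lambda>x. u' x * v' x - \<kappa>\<^sup>2 * (u x * v x)) = 0"
      by (simp add: b integral_unique)
    moreover have "integral {0..1} (\<lambda>x. u' x * v' x - \<kappa>\<^sup>2 * (u x * v x)) =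
        integral {0..1} (\<lambda>x. u' x * v' x) - \<kappa>\<^sup>2 * integral {0..1} (\<lambda>x. u x * v x)"
      by (subst integral_diff) (auto intro!: integrable_continuous_interval continuous_intros)
    ultimately show ?thesis by simp
  qed
  show 1: "integral {0..1} (\<lambda>x. f' x * h' x) = \<mu>\<^sup>2 * integral {0..1} (\<lambda>x. f x * h x)"
    by (rule e[OF f h bd(1,2)])
  have "integral {0..1} (\<lambda>x. h' x * f' x) = \<nu>\<^sup>2 * integral {0..1} (\<lambda>x. h x * f x)"
    by (rule e[OF h f bd(3,4)])
  with 1 show "(\<mu>\<^sup>2 - \<nu>\<^sup>2) * integral {0..1} (\<lambda>x. f x * h x) = 0"
    by (simp add: mult.commute algebra_simps)
qed

text \<open>What the later argument uses of the four systems. At each end point either all X n or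
  all their derivatives vanish, which gives the mixed products for all pairs of indices. The
  quadratic identity is sin^2 + cos^2 = 1, and the linear lower bound on \<mu> comes from pi \<ge>
  1.\<close>

lemma eigensystem_basic:
  assumes "eigensystem \<mu> X"
  shows "ode_pair (- (\<mu> n)\<^sup>2) (X n) (deriv (X n))"
    and "deriv (X n) 0 * X m 0 = 0" and "deriv (X n) 1 * X m 1 = 0"
    and "(deriv (X n) x)\<^sup>2 + (\<mu> n)\<^sup>2 * (X n x)\<^sup>2 = 2 * (\<mu> n)\<^sup>2"
    and "\<bar>X n x\<bar> \<le> sqrt 2"
    and "\<mu> n = 0 \<Longrightarrow> X n = (\<lambda>x. 0) \<or> X n = (\<lambda>x. 1)"
    and "0 \<le> \<mu> n" and "inj \<mu>"
    and "real n \<le> \<mu> n"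
proof -
  have half: "cos ((real n + 1/2) * pi) = 0" for n
    using sin_npi[of n] by (simp add: distrib_right cos_add)
  have sin_case: "ode_pair (- k\<^sup>2) (\<lambda>x. sqrt 2 * sin (k * x)) (\<lambda>x. sqrt 2 * k * cos (k * x))" for k
    unfolding ode_pair_def
    by (auto intro!: derivative_eq_intros simp: power2_eq_square)
  have cos_case: "ode_pair (- k\<^sup>2) (\<lambda>x. sqrt 2 * cos (k * x)) (\<lambda>x. - (sqrt 2 * k * sin (k * x)))" for k
    unfolding ode_pair_def
    by (auto intro!: derivative_eq_intros simp: power2_eq_square)
  have one: "ode_pair 0 (\<lambda>x. 1) (\<lambda>x. 0)" by (simp add: ode_pair_def)
  have derivD: "deriv f = f'" if "ode_pair k f f'" for k f f'
    using ode_pair_DERIV(1)[OF that] DERIV_imp_deriv by blast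
  note dsin = derivD[OF sin_case] and dcos = derivD[OF cos_case]
  have sq: "(sqrt 2 * k * a)\<^sup>2 + k\<^sup>2 * (sqrt 2 * b)\<^sup>2 = 2 * k\<^sup>2" if "a\<^sup>2 + b\<^sup>2 = 1" for a b k :: real
  proof -
    have "(sqrt 2 * k * a)\<^sup>2 + k\<^sup>2 * (sqrt 2 * b)\<^sup>2 = 2 * k\<^sup>2 * (a\<^sup>2 + b\<^sup>2)"
      by (simp add: power_mult_distrib algebra_simps)
    then show ?thesis using that by simp
  qed
  consider (sn) "\<mu> = (\<lambda>n. real n * pi)" "X = (\<lambda>n x. sqrt 2 * sin (\<mu> n * x))"
    | (cn) "\<mu> = (\<lambda>n. real n * pi)" "X = (\<lambda>n x. if n = 0 then 1 else sqrt 2 * cos (\<mu> n * x))"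
    | (sh) "\<mu> = (\<lambda>n. (real n + 1/2) * pi)" "X = (\<lambda>n x. sqrt 2 * sin (\<mu> n * x))"
    | (ch) "\<mu> = (\<lambda>n. (real n + 1/2) * pi)" "X = (\<lambda>n x. sqrt 2 * cos (\<mu> n * x))"
  proof -
    \<comment> \<open>The sine formula already gives 0 at index 0, so this system needs no separate
      case.\<close>
    have "(\<lambda>n x. if n = 0 then 0 else sqrt 2 * sin (real n * pi * x)) = (\<lambda>n x. sqrt 2 * sin (real n * pi * x))"
      by (intro ext) auto
    then show ?thesis using assms that unfolding eigensystem_def by auto
  qed
  note cases = this
  have pi1: "pi \<ge> 1" using pi_gt3 by simp
  have mu: "\<mu> = (\<lambda>n. real n * pi) \<or> \<mu> = (\<lambda>n. (real n + 1/2) * pi)"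
    using assms by (auto simp: eigensystem_def)
  then show "0 \<le> \<mu> n" by auto
  show "inj \<mu>" using mu by (auto simp: inj_def)
  show "real n \<le> \<mu> n"
    using mu mult_left_mono[OF pi1, of "real n"] pi1 by (auto simp: algebra_simps)
  show ode: "ode_pair (- (\<mu> n)\<^sup>2) (X n) (deriv (X n))" for n
  proof (cases rule: cases)
    case cn
    then show ?thesis using one derivD[OF one] by (cases "n = 0") (simp_all add: dcos cos_case)
  qed (simp_all add: dsin dcos sin_case cos_case)
  have X1: "deriv (X n) = (\<lambda>x. sqrt 2 * \<mu> n * cos (\<mu> n * x)) \<or> deriv (X n) = (\<lambda>x. - (sqrt 2 * \<mu> n * sin (\<mu> n * x)))" for n
  proof (cases rule: cases)
    case cn
    then show ?thesis using derivD[OF one] by (cases "n = 0") (simp_all add: dcos)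
  qed (simp_all add: dsin dcos)
  show "deriv (X n) 0 * X m 0 = 0"
  proof (cases rule: cases)
    case cn
    then show ?thesis using derivD[OF one] by (cases "n = 0") (simp_all add: dcos)
  qed (simp_all add: dsin dcos)
  show "deriv (X n) 1 * X m 1 = 0"
  proof (cases rule: cases)
    case cn
    then show ?thesis using derivD[OF one] by (cases "n = 0") (simp_all add: dcos)
  qed (simp_all add: dsin dcos half)
  show "(deriv (X n) x)\<^sup>2 + (\<mu> n)\<^sup>2 * (X n x)\<^sup>2 = 2 * (\<mu> n)\<^sup>2"
  proof (cases rule: cases)
    case cn
    then show ?thesis using derivD[OF one] sq[of "sin (\<mu> n * x)" "cos (\<mu> n * x)" "\<mu> n"]
      by (cases "n = 0") (simp_all add: dcos)
  qed (use sq[of "sin (\<mu> n * x)" "cos (\<mu> n * x)" "\<mu> n"] sq[of "cos (\<mu> n * x)" "sin (\<mu> n * x)" "\<mu> n"]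
      in \<open>simp_all add: dsin dcos\<close>)
  have "sqrt 2 \<ge> 1" by simp
  then show "\<bar>X n x\<bar> \<le> sqrt 2"
  proof (cases rule: cases)
    case cn
    then show ?thesis using \<open>sqrt 2 \<ge> 1\<close> by (simp add: abs_mult)
  qed (simp_all add: abs_mult)
  show "X n = (\<lambda>x. 0) \<or> X n = (\<lambda>x. 1)" if "\<mu> n = 0"
    using that by (cases rule: cases) (auto simp: add_nonneg_eq_0_iff)
qed

text \<open>The normalisation needs no explicit trigonometric integral: the integral of X'^2 equals
  \<mu>^2 times that of X^2, and their pointwise combination is the constant 2 * \<mu>^2, so \<mu>^2
  cancels. For \<mu> = 0 the function is 0 or 1. Orthogonality uses that \<mu> is injective and
  nonnegative, so the squares are distinct as well.\<close>

lemma eigensystem_orthogonal: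
  assumes "eigensystem \<mu> X"
  shows "n \<noteq> m \<Longrightarrow> integral {0..1} (\<lambda>x. X n x * X m x) = 0"
    and "n \<noteq> m \<Longrightarrow> integral {0..1} (\<lambda>x. deriv (X n) x * deriv (X m) x) = 0"
    and "integral {0..1} (\<lambda>x. (deriv (X n) x)\<^sup>2) \<le> (\<mu> n)\<^sup>2"
    and "integral {0..1} (\<lambda>x. (X n x)\<^sup>2) = 1 \<or> X n = (\<lambda>x. 0)"
    and "integral {0..1} (\<lambda>x. (X n x)\<^sup>2) \<le> 1"
proof -
  note b = eigensystem_basic[OF assms]
  note o = sturm_orthogonal[OF b(1) b(1) b(2) b(3) b(2) b(3)]
  show z: "integral {0..1} (\<lambda>x. X n x * X m x) = 0" if "n \<noteq> m" for n m
  proof -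
    have "\<mu> n \<noteq> \<mu> m" using b(8) that by (auto dest: injD)
    then have "(\<mu> n)\<^sup>2 \<noteq> (\<mu> m)\<^sup>2" using b(7)[of n] b(7)[of m] by (auto simp: power2_eq_iff_nonneg)
    then show ?thesis using o(1)[of n m] by simp
  qed
  show "integral {0..1} (\<lambda>x. deriv (X n) x * deriv (X m) x) = 0" if "n \<noteq> m"
    using o(2)[of n m] z[OF that] by simp
  have d: "integral {0..1} (\<lambda>x. (deriv (X n) x)\<^sup>2) = (\<mu> n)\<^sup>2 * integral {0..1} (\<lambda>x. (X n x)\<^sup>2)"
    using o(2)[of n n] by (simp add: power2_eq_square)
  note c [continuous_intros] = ode_pair_continuous[OF b(1)]
  have "integral {0..1} (\<lambda>x. (deriv (X n) x)\<^sup>2 + (\<mu> n)\<^sup>2 * (X n x)\<^sup>2)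
      = integral {0..1} (\<lambda>x. (deriv (X n) x)\<^sup>2) + (\<mu> n)\<^sup>2 * integral {0..1} (\<lambda>x. (X n x)\<^sup>2)"
    by (subst integral_add) (auto intro!: integrable_continuous_interval continuous_intros)
  then have "(\<mu> n)\<^sup>2 * integral {0..1} (\<lambda>x. (X n x)\<^sup>2) = (\<mu> n)\<^sup>2"
    unfolding b(4) d by simp
  then show e: "integral {0..1} (\<lambda>x. (X n x)\<^sup>2) = 1 \<or> X n = (\<lambda>x. 0)"
    using b(6)[of n] by auto
  then show le: "integral {0..1} (\<lambda>x. (X n x)\<^sup>2) \<le> 1" by auto
  show "integral {0..1} (\<lambda>x. (deriv (X n) x)\<^sup>2) \<le> (\<mu> n)\<^sup>2"
    unfolding d using mult_left_mono[OF le, of "(\<mu> n)\<^sup>2"] by simp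
qed

lemma eigensystem_deriv_bound:
  assumes "eigensystem \<mu> X"
  shows "\<bar>deriv (X n) x\<bar> \<le> sqrt 2 * \<mu> n"
proof -
  note b = eigensystem_basic[OF assms]
  have "(deriv (X n) x)\<^sup>2 \<le> (sqrt 2 * \<mu> n)\<^sup>2"
    using b(4)[of n x] by (simp add: power_mult_distrib) (metis add_le_same_cancel1 b(4) le_add_same_cancel1 mult_nonneg_nonneg zero_le_power2)
  then show ?thesis
    using abs_le_square_iff[of "deriv (X n) x" "sqrt 2 * \<mu> n"] b(7)[of n] by simp
qed

section \<open>Completeness of the eigensystems\<close>

lemma integrable_mult_bounded:
  fixes f :: "'a \<Rightarrow> complex"
  assumes "integrable M f" "\<psi> \<in> borel_measurable M" "\<And>x. x \<in> space M \<Longrightarrow> \<bar>\<psi> x\<bar> \<le> B"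
  shows "integrable M (\<lambda>x. f x * of_real (\<psi> x))"
proof (rule Bochner_Integration.integrable_bound[of _ "\<lambda>x. of_real B * f x"])
  show "AE x in M. norm (f x * of_real (\<psi> x)) \<le> norm (of_real B * f x)"
  proof (rule AE_I2)
    fix x assume "x \<in> space M"
    from assms(3)[OF this] have "\<bar>\<psi> x\<bar> \<le> \<bar>B\<bar>" by linarith
    then show "norm (f x * of_real (\<psi> x)) \<le> norm (of_real B * f x)"
      by (simp add: norm_mult mult.commute[of "\<bar>B\<bar>"] mult_left_mono)
  qed
qed (use assms in auto)

lemma sigma_finite_lebesgue: "sigma_finite_measure (lebesgue :: 'a::euclidean_space measure)"
proof
  obtain A :: "nat \<Rightarrow> 'a set" where A: "range A \<subseteq> sets lborel" "(\<Union>i. A i) = space lborel" "\<And>i. emeasure lborel (A i) \<noteq> \<infinity>"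
    using lborel.sigma_finite by blast
  then show "\<exists>A :: 'a set set. countable A \<and> A \<subseteq> sets lebesgue \<and> \<Union>A = space lebesgue \<and> (\<forall>a\<in>A. emeasure lebesgue a \<noteq> \<infinity>)"
    by (intro exI[of _ "range A"]) auto
qed

text \<open>Half-lines form an intersection-stable generator of the Borel sets, and the vanishing
  total integral gives closure under complements; a Dynkin argument then covers all Borel sets.
  Every Lebesgue set is Borel up to a null set.\<close>

lemma AE_zero_if_integral_lessThan_zero:
  fixes f :: "real \<Rightarrow> complex"
  assumes int: "integrable lebesgue f" and zero: "\<And>a. (LINT x:{..<a}|lebesgue. f x) = 0"
    and total: "(LINT x|lebesgue. f x) = 0"
  shows "AE x in lebesgue. f x = 0"
proof (rule sigma_finite_measure.density_zero[OF sigma_finite_lebesgue int])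
  have si: "set_integrable lebesgue A f" if "A \<in> sets lebesgue" for A
    unfolding set_integrable_def using that int by (intro integrable_mult_indicator) auto
  have bor: "(LINT x:B|lebesgue. f x) = 0" if "B \<in> sets borel" for B
  proof -
    have borel_sets: "sets (borel :: real measure) = sigma_sets UNIV (range lessThan)"
      by (subst borel_Iio) (simp add: sets_measure_of)
    then have "B \<in> sigma_sets UNIV (range lessThan)" using that by simp
    have "Int_stable (range lessThan :: real set set)"
    proof (rule Int_stableI)
      fix A B :: "real set" assume "A \<in> range lessThan" "B \<in> range lessThan"
      then obtain a b where "A = {..<a}" "B = {..<b}" by blast
      then have "A \<inter> B = {..<min a b}" by auto
      then show "A \<inter> B \<in> range lessThan" by blast
    qed
    moreover have "range lessThan \<subseteq> Pow (UNIV :: real set)" by simp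
    ultimately show ?thesis using \<open>B \<in> sigma_sets UNIV (range lessThan)\<close>
    proof (induction rule: sigma_sets_induct_disjoint)
      case (basic A)
      then show ?case using zero by auto
    next
      case empty
      then show ?case by (simp add: set_lebesgue_integral_def)
    next
      case (compl A)
      have A: "A \<in> sets lebesgue"
        using compl(1) by (simp flip: borel_sets)
      have "(LINT x:A \<union> (UNIV - A)|lebesgue. f x) = (LINT x:A|lebesgue. f x) + (LINT x:UNIV - A|lebesgue. f x)"
        by (intro set_integral_Un si) (use A in auto)
      then show ?case using compl(2) total by (simp add: set_lebesgue_integral_def)
    next
      case (union A)
      have A: "A i \<in> sets lebesgue" for i
        using union(2) by (auto simp flip: borel_sets)
      have "(LINT x:(\<Union>i. A i)|lebesgue. f x) = (\<Sum>i. LINT x:A i|lebesgue. f x)"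
        using union(1) by (intro lebesgue_integral_countable_add A si) (auto simp: disjoint_family_on_def A)
      then show ?case using union(3) by simp
    qed
  qed
  fix A :: "real set" assume "A \<in> sets lebesgue"
  then obtain S N N' where *: "A = S \<union> N" "N \<subseteq> N'" "N' \<in> null_sets lborel" "S \<in> sets lborel"
    by (rule sets_completionE)
  have "AE x in lebesgue. x \<notin> N'"
    using *(3) AE_completion AE_not_in by blast
  then have "AE x in lebesgue. indicator A x *\<^sub>R f x = indicator S x *\<^sub>R f x"
    by eventually_elim (use * in \<open>auto simp: indicator_def\<close>)
  then have "(LINT x:A|lebesgue. f x) = (LINT x:S|lebesgue. f x)"
    unfolding set_lebesgue_integral_def
    using \<open>A \<in> sets lebesgue\<close> *(4) int
    by (intro integral_cong_AE borel_measurable_scaleR borel_measurable_indicator) auto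
  then show "(LINT x:A|lebesgue. f x) = 0" using bor[of S] *(4) by simp
qed

text \<open>Product-to-sum formulas turn the vanishing cosine coefficients into vanishing integrals
  against powers of cos (pi * x), hence against polynomials in it and, by Weierstrass, against all
  continuous functions of it. Since cos (pi * x) is strictly decreasing on [0,1], these approximate
  the indicators of half-lines.\<close>

lemma cosine_complete:
  fixes h :: "real \<Rightarrow> complex"
  defines "M \<equiv> lebesgue_on {0<..<1}"
  assumes int: "integrable M h"
    and zero: "\<And>n::nat. (\<integral>x. h x * of_real (cos (real n * pi * x)) \<partial>M) = 0"
  shows "AE x in M. h x = 0"
proof -
  have meas: "\<psi> \<in> borel_measurable M" if "continuous_on UNIV \<psi>" for \<psi> :: "real \<Rightarrow> real"
    unfolding M_def by (intro continuous_measurable_lebesgue_on that) simp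
  have sp: "space M = {0<..<1}" by (simp add: M_def)
  have power: "integrable M (\<lambda>x. h x * of_real (cos (pi * x) ^ m * cos (real n * pi * x)))" for m n :: nat
    by (intro integrable_mult_bounded[OF int meas, of _ 1] continuous_intros)
      (auto simp: abs_mult power_abs intro!: mult_le_one power_le_one)
  have 1: "(\<integral>x. h x * of_real (cos (pi * x) ^ m * cos (real n * pi * x)) \<partial>M) = 0" for m n
  proof (induction m arbitrary: n)
    case 0
    then show ?case by (simp add: zero)
  next
    case (Suc m)
    show ?case
    proof (cases n)
      case 0
      \<comment> \<open>At n = 0 the extra factor cos (pi * x) is itself the mode of index 1; the
        product formula below would refer to index n - 1.\<close>
      then show ?thesis using Suc[of 1] by (simp add: mult.commute)
    next
      case (Suc k)
      have prod: "cos (pi * x) * cos (real n * pi * x) = (cos (real k * pi * x) + cos (real (n + 1) * pi * x)) / 2" for x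
        using cos_times_cos[of "real n * pi * x" "pi * x"] by (simp add: Suc algebra_simps)
      have e: "cos (pi * x) ^ Suc m * cos (real n * pi * x) =
          (cos (pi * x) ^ m * cos (real k * pi * x) + cos (pi * x) ^ m * cos (real (n + 1) * pi * x)) / 2" for x
        unfolding power_Suc2 mult.assoc[of "cos (pi * x) ^ m" "cos (pi * x)"] prod
        by (simp only: distrib_left times_divide_eq_right)
      have "(\<integral>x. h x * of_real (cos (pi * x) ^ Suc m * cos (real n * pi * x)) \<partial>M) =
        ((\<integral>x. h x * of_real (cos (pi * x) ^ m * cos (real k * pi * x))
          + h x * of_real (cos (pi * x) ^ m * cos (real (n + 1) * pi * x)) \<partial>M)) / 2"
        unfolding e of_real_divide of_real_add
        by (subst integral_divide_zero[symmetric]) (simp add: distrib_left add_divide_distrib)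
      also have "\<dots> = 0"
        by (subst Bochner_Integration.integral_add[OF power power]) (simp only: Suc.IH, simp)
      finally show ?thesis .
    qed
  qed
  have 2: "(\<integral>x. h x * of_real (p (cos (pi * x))) \<partial>M) = 0" if p: "real_polynomial_function p" for p
  proof -
    obtain a n where pn: "p = (\<lambda>x. \<Sum>i\<le>n. a i * x ^ i)"
      using p unfolding real_polynomial_function_iff_sum by blast
    have "(\<integral>x. h x * of_real (p (cos (pi * x))) \<partial>M)
        = (\<integral>x. (\<Sum>i\<le>n. of_real (a i) * (h x * of_real (cos (pi * x) ^ i * cos (real 0 * pi * x)))) \<partial>M)"
      by (simp add: pn sum_distrib_left mult_ac)
    also have "\<dots> = (\<Sum>i\<le>n. of_real (a i) * (\<integral>x. h x * of_real (cos (pi * x) ^ i * cos (real 0 * pi * x)) \<partial>M))"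
      by (subst Bochner_Integration.integral_sum) (intro integrable_mult_right power, rule sum.cong[OF refl], rule integral_mult_right_zero)
    also have "\<dots> = 0" using 1[of _ 0] by simp
    finally show ?thesis .
  qed
  have 3: "(\<integral>x. h x * of_real (F (cos (pi * x))) \<partial>M) = 0" if F: "continuous_on UNIV F" for F :: "real \<Rightarrow> real"
  proof -
    have iF: "integrable M (\<lambda>x. h x * of_real (G (cos (pi * x))))" if G: "continuous_on UNIV G" for G :: "real \<Rightarrow> real"
    proof -
      have "bounded (G ` {-1..1})"
        by (intro compact_imp_bounded compact_continuous_image continuous_on_subset[OF G]) auto
      then obtain B where B: "\<forall>y\<in>G ` {-1..1}. norm y \<le> B" unfolding bounded_iff by blast
      show ?thesis
        by (intro integrable_mult_bounded[OF int meas, of _ B] continuous_on_compose2[OF G] continuous_intros)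
          (use B in auto)
    qed
    define I where "I = (\<integral>x. cmod (h x) \<partial>M)"
    have "I \<ge> 0" by (simp add: I_def)
    \<comment> \<open>I + 1 stands in for the L1 norm I so that one can later divide by it even if h
      vanishes.\<close>
    have "cmod (\<integral>x. h x * of_real (F (cos (pi * x))) \<partial>M) \<le> e * (I + 1)" if "e > 0" for e
    proof -
      obtain p where p: "real_polynomial_function p" "\<And>x. x \<in> {-1..1} \<Longrightarrow> \<bar>F x - p x\<bar> < e"
        using Stone_Weierstrass_real_polynomial_function[OF compact_Icc continuous_on_subset[OF F] \<open>e > 0\<close>]
        by (metis subset_UNIV)
      have pc: "continuous_on UNIV p"
        using p(1) continuous_on_polymonial_function polynomial_function_def
        by (simp add: continuous_on_polymonial_function real_polynomial_function_eq)
      have "(\<integral>x. h x * of_real (F (cos (pi * x))) \<partial>M) =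
          (\<integral>x. h x * of_real (F (cos (pi * x)) - p (cos (pi * x))) \<partial>M)"
        using iF[OF F] iF[OF pc] 2[OF p(1)] by (simp add: right_diff_distrib)
      also have "cmod \<dots> \<le> (\<integral>x. cmod (h x * of_real (F (cos (pi * x)) - p (cos (pi * x)))) \<partial>M)"
        by (rule integral_norm_bound)
      also have "\<dots> \<le> (\<integral>x. e * cmod (h x) \<partial>M)"
      proof (rule integral_mono)
        have "integrable M (\<lambda>x. h x * of_real ((\<lambda>s. F s - p s) (cos (pi * x))))"
          by (rule iF) (intro continuous_intros F pc)
        then show "integrable M (\<lambda>x. cmod (h x * of_real (F (cos (pi * x)) - p (cos (pi * x)))))"
          by (intro integrable_norm) simp
        show "integrable M (\<lambda>x. e * cmod (h x))" using int by simp
        show "cmod (h x * of_real (F (cos (pi * x)) - p (cos (pi * x)))) \<le> e * cmod (h x)" for x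
          using p(2)[of "cos (pi * x)"]
          by (simp add: norm_mult mult.commute[of e] mult_left_mono less_imp_le flip: of_real_diff)
      qed
      also have "\<dots> = e * I" by (simp add: I_def)
      also have "\<dots> \<le> e * (I + 1)" using \<open>e > 0\<close> by simp
      finally show ?thesis .
    qed
    note le = this
    have "cmod (\<integral>x. h x * of_real (F (cos (pi * x))) \<partial>M) \<le> 0 + e" if "e > 0" for e
      using le[of "e / (I + 1)"] \<open>I \<ge> 0\<close> that by simp
    then have "cmod (\<integral>x. h x * of_real (F (cos (pi * x))) \<partial>M) \<le> 0" by (rule field_le_epsilon)
    then show ?thesis by simp
  qed
  have 4: "(\<integral>x. h x * of_real (indicator {..<a} x) \<partial>M) = 0" if a: "a \<in> {0..1}" for a :: real
  proof -
    \<comment> \<open>Steep ramps cut off at 0 and 1. As the cosine decreases, a value above cos (pi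
      * a) means x < a; at x = a the ramp is 0, so the limit is the indicator of the open
      half-line.\<close>
    define F where "F = (\<lambda>(j::nat) s. max 0 (min 1 (real j * (s - cos (pi * a)))))"
    have Fc: "continuous_on UNIV (F j)" for j
      unfolding F_def by (intro continuous_intros)
    have Fb: "\<bar>F j s\<bar> \<le> 1" for j s by (auto simp: F_def)
    have conv: "(\<lambda>j. F j (cos (pi * x))) \<longlonglongrightarrow> indicator {..<a} x" if x: "x \<in> {0<..<1}" for x
    proof (cases "x < a")
      case True
      then have d: "cos (pi * x) - cos (pi * a) > 0"
        using a x cos_mono_less_eq[of "pi * a" "pi * x"] by (simp add: mult_le_cancel_left1)
      obtain J :: nat where J: "real J * (cos (pi * x) - cos (pi * a)) > 1"
        using reals_Archimedean3[OF d] by blast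
      have "F j (cos (pi * x)) = 1" if "j \<ge> J" for j
      proof -
        have "real J * (cos (pi * x) - cos (pi * a)) \<le> real j * (cos (pi * x) - cos (pi * a))"
          using that d by (intro mult_right_mono) auto
        then show ?thesis using J by (simp add: F_def)
      qed
      then show ?thesis using True by (intro tendsto_eventually) (auto simp: eventually_sequentially)
    next
      case False
      then have d: "cos (pi * x) - cos (pi * a) \<le> 0"
        using a x cos_mono_le_eq[of "pi * x" "pi * a"] by (simp add: mult_le_cancel_left1)
      have "F j (cos (pi * x)) = 0" for j
        using mult_nonneg_nonpos[OF _ d, of "real j"] by (simp add: F_def)
      then show ?thesis using False by simp
    qed
    have "(\<lambda>j. \<integral>x. h x * of_real (F j (cos (pi * x))) \<partial>M) \<longlonglongrightarrow> (\<integral>x. h x * of_real (indicator {..<a} x) \<partial>M)"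
    proof (rule integral_dominated_convergence[where w = "\<lambda>x. cmod (h x)"])
      have "indicator {..<a} \<in> borel_measurable M"
        unfolding M_def by (intro measurable_restrict_space1 measurable_completion) simp
      then show "(\<lambda>x. h x * of_real (indicator {..<a} x)) \<in> borel_measurable M"
        using borel_measurable_integrable[OF int] by measurable
      have "(\<lambda>x. F j (cos (pi * x))) \<in> borel_measurable M" for j
        by (intro meas continuous_on_compose2[OF Fc] continuous_intros) auto
      then show "(\<lambda>x. h x * of_real (F j (cos (pi * x)))) \<in> borel_measurable M" for j
        using borel_measurable_integrable[OF int] by measurable
      show "AE x in M. (\<lambda>j. h x * of_real (F j (cos (pi * x)))) \<longlonglongrightarrow> h x * of_real (indicator {..<a} x)"
        using conv by (intro AE_I2 tendsto_intros) (auto simp: sp)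
      show "AE x in M. cmod (h x * of_real (F j (cos (pi * x)))) \<le> cmod (h x)" for j
        using Fb by (intro AE_I2) (simp add: norm_mult mult_left_le)
    qed (use int in auto)
    then show ?thesis using 3[OF Fc] by (simp add: LIMSEQ_const_iff)
  qed
  \<comment> \<open>Extension by zero, so that the criterion on the whole line applies.\<close>
  define f where "f = (\<lambda>x. indicator {0<..<1} x *\<^sub>R h x)"
  have f_int: "integrable lebesgue f"
    using int unfolding M_def f_def by (subst (asm) integrable_restrict_space) auto
  have f_eq: "(LINT x:{..<a}|lebesgue. f x) = (\<integral>x. h x * of_real (indicator {..<a} x) \<partial>M)" for a
    unfolding M_def f_def set_lebesgue_integral_def
    by (subst integral_restrict_space) (auto intro!: Bochner_Integration.integral_cong simp: indicator_def)
  have "AE x in lebesgue. f x = 0"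
  proof (rule AE_zero_if_integral_lessThan_zero[OF f_int])
    have tot: "(\<integral>x. h x \<partial>M) = 0"
      using zero[of 0] by simp
    then show "(LINT x|lebesgue. f x) = 0"
      unfolding M_def f_def by (subst (asm) integral_restrict_space) auto
    show "(LINT x:{..<a}|lebesgue. f x) = 0" for a
    proof -
      consider "a \<in> {0..1}" | "a < 0" | "a > 1" by force
      then show ?thesis
      proof cases
        case 1
        then show ?thesis unfolding f_eq by (rule 4)
      next
        case 2
        then have "(\<integral>x. h x * of_real (indicator {..<a} x) \<partial>M) = (\<integral>x. 0 \<partial>M)"
          by (intro Bochner_Integration.integral_cong) (auto simp: sp)
        then show ?thesis unfolding f_eq by simp
      next
        case 3
        then have "(\<integral>x. h x * of_real (indicator {..<a} x) \<partial>M) = (\<integral>x. h x \<partial>M)"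
          by (intro Bochner_Integration.integral_cong) (auto simp: sp)
        then show ?thesis unfolding f_eq tot .
      qed
    qed
  qed
  then show ?thesis
    unfolding M_def f_def by (subst AE_restrict_space_iff) (auto elim!: eventually_mono)
qed

text \<open>If \<open>s\<close> is positive, \<open>h\<close> vanishes together with \<open>h * s\<close>; multiplication by a suitable \<open>s\<close> turns each of
  the four systems into the cosine system.\<close>

lemma complete_via_cosine:
  fixes h :: "real \<Rightarrow> complex" and X :: "nat \<Rightarrow> real \<Rightarrow> real"
  defines "M \<equiv> lebesgue_on {0<..<1}"
  assumes int: "integrable M h"
    and Xc: "\<And>n. continuous_on UNIV (X n)" and Xb: "\<And>n x. \<bar>X n x\<bar> \<le> B"
    and zero: "\<And>n. (\<integral>x. h x * of_real (X n x) \<partial>M) = 0"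
    and s: "continuous_on UNIV s" "\<And>x. \<bar>s x\<bar> \<le> 1" "\<And>x. x \<in> {0<..<1} \<Longrightarrow> s x \<noteq> 0"
    and rel: "\<And>n. \<exists>a b i j. \<forall>x. s x * cos (real n * pi * x) = a * X i x + b * X j x"
  shows "AE x in M. h x = 0"
proof -
  have meas: "\<psi> \<in> borel_measurable M" if "continuous_on UNIV \<psi>" for \<psi> :: "real \<Rightarrow> real"
    unfolding M_def by (intro continuous_measurable_lebesgue_on that) simp
  have iX: "integrable M (\<lambda>x. h x * of_real (X n x))" for n
    by (rule integrable_mult_bounded[OF int meas[OF Xc] Xb])
  have "AE x in M. h x * of_real (s x) = 0"
    unfolding M_def
  proof (rule cosine_complete)
    show "integrable (lebesgue_on {0<..<1}) (\<lambda>x. h x * of_real (s x))"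
      using integrable_mult_bounded[OF int meas[OF s(1)] s(2)] by (simp add: M_def)
    fix n
    obtain a b i j where ab: "\<And>x. s x * cos (real n * pi * x) = a * X i x + b * X j x"
      using rel[of n] by blast
    have "(\<integral>x. h x * of_real (s x) * of_real (cos (real n * pi * x)) \<partial>M)
        = (\<integral>x. of_real a * (h x * of_real (X i x)) + of_real b * (h x * of_real (X j x)) \<partial>M)"
    proof (rule Bochner_Integration.integral_cong[OF refl])
      fix x
      have c: "complex_of_real (s x) * of_real (cos (real n * pi * x)) = of_real (a * X i x + b * X j x)"
        by (simp only: of_real_mult[symmetric] ab)
      show "h x * of_real (s x) * of_real (cos (real n * pi * x))
          = of_real a * (h x * of_real (X i x)) + of_real b * (h x * of_real (X j x))"
        unfolding mult.assoc[of "h x" "complex_of_real (s x)"] c by (simp add: algebra_simps)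
    qed
    also have "\<dots> = 0"
      by (subst Bochner_Integration.integral_add) (auto intro!: integrable_mult_right iX simp: zero)
    finally show "(\<integral>x. h x * of_real (s x) * of_real (cos (real n * pi * x)) \<partial>lebesgue_on {0<..<1}) = 0"
      by (simp add: M_def)
  qed
  then have "AE x in M. x \<in> space M \<longrightarrow> h x * of_real (s x) = 0" by eventually_elim simp
  with AE_space show ?thesis by eventually_elim (use s(3) in \<open>auto simp: M_def\<close>)
qed

text \<open>In each case the multiplier is, up to a constant, the lowest nonzero eigenfunction of
  the system: it has no zero in (0,1), and its product with cos (n * pi * x) is a combination of at
  most two eigenfunctions. For n = 0 the lower index would be negative, but the product is then an
  eigenfunction by itself.\<close>

lemma eigensystem_complete:
  fixes h :: "real \<Rightarrow> complex"
  assumes "eigensystem \<mu> X" and int: "integrable (lebesgue_on {0<..<1}) h"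
    and zero: "\<And>n. (\<integral>x. h x * of_real (X n x) \<partial>lebesgue_on {0<..<1}) = 0"
  shows "AE x in lebesgue_on {0<..<1}. h x = 0"
proof -
  note via = complete_via_cosine[OF int ode_pair_continuous(1)[OF eigensystem_basic(1)[OF assms(1)]]
      eigensystem_basic(5)[OF assms(1)] zero]
  have half: "\<bar>sin t\<bar> \<le> 1" "\<bar>cos t\<bar> \<le> 1" for t :: real by auto
  consider (sn) "X = (\<lambda>n x. sqrt 2 * sin (real n * pi * x))"
    | (cn) "X = (\<lambda>n x. if n = 0 then 1 else sqrt 2 * cos (real n * pi * x))"
    | (sh) "X = (\<lambda>n x. sqrt 2 * sin ((real n + 1/2) * pi * x))"
    | (ch) "X = (\<lambda>n x. sqrt 2 * cos ((real n + 1/2) * pi * x))"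
  proof -
    have "(\<lambda>n x. if n = 0 then 0 else sqrt 2 * sin (real n * pi * x)) = (\<lambda>n x. sqrt 2 * sin (real n * pi * x))"
      by (intro ext) auto
    then show ?thesis using assms(1) that unfolding eigensystem_def by auto
  qed
  then show ?thesis
  proof cases
    case sn
    show ?thesis
    proof (rule via[of "\<lambda>x. sin (pi * x)"])
      show "sin (pi * x) \<noteq> 0" if "x \<in> {0<..<1}" for x
        using that sin_gt_zero[of "pi * x"] by simp
      show "\<exists>a b i j. \<forall>x. sin (pi * x) * cos (real n * pi * x) = a * X i x + b * X j x" for n
      proof (cases n)
        case 0
        then show ?thesis by (intro exI[of _ "1 / sqrt 2"] exI[of _ 0] exI[of _ 1]) (simp add: sn)
      next
        case (Suc m)
        have "sin (pi * x) * cos (real n * pi * x) = (1/2) * sin (real (n + 1) * pi * x) - (1/2) * sin (real m * pi * x)" for x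
          using sin_times_cos[of "pi * x" "real n * pi * x"] sin_minus[of "real m * pi * x"]
          by (simp add: Suc algebra_simps)
        then show ?thesis
          by (intro exI[of _ "1 / (2 * sqrt 2)"] exI[of _ "- 1 / (2 * sqrt 2)"] exI[of _ "n + 1"] exI[of _ m])
            (simp add: sn)
      qed
    qed (auto intro!: continuous_intros)
  next
    case cn
    show ?thesis
    proof (rule via[of "\<lambda>x. 1"])
      show "\<exists>a b i j. \<forall>x. 1 * cos (real n * pi * x) = a * X i x + b * X j x" for n
        by (intro exI[of _ "if n = 0 then 1 else 1 / sqrt 2"] exI[of _ 0] exI[of _ n]) (simp add: cn)
    qed auto
  next
    case sh
    show ?thesis
    proof (rule via[of "\<lambda>x. sin (pi * x / 2)"])
      show "sin (pi * x / 2) \<noteq> 0" if "x \<in> {0<..<1}" for x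
        using that sin_gt_zero[of "pi * x / 2"] by simp
      show "\<exists>a b i j. \<forall>x. sin (pi * x / 2) * cos (real n * pi * x) = a * X i x + b * X j x" for n
      proof (cases n)
        case 0
        then show ?thesis by (intro exI[of _ "1 / sqrt 2"] exI[of _ 0] exI[of _ 0]) (simp add: sh)
      next
        case (Suc m)
        have "sin (pi * x / 2) * cos (real n * pi * x) =
            (1/2) * sin ((real n + 1/2) * pi * x) - (1/2) * sin ((real m + 1/2) * pi * x)" for x
          using sin_times_cos[of "pi * x / 2" "real n * pi * x"] sin_minus[of "(real m + 1/2) * pi * x"]
          by (simp add: Suc algebra_simps)
        then show ?thesis
          by (intro exI[of _ "1 / (2 * sqrt 2)"] exI[of _ "- 1 / (2 * sqrt 2)"] exI[of _ n] exI[of _ m])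
            (simp add: sh)
      qed
    qed (auto intro!: continuous_intros)
  next
    case ch
    show ?thesis
    proof (rule via[of "\<lambda>x. cos (pi * x / 2)"])
      show "cos (pi * x / 2) \<noteq> 0" if "x \<in> {0<..<1}" for x
        using that cos_gt_zero[of "pi * x / 2"] by simp
      show "\<exists>a b i j. \<forall>x. cos (pi * x / 2) * cos (real n * pi * x) = a * X i x + b * X j x" for n
      proof (cases n)
        case 0
        then show ?thesis by (intro exI[of _ "1 / sqrt 2"] exI[of _ 0] exI[of _ 0]) (simp add: ch)
      next
        case (Suc m)
        have "cos (pi * x / 2) * cos (real n * pi * x) =
            (1/2) * cos ((real n + 1/2) * pi * x) + (1/2) * cos ((real m + 1/2) * pi * x)" for x
          using cos_times_cos[of "real n * pi * x" "pi * x / 2"]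
          by (simp add: Suc algebra_simps)
        then show ?thesis
          by (intro exI[of _ "1 / (2 * sqrt 2)"] exI[of _ "1 / (2 * sqrt 2)"] exI[of _ n] exI[of _ m])
            (simp add: ch)
      qed
    qed (auto intro!: continuous_intros)
  qed
qed

lemma coeff_eq: "coeff X g n = (\<integral>x. g x * of_real (X n x) \<partial>lebesgue_on {0<..<1})"
  unfolding coeff_def set_lebesgue_integral_def by (rule integral_restrict_space[symmetric]) simp

text \<open>Square summability provides some L2 limit G. Its coefficients are limits of those of the
  partial sums, which are eventually constant, so G and the datum have the same coefficients;
  completeness identifies them almost everywhere.\<close>

lemma eigensystem_expansion:
  assumes es: "eigensystem \<mu> X" and g: "g \<in> L2 (lebesgue_on {0<..<1})"
    and sum: "summable (\<lambda>n. (cmod (coeff X g n))\<^sup>2)"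
  shows "L2_tendsto (lebesgue_on {0<..<1}) (\<lambda>N x. \<Sum>n<N. coeff X g n * of_real (X n x)) g"
proof -
  let ?M = "lebesgue_on {0<..<1::real}"
  let ?S = "\<lambda>N x. \<Sum>n<N. coeff X g n * of_real (X n x)"
  note b = eigensystem_basic[OF es] and o = eigensystem_orthogonal[OF es]
  have Xc: "continuous_on S (X n)" for S n by (rule ode_pair_continuous(1)[OF b(1)])
  have "summable (\<lambda>n. (cmod (coeff X g n))\<^sup>2 * integral {0..1} (\<lambda>x. (X n x)\<^sup>2))"
    by (rule summable_comparison_test'[OF sum, of 0])
      (auto simp: abs_mult o(5) intro!: mult_left_le order.trans[OF eq_refl o(5)] abs_of_nonneg integral_nonneg
        integrable_continuous_interval continuous_intros Xc)
  from orthogonal_series_converges[OF Xc o(1) this]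
  obtain G where G: "L2_tendsto ?M ?S G" by blast
  have mX: "(\<lambda>x. complex_of_real (X m x)) \<in> borel_measurable ?M" for m
    by (intro continuous_measurable_lebesgue_on continuous_intros Xc) simp
  have bX: "cmod (of_real (X m x)) \<le> sqrt 2" for m x using b(5)[of m x] by simp
  have cG: "(\<integral>x. G x * of_real (X m x) \<partial>?M) = coeff X g m" for m
  proof -
    have "(\<integral>x. ?S N x * of_real (X m x) \<partial>?M) = coeff X g m" if "N > m" for N
    proof -
      have XX: "(\<integral>x. X n x * X m x \<partial>?M) = (if n = m then integral {0..1} (\<lambda>x. (X m x)\<^sup>2) else 0)"
        and iXX: "integrable ?M (\<lambda>x. X n x * X m x)" for n
      proof -
        have "(\<lambda>x. X n x * X m x) absolutely_integrable_on {0<..<1}"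
          by (rule set_integrable_subset[OF absolutely_integrable_continuous_real[of 0 1]])
            (auto intro!: continuous_intros Xc)
        then show i: "integrable ?M (\<lambda>x. X n x * X m x)"
          by (rule absolutely_integrable_imp_integrable) simp
        have "(\<integral>x. X n x * X m x \<partial>?M) = integral {0<..<1} (\<lambda>x. X n x * X m x)"
          by (rule lebesgue_integral_eq_integral[OF i]) simp
        also have "\<dots> = integral {0..1} (\<lambda>x. X n x * X m x)"
          using integral_open_interval[of 0 1 "\<lambda>x. X n x * X m x"] by (simp add: cbox_interval)
        also have "\<dots> = (if n = m then integral {0..1} (\<lambda>x. (X m x)\<^sup>2) else 0)"
          using o(1) by (simp add: power2_eq_square)
        finally show "(\<integral>x. X n x * X m x \<partial>?M) = (if n = m then integral {0..1} (\<lambda>x. (X m x)\<^sup>2) else 0)" .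
      qed
      have "(\<integral>x. ?S N x * of_real (X m x) \<partial>?M) = (\<integral>x. (\<Sum>n<N. coeff X g n * of_real (X n x * X m x)) \<partial>?M)"
        by (simp add: sum_distrib_right mult.assoc)
      also have "\<dots> = (\<Sum>n<N. coeff X g n * of_real (\<integral>x. X n x * X m x \<partial>?M))"
        by (subst Bochner_Integration.integral_sum)
          (auto intro!: integrable_mult_right integrable_of_real iXX
            simp del: of_real_mult simp: integral_mult_right_zero integral_complex_of_real)
      also have "\<dots> = (\<Sum>n<N. if n = m then coeff X g m * of_real (integral {0..1} (\<lambda>x. (X m x)\<^sup>2)) else 0)"
        by (intro sum.cong refl) (auto simp: XX)
      also have "\<dots> = coeff X g m * of_real (integral {0..1} (\<lambda>x. (X m x)\<^sup>2))"
        using that by (simp add: sum.delta)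
      \<comment> \<open>The eigenfunction is normalised, or it is the zero function of the sine
        system, whose coefficient is 0.\<close>
      also have "\<dots> = coeff X g m"
        using o(4)[of m] by (auto simp: coeff_eq)
      finally show ?thesis .
    qed
    then have "(\<lambda>N. \<integral>x. ?S N x * of_real (X m x) \<partial>?M) \<longlonglongrightarrow> coeff X g m"
      by (intro tendsto_eventually eventually_sequentiallyI[of "Suc m"]) auto
    moreover have "(\<lambda>N. \<integral>x. ?S N x * of_real (X m x) \<partial>?M) \<longlonglongrightarrow> (\<integral>x. G x * of_real (X m x) \<partial>?M)"
      by (rule L2_tendsto_integral_mult[OF finite_measure_unit G mX bX])
    ultimately show ?thesis using LIMSEQ_unique by blast
  qed
  have GL: "G \<in> L2 ?M" by (rule L2_tendstoD(2)[OF G])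
  note iX = L2_imp_integrable[OF finite_measure_unit _ mX bX]
  have "AE x in ?M. g x - G x = 0"
  proof (rule eigensystem_complete[OF es])
    show "integrable ?M (\<lambda>x. g x - G x)"
      using L2_imp_integrable[OF finite_measure_unit L2_diff[OF g GL], of "\<lambda>_. 1" 1] by simp
    show "(\<integral>x. (g x - G x) * of_real (X n x) \<partial>?M) = 0" for n
      using iX[OF g, of n] iX[OF GL, of n] cG[of n] by (simp add: left_diff_distrib coeff_eq)
  qed
  then have ae: "AE x in ?M. cmod (?S N x - g x) ^ 2 = cmod (?S N x - G x) ^ 2" for N
    by eventually_elim simp
  note A = L2_tendstoD[OF G]
  have "sqn ?M (\<lambda>x. ?S N x - g x) = sqn ?M (\<lambda>x. ?S N x - G x)" for N
    unfolding sqn_def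
    using borel_measurable_integrable[OF L2_integrable_power2[OF L2_diff[OF A(1)[of N] g]]]
      borel_measurable_integrable[OF L2_integrable_power2[OF L2_diff[OF A(1)[of N] GL]]] ae[of N]
    by (intro integral_cong_AE) auto
  then show ?thesis using A g by (simp add: L2_tendsto_iff)
qed

section \<open>The boundary value problems in y\<close>

text \<open>\<open>cosl l\<close> and \<open>sinl l\<close> are the solutions of f'' = l * f with
  initial values (1, 0) and (0, 1) for (f, f'). Splitting by the sign of l keeps all formulas
  real.\<close>

definition cosl :: "real \<Rightarrow> real \<Rightarrow> real" where
  "cosl l y = (if l > 0 then cosh (sqrt l * y) else if l < 0 then cos (sqrt (- l) * y) else 1)"

definition sinl :: "real \<Rightarrow> real \<Rightarrow> real" where
  "sinl l y = (if l > 0 then sinh (sqrt l * y) / sqrt l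
     else if l < 0 then sin (sqrt (- l) * y) / sqrt (- l) else y)"

lemma ode_pair_sinl: "ode_pair l (sinl l) (cosl l)"
proof -
  consider "l > 0" | "l < 0" | "l = 0" by linarith
  then show ?thesis
  proof cases
    case 1
    then have e: "sinl l = (\<lambda>y. sinh (sqrt l * y) / sqrt l)" "cosl l = (\<lambda>y. cosh (sqrt l * y))"
      by (auto simp: sinl_def cosl_def fun_eq_iff)
    have eq: "s * sqrt l = l * (s / sqrt l)" for s
      using 1 by (simp add: field_simps)
    have "((\<lambda>y. sinh (sqrt l * y) / sqrt l) has_real_derivative cosh (sqrt l * y)) (at y)" for y
      using 1 by (auto intro!: derivative_eq_intros simp: mult.assoc)
    moreover have "((\<lambda>y. cosh (sqrt l * y)) has_real_derivative sinh (sqrt l * y) * sqrt l) (at y)" for y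
      by (auto intro!: derivative_eq_intros)
    ultimately show ?thesis
      unfolding ode_pair_def e eq by blast
  next
    case 2
    then have e: "sinl l = (\<lambda>y. sin (sqrt (- l) * y) / sqrt (- l))" "cosl l = (\<lambda>y. cos (sqrt (- l) * y))"
      by (auto simp: sinl_def cosl_def fun_eq_iff)
    have eq: "- s * sqrt (- l) = l * (s / sqrt (- l))" for s
      using 2 by (simp add: field_simps)
    have "((\<lambda>y. sin (sqrt (- l) * y) / sqrt (- l)) has_real_derivative cos (sqrt (- l) * y)) (at y)" for y
      using 2 by (auto intro!: derivative_eq_intros simp: mult.assoc)
    moreover have "((\<lambda>y. cos (sqrt (- l) * y)) has_real_derivative - sin (sqrt (- l) * y) * sqrt (- l)) (at y)" for y
      by (auto intro!: derivative_eq_intros)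
    ultimately show ?thesis
      unfolding ode_pair_def e eq by blast
  next
    case 3
    then have e: "sinl l = (\<lambda>y. y)" "cosl l = (\<lambda>y. 1)"
      by (auto simp: sinl_def cosl_def fun_eq_iff)
    show ?thesis unfolding ode_pair_def e using 3 by simp
  qed
qed

lemma sinl_0 [simp]: "sinl l 0 = 0" and cosl_0 [simp]: "cosl l 0 = 1"
  by (auto simp: sinl_def cosl_def)

text \<open>The Wronskian of the fundamental system, covering the hyperbolic and the trigonometric
  identity at once.\<close>

lemma cosl_sinl_identity: "(cosl l y)\<^sup>2 - l * (sinl l y)\<^sup>2 = 1"
proof -
  consider "l > 0" | "l < 0" | "l = 0" by linarith
  then show ?thesis
  proof cases
    case 1
    then show ?thesis
      by (simp add: sinl_def cosl_def power_divide cosh_square_eq)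
  next
    case 2
    then show ?thesis
      by (simp add: sinl_def cosl_def power_divide)
  qed (simp add: sinl_def cosl_def)
qed

lemma sinl_cosl_reflected:
  shows "((\<lambda>y. sinl l (1 - y)) has_real_derivative - cosl l (1 - y)) (at y)"
    and "((\<lambda>y. cosl l (1 - y)) has_real_derivative - (l * sinl l (1 - y))) (at y)"
proof -
  have r: "((\<lambda>y. 1 - y) has_real_derivative - 1) (at y)"
    by (auto intro!: derivative_eq_intros)
  show "((\<lambda>y. sinl l (1 - y)) has_real_derivative - cosl l (1 - y)) (at y)"
    by (rule DERIV_cong[OF DERIV_chain2[OF ode_pair_DERIV(1)[OF ode_pair_sinl] r]]) simp
  show "((\<lambda>y. cosl l (1 - y)) has_real_derivative - (l * sinl l (1 - y))) (at y)"
    by (rule DERIV_cong[OF DERIV_chain2[OF ode_pair_DERIV(2)[OF ode_pair_sinl] r]]) simp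
qed

text \<open>Variation of constants: both combinations below have derivative zero.\<close>

lemma ode_solution_representation:
  assumes Y: "\<And>y. y \<in> {0..1} \<Longrightarrow> (Y has_real_derivative Y' y) (at y within {0..1})"
    and Y'c: "continuous_on {0..1} Y'"
    and Y': "\<And>y. y \<in> {0<..<1} \<Longrightarrow> (Y' has_real_derivative l * Y y) (at y)"
    and y: "y \<in> {0..1}"
  shows "Y y = Y 1 * cosl l (1 - y) - Y' 1 * sinl l (1 - y)"
    and "Y' y = Y' 1 * cosl l (1 - y) - l * Y 1 * sinl l (1 - y)"
proof -
  define C where "C = (\<lambda>y. cosl l (1 - y))"
  define S where "S = (\<lambda>y. sinl l (1 - y))"
  have dS: "(S has_real_derivative - C y) (at y)" and dC: "(C has_real_derivative - (l * S y)) (at y)" for y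
    unfolding S_def C_def by (rule sinl_cosl_reflected)+
  have Yc: "continuous_on {0..1} Y" using Y by (rule DERIV_continuous_on)
  have Sc: "continuous_on A S" and Cc: "continuous_on A C" for A
    by (rule DERIV_continuous_on, rule has_field_derivative_at_within, rule dS dC)+
  have Yi: "(Y has_real_derivative Y' y) (at y)" if "y \<in> {0<..<1}" for y
    using Y[of y] that by (simp add: at_within_Icc_at)
  have const: "f x = f 1" if "continuous_on {0..1} f" "\<And>y. y \<in> {0<..<1} \<Longrightarrow> (f has_real_derivative 0) (at y)"
    "x \<in> {0..1}" for f :: "real \<Rightarrow> real" and x
  proof -
    have *: "f z = f 0" if "z \<in> {0..1}" for z
      using DERIV_isconst2[of 0 1 f z] \<open>continuous_on {0..1} f\<close> \<open>\<And>y. y \<in> {0<..<1} \<Longrightarrow> (f has_real_derivative 0) (at y)\<close> that by simp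
    show ?thesis using *[of x] *[of 1] that(3) by simp
  qed
  have a: "Y y * C y + Y' y * S y = Y 1"
  proof -
    have "(\<lambda>y. Y y * C y + Y' y * S y) y = (\<lambda>y. Y y * C y + Y' y * S y) 1"
    proof (rule const[OF _ _ y])
      show "continuous_on {0..1} (\<lambda>y. Y y * C y + Y' y * S y)"
        by (intro continuous_intros Yc Y'c Sc Cc)
      show "((\<lambda>y. Y y * C y + Y' y * S y) has_real_derivative 0) (at z)" if "z \<in> {0<..<1}" for z
        by (rule DERIV_cong[OF DERIV_add[OF DERIV_mult[OF Yi[OF that] dC] DERIV_mult[OF Y'[OF that] dS]]])
          (simp add: algebra_simps)
    qed
    then show ?thesis by (simp add: C_def S_def)
  qed
  have b: "Y' y * C y + l * Y y * S y = Y' 1"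
  proof -
    have "(\<lambda>y. Y' y * C y + l * (Y y * S y)) y = (\<lambda>y. Y' y * C y + l * (Y y * S y)) 1"
    proof (rule const[OF _ _ y])
      show "continuous_on {0..1} (\<lambda>y. Y' y * C y + l * (Y y * S y))"
        by (intro continuous_intros Yc Y'c Sc Cc)
      show "((\<lambda>y. Y' y * C y + l * (Y y * S y)) has_real_derivative 0) (at z)" if "z \<in> {0<..<1}" for z
        by (rule DERIV_cong[OF DERIV_add[OF DERIV_mult[OF Y'[OF that] dC]
                DERIV_cmult[OF DERIV_mult[OF Yi[OF that] dS]]]])
          (simp add: algebra_simps)
    qed
    then show ?thesis by (simp add: C_def S_def mult.assoc)
  qed
  \<comment> \<open>The two constants form a linear system for Y y and Y' y, and its determinant is
    this Wronskian.\<close>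
  have id: "C y * C y - l * (S y * S y) = 1"
    using cosl_sinl_identity[of l "1 - y"] by (simp add: C_def S_def power2_eq_square)
  have "Y 1 * C y - Y' 1 * S y = Y y * (C y * C y - l * (S y * S y))"
    unfolding a[symmetric] b[symmetric] by (simp add: algebra_simps)
  then show "Y y = Y 1 * cosl l (1 - y) - Y' 1 * sinl l (1 - y)"
    unfolding id by (simp add: C_def S_def)
  have "Y' 1 * C y - l * Y 1 * S y = Y' y * (C y * C y - l * (S y * S y))"
    unfolding a[symmetric] b[symmetric] by (simp add: algebra_simps)
  then show "Y' y = Y' 1 * cosl l (1 - y) - l * Y 1 * sinl l (1 - y)"
    unfolding id by (simp add: C_def S_def)
qed

text \<open>The value of the B1 boundary operator at 0, with its outward sign, on the unnormalised
  solution \<open>sinl l (1 - y)\<close> or \<open>cosl l (1 - y)\<close> that already satisfies the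
  condition at 1. It vanishes exactly in the resonant case.\<close>

definition bvp_den :: "bc \<Rightarrow> bc \<Rightarrow> real \<Rightarrow> real" where
  "bvp_den B1 B3 l = (if B1 \<noteq> B3 then cosl l 1
     else case B1 of Dirichlet \<Rightarrow> sinl l 1 | Neumann \<Rightarrow> l * sinl l 1)"

definition bvp_sol :: "bc \<Rightarrow> bc \<Rightarrow> real \<Rightarrow> real \<Rightarrow> real" where
  "bvp_sol B1 B3 l y = (case B3 of Dirichlet \<Rightarrow> sinl l (1 - y) | Neumann \<Rightarrow> cosl l (1 - y)) / bvp_den B1 B3 l"

definition bvp_sol' :: "bc \<Rightarrow> bc \<Rightarrow> real \<Rightarrow> real \<Rightarrow> real" where
  "bvp_sol' B1 B3 l y = - (case B3 of Dirichlet \<Rightarrow> cosl l (1 - y) | Neumann \<Rightarrow> l * sinl l (1 - y)) / bvp_den B1 B3 l"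

lemma ode_pair_bvp_sol: "ode_pair l (bvp_sol B1 B3 l) (bvp_sol' B1 B3 l)"
proof -
  have s: "((\<lambda>y. sinl l (1 - y)) has_real_derivative - cosl l (1 - y)) (at y)"
    and c: "((\<lambda>y. cosl l (1 - y)) has_real_derivative - (l * sinl l (1 - y))) (at y)" for y
    by (rule sinl_cosl_reflected)+
  show ?thesis
    unfolding ode_pair_def bvp_sol_def bvp_sol'_def
    by (cases B3) (auto intro!: derivative_eq_intros s c simp: divide_inverse)
qed

lemma bvp_solution_bvp_sol:
  assumes "bvp_den B1 B3 (m\<^sup>2 - k\<^sup>2) \<noteq> 0"
  shows "bvp_solution k m B1 B3 (bvp_sol B1 B3 (m\<^sup>2 - k\<^sup>2))"
proof -
  let ?l = "m\<^sup>2 - k\<^sup>2"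
  note o = ode_pair_bvp_sol[of ?l B1 B3]
  have "(case B1 of Dirichlet \<Rightarrow> bvp_sol B1 B3 ?l 0 | Neumann \<Rightarrow> - bvp_sol' B1 B3 ?l 0) = 1"
    using assms by (cases B1; cases B3) (auto simp: bvp_sol_def bvp_sol'_def bvp_den_def)
  moreover have "(case B3 of Dirichlet \<Rightarrow> bvp_sol B1 B3 ?l 1 | Neumann \<Rightarrow> bvp_sol' B1 B3 ?l 1) = 0"
    by (cases B3) (auto simp: bvp_sol_def bvp_sol'_def)
  ultimately show ?thesis
    unfolding bvp_solution_def
    by (intro exI[of _ "bvp_sol' B1 B3 ?l"] exI[of _ "\<lambda>y. ?l * bvp_sol B1 B3 ?l y"])
      (auto simp: algebra_simps intro: ode_pair_continuous[OF o] ode_pair_DERIV[OF o, unfolded left_diff_distrib])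
qed

text \<open>A solution is determined by its two values at y = 1. The condition B3 makes one of them
  0, and the condition at 0 says that the other, up to sign, times \<open>bvp_den\<close> is
  1.\<close>

lemma bvp_solution_unique:
  assumes "bvp_den B1 B3 (m\<^sup>2 - k\<^sup>2) \<noteq> 0" and "bvp_solution k m B1 B3 Z" and y: "y \<in> {0..1}"
  shows "Z y = bvp_sol B1 B3 (m\<^sup>2 - k\<^sup>2) y"
proof -
  let ?l = "m\<^sup>2 - k\<^sup>2"
  obtain Z' Z'' where Z: "\<And>y. y \<in> {0..1} \<Longrightarrow> (Z has_real_derivative Z' y) (at y within {0..1})"
    and Z'c: "continuous_on {0..1} Z'"
    and Z': "\<And>y. y \<in> {0<..<1} \<Longrightarrow> (Z' has_real_derivative Z'' y) (at y)"
    and eq: "\<And>y. y \<in> {0<..<1} \<Longrightarrow> Z'' y + (k\<^sup>2 - m\<^sup>2) * Z y = 0"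
    and b1: "(case B1 of Dirichlet \<Rightarrow> Z 0 | Neumann \<Rightarrow> - Z' 0) = 1"
    and b3: "(case B3 of Dirichlet \<Rightarrow> Z 1 | Neumann \<Rightarrow> Z' 1) = 0"
    using assms(2) unfolding bvp_solution_def by blast
  have Z'': "(Z' has_real_derivative ?l * Z y) (at y)" if "y \<in> {0<..<1}" for y
  proof -
    have "Z'' y = ?l * Z y" using eq[OF that] by (simp add: algebra_simps)
    then show ?thesis using Z'[OF that] by simp
  qed
  have rep: "Z y = Z 1 * cosl ?l (1 - y) - Z' 1 * sinl ?l (1 - y)"
    "Z' y = Z' 1 * cosl ?l (1 - y) - ?l * Z 1 * sinl ?l (1 - y)" if "y \<in> {0..1}" for y
    by (rule ode_solution_representation[of Z Z' ?l, OF _ Z'c _ that]; use Z Z'' in blast)+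
  have r0: "Z 0 = Z 1 * cosl ?l 1 - Z' 1 * sinl ?l 1" "Z' 0 = Z' 1 * cosl ?l 1 - ?l * Z 1 * sinl ?l 1"
    using rep[of 0] by simp_all
  show ?thesis
  proof (cases B3)
    case Dirichlet
    then have z1: "Z 1 = 0" using b3 by simp
    have "- Z' 1 * bvp_den B1 B3 ?l = 1"
      using b1 r0 z1 Dirichlet by (cases B1) (auto simp: bvp_den_def)
    then have z1': "- Z' 1 = 1 / bvp_den B1 B3 ?l" using assms(1) by (simp add: field_simps)
    have "Z y = - Z' 1 * sinl ?l (1 - y)" using rep(1)[OF y] z1 by simp
    then show ?thesis unfolding z1' by (simp add: bvp_sol_def Dirichlet)
  next
    case Neumann
    then have z1: "Z' 1 = 0" using b3 by simp
    have "Z 1 * bvp_den B1 B3 ?l = 1"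
      using b1 r0 z1 Neumann by (cases B1) (auto simp: bvp_den_def algebra_simps)
    then have "Z 1 = 1 / bvp_den B1 B3 ?l" using assms(1) by (simp add: field_simps)
    then show ?thesis
      using rep(1)[OF y] z1 Neumann by (simp add: bvp_sol_def)
  qed
qed

text \<open>Since r \<le> 1/2, no integer is closer to N + r than N, so the infimum is attained
  there.\<close>

lemma d0_eq:
  assumes k: "k\<^sup>2 = (of_int N + r) * pi\<^sup>2" and r: "0 \<le> r" "r \<le> 1/2"
  shows "d0 k = r * pi\<^sup>2"
proof (rule antisym)
  have "d0 k \<le> \<bar>k\<^sup>2 - of_int N * pi\<^sup>2\<bar>"
    unfolding d0_def by (rule cINF_lower) (auto intro!: bdd_belowI[of _ 0])
  also have "\<dots> = r * pi\<^sup>2" using r by (simp add: k algebra_simps)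
  finally show "d0 k \<le> r * pi\<^sup>2" .
  show "r * pi\<^sup>2 \<le> d0 k"
    unfolding d0_def
  proof (rule cINF_greatest)
    fix n :: int
    have "k\<^sup>2 - of_int n * pi\<^sup>2 = (of_int (N - n) + r) * pi\<^sup>2" by (simp add: k algebra_simps)
    moreover have "r \<le> \<bar>of_int (N - n) + r\<bar>"
    proof (cases "N - n \<ge> 0")
      case True
      then have "(of_int (N - n) :: real) \<ge> 0" by linarith
      then show ?thesis by linarith
    next
      case False
      then have "(of_int (N - n) :: real) \<le> -1" by linarith
      then show ?thesis using r by linarith
    qed
    ultimately show "r * pi\<^sup>2 \<le> \<bar>k\<^sup>2 - of_int n * pi\<^sup>2\<bar>"
      by (simp add: abs_mult mult_right_mono)
  qed simp
qed

lemma sinl_1_zero: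
  assumes "sinl l 1 = 0"
  shows "\<exists>j::int. l = - ((of_int j)\<^sup>2 * pi\<^sup>2)"
proof -
  have "l < 0" using assms by (cases "l > 0"; cases "l = 0") (auto simp: sinl_def)
  then have "sin (sqrt (- l)) = 0" using assms by (simp add: sinl_def)
  then obtain j :: int where "sqrt (- l) = of_int j * pi" by (auto simp: sin_zero_iff_int2)
  then have "- l = (of_int j * pi)\<^sup>2"
    using \<open>l < 0\<close> real_sqrt_pow2[of "- l"] by simp
  then show ?thesis by (intro exI[of _ j]) (simp add: power_mult_distrib)
qed

lemma cosl_1_zero:
  assumes "cosl l 1 = 0"
  shows "\<exists>j::int. l = - ((of_int j + 1/2)\<^sup>2 * pi\<^sup>2)"
proof -
  have "l < 0" using assms by (cases "l > 0"; cases "l = 0") (auto simp: cosl_def)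
  then have "cos (sqrt (- l)) = 0" using assms by (simp add: cosl_def)
  then obtain i :: int where i: "odd i" "sqrt (- l) = of_int i * (pi/2)" by (auto simp: cos_zero_iff_int)
  then obtain j where "i = 2 * j + 1" by (auto elim: oddE)
  then have "sqrt (- l) = (of_int j + 1/2) * pi" using i(2) by (simp add: field_simps)
  then have "- l = ((of_int j + 1/2) * pi)\<^sup>2"
    using \<open>l < 0\<close> real_sqrt_pow2[of "- l"] by simp
  then show ?thesis by (intro exI[of _ j]) (simp add: power_mult_distrib)
qed

text \<open>At a resonance k^2 / pi^2 is a sum of two squares of integers or half-integers, and (n +
  1/2)^2 = n * (n + 1) + 1/4 is 1/4 modulo 1. For equal boundary types the half-integer choice would
  force d0 = pi^2 / 4 and the integer choice d0 = 0; for mixed types the integer choice would force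
  pi^2 / 4 and the half-integer choice pi^2 / 2. Each value lies outside the range of d0 for which
  that choice is made.\<close>

lemma bvp_den_nonzero: "bvp_den B1 B3 ((mu k B1 B3 n)\<^sup>2 - k\<^sup>2) \<noteq> 0"
proof
  let ?l = "(mu k B1 B3 n)\<^sup>2 - k\<^sup>2"
  assume zero: "bvp_den B1 B3 ?l = 0"
  have pi2: "pi\<^sup>2 > 0" by simp
  show False
  proof (cases "B1 = B3")
    case True
    have "\<exists>j::int. ?l = - ((of_int j)\<^sup>2 * pi\<^sup>2)"
    proof (cases "sinl ?l 1 = 0")
      case True
      then show ?thesis by (rule sinl_1_zero)
    next
      case False
      \<comment> \<open>The pure Neumann denominator has the additional zero l = 0 from the constant
        function; it fits the same form with j = 0.\<close>
      then have "?l = 0" using zero True by (cases B3) (auto simp: bvp_den_def)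
      then show ?thesis by (intro exI[of _ 0]) simp
    qed
    then obtain j :: int where "?l = - ((of_int j)\<^sup>2 * pi\<^sup>2)" by blast
    then have j: "k\<^sup>2 = (mu k B1 B3 n)\<^sup>2 + (of_int j)\<^sup>2 * pi\<^sup>2" by linarith
    show False
    proof (cases "d0 k \<in> {0..pi\<^sup>2 / 8}")
      case t: True
      then have "mu k B1 B3 n = (real n + 1/2) * pi"
        using True by (auto simp: mu_def)
      then have "k\<^sup>2 = (of_int (int n * int n + int n + j\<^sup>2) + 1/4) * pi\<^sup>2"
        using j by (simp add: power_mult_distrib power2_eq_square algebra_simps)
      from d0_eq[OF this] have "d0 k = 1/4 * pi\<^sup>2" by simp
      then show False using t pi2 by simp
    next
      case t: False
      then have "mu k B1 B3 n = real n * pi"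
        using True by (auto simp: mu_def)
      then have "k\<^sup>2 = (of_int (int n * int n + j\<^sup>2) + 0) * pi\<^sup>2"
        using j by (simp add: power_mult_distrib power2_eq_square algebra_simps)
      from d0_eq[OF this] have "d0 k = 0" by simp
      then show False using t pi2 by simp
    qed
  next
    case False
    then have "cosl ?l 1 = 0" using zero by (simp add: bvp_den_def)
    from cosl_1_zero[OF this]
    obtain j :: int where "?l = - ((of_int j + 1/2)\<^sup>2 * pi\<^sup>2)" by blast
    then have j: "k\<^sup>2 = (mu k B1 B3 n)\<^sup>2 + (of_int j + 1/2)\<^sup>2 * pi\<^sup>2" by linarith
    show False
    proof (cases "d0 k \<in> {0..pi\<^sup>2 / 8} \<union> {3 * pi\<^sup>2 / 8..pi\<^sup>2 / 2}")
      case t: True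
      then have "mu k B1 B3 n = real n * pi"
        using False by (auto simp: mu_def)
      then have "k\<^sup>2 = (of_int (int n * int n + j * j + j) + 1/4) * pi\<^sup>2"
        using j by (simp add: power_mult_distrib power2_eq_square algebra_simps)
      from d0_eq[OF this] have "d0 k = 1/4 * pi\<^sup>2" by simp
      then show False using t pi2 by simp
    next
      case t: False
      then have "mu k B1 B3 n = (real n + 1/2) * pi"
        using False by (auto simp: mu_def)
      then have "k\<^sup>2 = (of_int (int n * int n + int n + j * j + j) + 1/2) * pi\<^sup>2"
        using j by (simp add: power_mult_distrib power2_eq_square algebra_simps)
      from d0_eq[OF this] have "d0 k = 1/2 * pi\<^sup>2" by simp
      then show False using t pi2 by simp
    qed
  qed
qed

section \<open>Decay of the solutions in y for large frequencies\<close>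

definition bc_weight :: "bc \<Rightarrow> real \<Rightarrow> real" where
  "bc_weight B m = (case B of Dirichlet \<Rightarrow> 1 | Neumann \<Rightarrow> 1 / m)"

text \<open>With \<beta> = sqrt (m^2 - k^2), the condition 2 * k \<le> m gives \<beta> \<ge> m / 2,
  hence the decay rate, and m \<ge> 4 gives \<beta> \<ge> 2, so that sinh \<beta> and cosh \<beta>
  are at least exp \<beta> / 4. Every quotient is then at most 4 times the exponential. The
  remaining factor is 1, \<beta> \<le> m or 1 / \<beta> \<le> 2 / m, the last of which raises the
  constant to 8.\<close>

lemma bvp_sol_bound:
  assumes k: "0 < k" and m: "2 * k \<le> m" "4 \<le> m" and y: "y \<in> {0..1}"
  shows "\<bar>bvp_sol B1 B3 (m\<^sup>2 - k\<^sup>2) y\<bar> \<le> 8 * bc_weight B1 m * exp (- (m * y / 2))"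
    and "\<bar>bvp_sol' B1 B3 (m\<^sup>2 - k\<^sup>2) y\<bar> \<le> 8 * bc_weight B1 m * m * exp (- (m * y / 2))"
proof -
  define l where "l = m\<^sup>2 - k\<^sup>2"
  define \<beta> where "\<beta> = sqrt l"
  have "k\<^sup>2 \<le> (m/2)\<^sup>2" using k m by (intro power_mono) auto
  moreover have "(m/2)\<^sup>2 = m\<^sup>2 / 4" by (simp add: power_divide)
  ultimately have l: "(m/2)\<^sup>2 \<le> l" "l \<le> m\<^sup>2"
    using zero_le_power2[of m] zero_le_power2[of k] unfolding l_def by linarith+
  have "0 < (m/2)\<^sup>2" using m by simp
  then have lpos: "l > 0" using l by linarith
  have \<beta>1: "m/2 \<le> \<beta>" unfolding \<beta>_def by (intro real_le_rsqrt l)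
  have \<beta>2: "\<beta> \<le> m" unfolding \<beta>_def using l(2) m by (intro real_le_lsqrt) auto
  have bpos: "\<beta> \<ge> 2" "\<beta> > 0" "m > 0" using \<beta>1 m by auto
  have ll: "l = \<beta> * \<beta>" using lpos by (simp add: \<beta>_def)
  have E: "exp (\<beta> * (1 - y)) \<le> exp \<beta> * exp (- (m * y / 2))"
    unfolding exp_add[symmetric] exp_le_cancel_iff using mult_right_mono[OF \<beta>1, of y] y
    by (simp add: algebra_simps)
  have z: "\<beta> * (1 - y) \<ge> 0" using y bpos by simp
  have num: "\<bar>sinh (\<beta> * (1 - y))\<bar> \<le> exp \<beta> * exp (- (m * y / 2))" "\<bar>cosh (\<beta> * (1 - y))\<bar> \<le> exp \<beta> * exp (- (m * y / 2))"
  proof -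
    have half: "\<bar>(P - Q) / 2\<bar> \<le> P" "\<bar>(P + Q) / 2\<bar> \<le> P" if "0 < Q" "Q \<le> P" for P Q :: real
      using that by (auto simp: abs_le_iff field_simps)
    have "exp (- (\<beta> * (1 - y))) \<le> exp (\<beta> * (1 - y))" "0 < exp (- (\<beta> * (1 - y)))" using z by auto
    then have "\<bar>sinh (\<beta> * (1 - y))\<bar> \<le> exp (\<beta> * (1 - y))" "\<bar>cosh (\<beta> * (1 - y))\<bar> \<le> exp (\<beta> * (1 - y))"
      unfolding sinh_field_def cosh_field_def by (intro half; simp)+
    then show "\<bar>sinh (\<beta> * (1 - y))\<bar> \<le> exp \<beta> * exp (- (m * y / 2))" "\<bar>cosh (\<beta> * (1 - y))\<bar> \<le> exp \<beta> * exp (- (m * y / 2))"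
      using E by linarith+
  qed
  have den: "exp \<beta> / 4 \<le> sinh \<beta>" "exp \<beta> / 4 \<le> cosh \<beta>"
  proof -
    have quarter: "P / 4 \<le> (P - Q) / 2" "P / 4 \<le> (P + Q) / 2" if "Q \<le> P / 2" "0 < Q" "0 < P" for P Q :: real
      using that by (simp_all add: field_simps)
    have "1 + \<beta> \<le> exp \<beta>" by (rule exp_ge_add_one_self)
    moreover have "exp (- \<beta>) \<le> exp 0" using bpos by (subst exp_le_cancel_iff) simp
    ultimately have "exp (- \<beta>) \<le> exp \<beta> / 2"
      using bpos(1) exp_zero[where 'a = real] by linarith
    then show "exp \<beta> / 4 \<le> sinh \<beta>" "exp \<beta> / 4 \<le> cosh \<beta>"
      unfolding sinh_field_def cosh_field_def by (intro quarter; simp)+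
  qed
  have e0: "exp \<beta> / 4 > 0" by simp
  have ratio: "\<bar>a / d\<bar> \<le> 4 * exp (- (m * y / 2))" if "\<bar>a\<bar> \<le> exp \<beta> * exp (- (m * y / 2))" "exp \<beta> / 4 \<le> d" for a d
  proof -
    have "d > 0" using that(2) e0 by linarith
    then have "\<bar>a / d\<bar> = \<bar>a\<bar> / d" by simp
    also have "\<dots> \<le> (exp \<beta> * exp (- (m * y / 2))) / (exp \<beta> / 4)"
      by (intro frac_le that e0) auto
    finally show ?thesis by simp
  qed
  have inv: "1 / \<beta> \<le> 2 / m" using \<beta>1 bpos by (simp add: field_simps)
  define E' where "E' = exp (- (m * y / 2))"
  have E': "E' > 0" by (simp add: E'_def)
  have bnd: "\<bar>r\<bar> * c \<le> 8 * d * E'" if "\<bar>r\<bar> \<le> 4 * E'" "0 \<le> c" "c \<le> 2 * d" for r c d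
  proof -
    have "\<bar>r\<bar> * c \<le> (4 * E') * (2 * d)" using that E' by (intro mult_mono) auto
    then show ?thesis by (simp add: mult_ac)
  qed
  have r: "\<bar>sinh (\<beta> * (1 - y)) / sinh \<beta>\<bar> \<le> 4 * E'" "\<bar>cosh (\<beta> * (1 - y)) / sinh \<beta>\<bar> \<le> 4 * E'"
    "\<bar>sinh (\<beta> * (1 - y)) / cosh \<beta>\<bar> \<le> 4 * E'" "\<bar>cosh (\<beta> * (1 - y)) / cosh \<beta>\<bar> \<le> 4 * E'"
    unfolding E'_def by (intro ratio num den)+
  have s: "sinl l x = sinh (\<beta> * x) / \<beta>" "cosl l x = cosh (\<beta> * x)" for x
    using lpos by (auto simp: sinl_def cosl_def \<beta>_def)
  have f1: "bvp_sol Dirichlet Dirichlet l y = sinh (\<beta> * (1 - y)) / sinh \<beta> * 1"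
    "bvp_sol Dirichlet Neumann l y = cosh (\<beta> * (1 - y)) / cosh \<beta> * 1"
    "bvp_sol Neumann Dirichlet l y = sinh (\<beta> * (1 - y)) / cosh \<beta> * (1 / \<beta>)"
    "bvp_sol Neumann Neumann l y = cosh (\<beta> * (1 - y)) / sinh \<beta> * (1 / \<beta>)"
    using bpos by (simp_all add: bvp_sol_def bvp_den_def s) (simp_all add: ll)
  have f2: "bvp_sol' Dirichlet Dirichlet l y = - (cosh (\<beta> * (1 - y)) / sinh \<beta>) * \<beta>"
    "bvp_sol' Dirichlet Neumann l y = - (sinh (\<beta> * (1 - y)) / cosh \<beta>) * \<beta>"
    "bvp_sol' Neumann Dirichlet l y = - (cosh (\<beta> * (1 - y)) / cosh \<beta>) * 1"
    "bvp_sol' Neumann Neumann l y = - (sinh (\<beta> * (1 - y)) / sinh \<beta>) * 1"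
    using bpos by (simp_all add: bvp_sol'_def bvp_den_def s) (simp_all add: ll)
  show "\<bar>bvp_sol B1 B3 (m\<^sup>2 - k\<^sup>2) y\<bar> \<le> 8 * bc_weight B1 m * exp (- (m * y / 2))"
    unfolding l_def[symmetric] E'_def[symmetric]
    using bnd[OF r(1), of 1 1] bnd[OF r(4), of 1 1] bnd[OF r(3), of "1 / \<beta>" "1 / m"] bnd[OF r(2), of "1 / \<beta>" "1 / m"] inv bpos
    by (cases B1; cases B3) (simp_all add: f1 bc_weight_def abs_mult)
  show "\<bar>bvp_sol' B1 B3 (m\<^sup>2 - k\<^sup>2) y\<bar> \<le> 8 * bc_weight B1 m * m * exp (- (m * y / 2))"
    unfolding l_def[symmetric] E'_def[symmetric]
    using bnd[OF r(2), of \<beta> m] bnd[OF r(3), of \<beta> m] bnd[OF r(4), of 1 1] bnd[OF r(1), of 1 1] \<beta>2 bpos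
    by (cases B1; cases B3) (simp_all add: f2 bc_weight_def abs_mult)
qed

lemma integral_exp_decay_le:
  fixes m :: real
  assumes "m > 0"
  shows "integral {0..1} (\<lambda>y. exp (- (m * y))) \<le> 1 / m"
proof -
  have "((\<lambda>y. exp (- (m * y))) has_integral (- exp (- (m * 1)) / m) - (- exp (- (m * 0)) / m)) {0..1}"
    using assms
    by (intro fundamental_theorem_of_calculus[where f = "\<lambda>y. - exp (- (m * y)) / m"])
      (auto intro!: derivative_eq_intros simp flip: has_real_derivative_iff_has_vector_derivative)
  then have "integral {0..1} (\<lambda>y. exp (- (m * y))) = (1 - exp (- m)) / m"
    by (simp add: integral_unique diff_divide_distrib)
  also have "\<dots> \<le> 1 / m" using assms by (simp add: divide_right_mono)
  finally show ?thesis .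
qed

text \<open>Squaring turns the decay into exp (- m * y), whose integral is at most 1 / m. Every
  derivative in y costs a factor m^2.\<close>

lemma bvp_sol_integral_bound:
  assumes k: "0 < k" and m: "2 * k \<le> m" "4 \<le> m"
  shows "integral {0..1} (\<lambda>y. (bvp_sol B1 B3 (m\<^sup>2 - k\<^sup>2) y)\<^sup>2) \<le> 64 * (bc_weight B1 m)\<^sup>2 / m"
    and "integral {0..1} (\<lambda>y. (bvp_sol' B1 B3 (m\<^sup>2 - k\<^sup>2) y)\<^sup>2) \<le> 64 * (bc_weight B1 m)\<^sup>2 * m"
    and "integral {0..1} (\<lambda>y. ((m\<^sup>2 - k\<^sup>2) * bvp_sol B1 B3 (m\<^sup>2 - k\<^sup>2) y)\<^sup>2) \<le> 64 * (bc_weight B1 m)\<^sup>2 * m ^ 3"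
proof -
  let ?l = "m\<^sup>2 - k\<^sup>2"
  have mpos: "m > 0" using m by simp
  note c = ode_pair_continuous[OF ode_pair_bvp_sol]
  have main: "integral {0..1} (\<lambda>y. (f y)\<^sup>2) \<le> A\<^sup>2 * (1 / m)"
    if "continuous_on {0..1} f" "\<And>y. y \<in> {0..1} \<Longrightarrow> \<bar>f y\<bar> \<le> A * exp (- (m * y / 2))" for f :: "real \<Rightarrow> real" and A
  proof -
    have "integral {0..1} (\<lambda>y. (f y)\<^sup>2) \<le> integral {0..1} (\<lambda>y. A\<^sup>2 * exp (- (m * y)))"
    proof (intro integral_le integrable_continuous_interval continuous_intros that(1))
      fix y :: real assume "y \<in> {0..1}"
      then have "(f y)\<^sup>2 \<le> (A * exp (- (m * y / 2)))\<^sup>2"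
        using that(2) abs_le_square_iff order_trans[OF that(2) abs_ge_self] by blast
      also have "\<dots> = A\<^sup>2 * exp (- (m * y))"
        by (simp add: power_mult_distrib flip: exp_double)
      finally show "(f y)\<^sup>2 \<le> A\<^sup>2 * exp (- (m * y))" .
    qed
    also have "\<dots> = A\<^sup>2 * integral {0..1} (\<lambda>y. exp (- (m * y)))" by simp
    also have "\<dots> \<le> A\<^sup>2 * (1 / m)" by (intro mult_left_mono integral_exp_decay_le mpos) simp
    finally show ?thesis .
  qed
  show i: "integral {0..1} (\<lambda>y. (bvp_sol B1 B3 ?l y)\<^sup>2) \<le> 64 * (bc_weight B1 m)\<^sup>2 / m"
    using main[OF c(1) bvp_sol_bound(1)[OF k m]] by (simp add: power_mult_distrib)
  show "integral {0..1} (\<lambda>y. (bvp_sol' B1 B3 ?l y)\<^sup>2) \<le> 64 * (bc_weight B1 m)\<^sup>2 * m"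
    using main[OF c(2) bvp_sol_bound(2)[OF k m]] mpos by (simp add: power_mult_distrib power2_eq_square mult.assoc)
  have "0 < k\<^sup>2" "k\<^sup>2 \<le> m\<^sup>2" using k m by (auto intro: power_mono)
  then have l2: "?l\<^sup>2 \<le> (m\<^sup>2)\<^sup>2" by (intro power_mono) auto
  have "integral {0..1} (\<lambda>y. (?l * bvp_sol B1 B3 ?l y)\<^sup>2) = ?l\<^sup>2 * integral {0..1} (\<lambda>y. (bvp_sol B1 B3 ?l y)\<^sup>2)"
    by (simp add: power_mult_distrib)
  also have "\<dots> \<le> (m\<^sup>2)\<^sup>2 * (64 * (bc_weight B1 m)\<^sup>2 / m)"
    by (intro mult_mono l2 i integral_nonneg integrable_continuous_interval continuous_intros c) auto
  also have "\<dots> = 64 * (bc_weight B1 m)\<^sup>2 * m ^ 3"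
    using mpos by (simp add: power2_eq_square power3_eq_cube)
  finally show "integral {0..1} (\<lambda>y. (?l * bvp_sol B1 B3 ?l y)\<^sup>2) \<le> 64 * (bc_weight B1 m)\<^sup>2 * m ^ 3" .
qed

section \<open>Hoelder continuity and the H1/2 trace\<close>

lemma AE_bd_square: "AE p in bd_measure. p \<in> {0..1} \<times> {0..1}"
proof -
  have m: "{0..1} \<times> {0..1::real} \<in> sets (borel :: (real \<times> real) measure)"
    by (intro borel_closed closed_Times) auto
  then have "(\<integral>\<^sup>+p. indicator (- ({0..1} \<times> {0..1})) p \<partial>bd_measure) = 0"
    by (subst nn_integral_bd_measure) (auto intro!: nn_integral_0_iff_AE[THEN iffD2] simp: indicator_def nn_integral_0_iff_AE)
  then have "emeasure bd_measure (- ({0..1} \<times> {0..1})) = 0"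
    using m by (subst (asm) nn_integral_indicator) auto
  then show ?thesis
    using m by (subst AE_iff_measurable[of "- ({0..1} \<times> {0..1})"]) auto
qed

lemma measure_bd: "measure bd_measure UNIV = 4"
proof -
  have "emeasure bd_measure UNIV = (\<integral>\<^sup>+p. 1 \<partial>bd_measure)" by simp
  also have "\<dots> = 4" by (subst nn_integral_bd_measure) auto
  finally show ?thesis by (simp add: measure_def)
qed

lemma L2_bd_bounded:
  assumes [measurable]: "f \<in> borel_measurable borel" and B: "\<And>p. p \<in> {0..1} \<times> {0..1} \<Longrightarrow> cmod (f p) \<le> B"
  shows "f \<in> L2 bd_measure" "sqn bd_measure f \<le> 4 * B\<^sup>2"
proof -
  interpret finite_measure bd_measure by (rule finite_measure_bd)
  have ae: "AE p in bd_measure. (cmod (f p))\<^sup>2 \<le> B\<^sup>2"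
    using AE_bd_square by eventually_elim (use B in \<open>auto intro!: power_mono\<close>)
  have m: "(\<lambda>p. (cmod (f p))\<^sup>2) \<in> borel_measurable bd_measure" by measurable
  have int: "integrable bd_measure (\<lambda>p. (cmod (f p))\<^sup>2)"
    by (rule integrable_const_bound[where B = "B\<^sup>2"]) (use ae m in auto)
  then show "f \<in> L2 bd_measure"
    using measurable_cong_sets[OF sets_bd_measure refl] by (simp add: L2_def)
  have "sqn bd_measure f \<le> (\<integral>p. B\<^sup>2 \<partial>bd_measure)"
    unfolding sqn_def by (rule integral_mono_AE[OF int _ ae]) simp
  then show "sqn bd_measure f \<le> 4 * B\<^sup>2" by (simp add: measure_bd mult.commute)
qed

lemma nn_integral_inverse_sqrt:
  "(\<integral>\<^sup>+s. ennreal (s powr (-1/2)) * indicator {0..1} s \<partial>lborel) = 2"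
proof -
  have "((\<lambda>s::real. s powr (-1/2)) has_integral (1 powr (-1/2 + 1) / (-1/2 + 1))) {0..1}"
    by (rule has_integral_powr_from_0) auto
  from nn_integral_has_integral_lebesgue[OF _ this]
  have "(\<integral>\<^sup>+s. ennreal (indicator {0..1} s * s powr (-1/2)) \<partial>lborel) = ennreal 2" by simp
  then show ?thesis by (simp add: ennreal_mult' mult.commute ennreal_indicator)
qed

text \<open>The kernel is dominated by two one-sided kernels starting at a, one for each direction,
  each of integral 2.\<close>

lemma nn_integral_inverse_sqrt_dist_le:
  assumes a: "a \<in> {0..1::real}"
  shows "(\<integral>\<^sup>+t. ennreal (\<bar>a - t\<bar> powr (-1/2)) * indicator {0..1} t \<partial>lborel) \<le> 4"
proof -
  let ?k = "\<lambda>s::real. ennreal (s powr (-1/2)) * indicator {0..1} s"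
  have "(\<integral>\<^sup>+t. ennreal (\<bar>a - t\<bar> powr (-1/2)) * indicator {0..1} t \<partial>lborel)
      \<le> (\<integral>\<^sup>+t. ?k (t - a) + ?k (a - t) \<partial>lborel)"
    using a by (intro nn_integral_mono) (auto simp: indicator_def abs_real_def)
  also have "\<dots> = (\<integral>\<^sup>+t. ?k (t - a) \<partial>lborel) + (\<integral>\<^sup>+t. ?k (a - t) \<partial>lborel)"
    by (intro nn_integral_add) measurable
  also have "(\<integral>\<^sup>+t. ?k (t - a) \<partial>lborel) = (\<integral>\<^sup>+s. ?k s \<partial>lborel)"
    by (subst nn_integral_real_affine[where c = 1 and t = a]) auto
  also have "(\<integral>\<^sup>+t. ?k (a - t) \<partial>lborel) = (\<integral>\<^sup>+s. ?k s \<partial>lborel)"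
    by (subst nn_integral_real_affine[where c = "-1" and t = a]) auto
  finally show ?thesis unfolding nn_integral_inverse_sqrt by simp
qed

text \<open>Along an edge the distance is at least the difference of the coordinate that varies
  there, so each edge contributes at most 4, wherever p lies.\<close>

lemma nn_integral_bd_kernel_le:
  assumes p: "p \<in> {0..1} \<times> {0..1}"
  shows "(\<integral>\<^sup>+q. ennreal (dist p q powr (-1/2)) \<partial>bd_measure) \<le> 16"
proof -
  obtain a b where ab: "p = (a, b)" "a \<in> {0..1}" "b \<in> {0..1}" using p by auto
  have ge: "\<bar>a - t\<bar> \<le> dist p (t, s)" "\<bar>b - s\<bar> \<le> dist p (t, s)" for t s
    by (simp_all add: ab dist_prod_def dist_real_def real_le_rsqrt)
  have le: "ennreal (dist p (t, s) powr (-1/2)) \<le> ennreal (r powr (-1/2))" if "0 < r" "r \<le> dist p (t, s)" for r t s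
    using that by (intro ennreal_leI powr_mono2') auto
  have h: "(\<integral>\<^sup>+t. ennreal (dist p (t, s) powr (-1/2)) * indicator {0..1} t \<partial>lborel) \<le> 4" for s
  proof -
    \<comment> \<open>At t = a the majorant is 0 powr (-1/2) = 0, although the distance may be
      positive, so this point has to be removed.\<close>
    have "AE t in lborel. t \<noteq> a" by (rule AE_lborel_singleton)
    then have "AE t in lborel. ennreal (dist p (t, s) powr (-1/2)) * indicator {0..1} t
        \<le> ennreal (\<bar>a - t\<bar> powr (-1/2)) * indicator {0..1} t"
      by eventually_elim (rule mult_right_mono[OF le], auto simp: ge)
    from nn_integral_mono_AE[OF this] show ?thesis
      using nn_integral_inverse_sqrt_dist_le[OF ab(2)] by (rule order_trans)
  qed
  have v: "(\<integral>\<^sup>+s. ennreal (dist p (t, s) powr (-1/2)) * indicator {0..1} s \<partial>lborel) \<le> 4" for t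
  proof -
    have "AE s in lborel. s \<noteq> b" by (rule AE_lborel_singleton)
    then have "AE s in lborel. ennreal (dist p (t, s) powr (-1/2)) * indicator {0..1} s
        \<le> ennreal (\<bar>b - s\<bar> powr (-1/2)) * indicator {0..1} s"
      by eventually_elim (rule mult_right_mono[OF le], auto simp: ge)
    from nn_integral_mono_AE[OF this] show ?thesis
      using nn_integral_inverse_sqrt_dist_le[OF ab(3)] by (rule order_trans)
  qed
  have "(\<lambda>q. ennreal (dist p q powr (-1/2))) \<in> borel_measurable borel" by measurable
  from nn_integral_bd_measure[OF this]
  have "(\<integral>\<^sup>+q. ennreal (dist p q powr (-1/2)) \<partial>bd_measure) \<le> 4 + 4 + 4 + 4"
    using add_mono[OF add_mono[OF add_mono[OF h[of 0] v[of 1]] h[of 1]] v[of 0]] by simp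
  then show ?thesis by simp
qed

text \<open>Squaring the Hoelder bound and dividing by the squared distance leaves the exponent 2 *
  (3/4) - 2 = -1/2, which is integrable along a curve.\<close>

lemma hoelder_in_H_half:
  assumes w: "w \<in> L2 bd_measure"
    and H: "\<And>p q. p \<in> {0..1} \<times> {0..1} \<Longrightarrow> q \<in> {0..1} \<times> {0..1} \<Longrightarrow> cmod (w p - w q) \<le> H * dist p q powr (3/4)"
  shows "w \<in> H_half_bd"
proof -
  have pt: "ennreal ((cmod (w p - w q))\<^sup>2 / (dist p q)\<^sup>2) \<le> ennreal (H\<^sup>2) * ennreal (dist p q powr (-1/2))"
    if pq: "p \<in> {0..1} \<times> {0..1}" "q \<in> {0..1} \<times> {0..1}" for p q
  proof (cases "p = q")
    case False
    define d where "d = dist p q"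
    have d: "d > 0" using False by (simp add: d_def)
    have "(cmod (w p - w q))\<^sup>2 \<le> (H * d powr (3/4))\<^sup>2"
      unfolding d_def by (intro power_mono H pq) simp
    also have "\<dots> = H\<^sup>2 * d powr (3/2)"
      by (simp add: power_mult_distrib power2_eq_square[of "d powr _"] flip: powr_add)
    finally have "(cmod (w p - w q))\<^sup>2 / d\<^sup>2 \<le> H\<^sup>2 * d powr (3/2) / d\<^sup>2"
      by (rule divide_right_mono) simp
    also have "\<dots> = H\<^sup>2 * (d powr (3/2) / d powr 2)" using d by (simp add: powr_numeral)
    also have "\<dots> = H\<^sup>2 * d powr (-1/2)" by (simp flip: powr_diff)
    finally show ?thesis unfolding d_def by (simp add: ennreal_leI flip: ennreal_mult)
  qed simp
  have inner: "(\<integral>\<^sup>+q. ennreal ((cmod (w p - w q))\<^sup>2 / (dist p q)\<^sup>2) \<partial>bd_measure) \<le> ennreal (H\<^sup>2) * 16"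
    if p: "p \<in> {0..1} \<times> {0..1}" for p
  proof -
    have "AE q in bd_measure. ennreal ((cmod (w p - w q))\<^sup>2 / (dist p q)\<^sup>2)
        \<le> ennreal (H\<^sup>2) * ennreal (dist p q powr (-1/2))"
      using AE_bd_square by eventually_elim (rule pt[OF p])
    then have "(\<integral>\<^sup>+q. ennreal ((cmod (w p - w q))\<^sup>2 / (dist p q)\<^sup>2) \<partial>bd_measure)
        \<le> (\<integral>\<^sup>+q. ennreal (H\<^sup>2) * ennreal (dist p q powr (-1/2)) \<partial>bd_measure)"
      by (rule nn_integral_mono_AE)
    also have "\<dots> = ennreal (H\<^sup>2) * (\<integral>\<^sup>+q. ennreal (dist p q powr (-1/2)) \<partial>bd_measure)"
      by (rule nn_integral_cmult) measurable
    also have "\<dots> \<le> ennreal (H\<^sup>2) * 16"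
      by (intro mult_left_mono nn_integral_bd_kernel_le p) simp
    finally show ?thesis .
  qed
  have "(\<integral>\<^sup>+p. (\<integral>\<^sup>+q. ennreal ((cmod (w p - w q))\<^sup>2 / (dist p q)\<^sup>2) \<partial>bd_measure) \<partial>bd_measure)
      \<le> (\<integral>\<^sup>+p. ennreal (H\<^sup>2) * 16 \<partial>bd_measure)"
  proof (rule nn_integral_mono_AE)
    show "AE p in bd_measure. (\<integral>\<^sup>+q. ennreal ((cmod (w p - w q))\<^sup>2 / (dist p q)\<^sup>2) \<partial>bd_measure)
        \<le> ennreal (H\<^sup>2) * 16"
      using AE_bd_square by eventually_elim (rule inner)
  qed
  also have "\<dots> < \<infinity>"
    using finite_measure.emeasure_finite[OF finite_measure_bd, of UNIV]
    by (simp add: ennreal_mult_less_top top.not_eq_extremum)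
  finally show ?thesis using w by (simp add: H_half_bd_def)
qed

text \<open>Interpolates between boundedness and Lipschitz continuity to give Hoelder
  continuity.\<close>

lemma min_le_powr:
  fixes t :: real
  assumes "0 \<le> t" "0 \<le> r" "r \<le> 1"
  shows "min 1 t \<le> t powr r"
proof (cases "t \<ge> 1")
  case True
  then show ?thesis using ge_one_powr_ge_zero[of t r] assms by simp
next
  case False
  show ?thesis
  proof (cases "t = 0")
    case f: False
    then have "t powr 1 \<le> t powr r" using False assms by (intro powr_mono') auto
    then show ?thesis using f assms by simp
  qed simp
qed

lemma lipschitz_unit:
  fixes f :: "real \<Rightarrow> real"
  assumes "\<And>x. (f has_real_derivative f' x) (at x)" "\<And>x. x \<in> {0..1} \<Longrightarrow> \<bar>f' x\<bar> \<le> B" "x \<in> {0..1}" "y \<in> {0..1}"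
  shows "\<bar>f x - f y\<bar> \<le> B * \<bar>x - y\<bar>"
  using field_differentiable_bound[of "{0..1}" f f' B x y] assms
  by (auto intro: has_field_derivative_at_within)

text \<open>Each product X n * Y n oscillates by at most 4 * K n and has a Lipschitz constant 4 * K
  n * (1 + \<mu> n); interpolation gives the Hoelder constant \<open>H n\<close>. As
  \<open>H n\<close> is summable and also bounds the terms, the series converges uniformly on the
  closed square, which identifies the L2 limit on the boundary with a Hoelder continuous
  function.\<close>

lemma sepsum_hoelder_trace:
  assumes es: "eigensystem \<mu> X"
    and Y: "\<And>n. ode_pair (l n) (Y n) (Y' n)"
    and K: "\<And>n y. y \<in> {0..1} \<Longrightarrow> \<bar>Y n y\<bar> \<le> K n" "\<And>n y. y \<in> {0..1} \<Longrightarrow> \<bar>Y' n y\<bar> \<le> K n * (1 + \<mu> n)"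
    and sum: "summable (\<lambda>n. cmod (c n) * K n * (1 + \<mu> n) powr (3/4))"
  shows "\<exists>w. L2_tendsto bd_measure (sepsum c X Y) w \<and> w \<in> H_half_bd"
proof -
  note b = eigensystem_basic[OF es]
  have Xc: "continuous_on UNIV (X n)" and Yc: "continuous_on UNIV (Y n)" for n
    by (rule ode_pair_continuous[OF b(1)] ode_pair_continuous[OF Y])+
  define h where "h n p = c n * of_real (X n (fst p)) * of_real (Y n (snd p))" for n and p :: "real \<times> real"
  define H where "H n = 4 * (cmod (c n) * K n * (1 + \<mu> n) powr (3/4))" for n
  have sH: "summable H" unfolding H_def by (intro summable_mult sum)
  have K0: "K n \<ge> 0" for n using K(1)[of 0 n] by simp
  have mu0: "\<mu> n \<ge> 0" for n by (rule b(7))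
  have s2: "sqrt 2 \<le> 2" by (simp add: real_le_lsqrt)
  have XY: "\<bar>X n x * Y n y\<bar> \<le> 2 * K n" if "y \<in> {0..1}" for n x y
    unfolding abs_mult using b(5)[of n x] s2 K(1)[OF that, of n] by (intro mult_mono) auto
  have hb: "cmod (h n p) \<le> H n" if "p \<in> {0..1} \<times> {0..1}" for n p
  proof -
    have "cmod (h n p) = cmod (c n) * \<bar>X n (fst p) * Y n (snd p)\<bar>"
      by (simp add: h_def norm_mult abs_mult)
    also have "\<dots> \<le> cmod (c n) * (2 * K n)"
      using that by (intro mult_left_mono XY) auto
    also have "\<dots> \<le> 2 * (cmod (c n) * K n * (1 + \<mu> n) powr (3/4))"
    proof -
      have "1 \<le> (1 + \<mu> n) powr (3/4)" using mu0[of n] by (intro ge_one_powr_ge_zero) auto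
      from mult_left_mono[OF this, of "2 * (cmod (c n) * K n)"] K0[of n]
      show ?thesis by (simp add: mult_ac)
    qed
    also have "\<dots> \<le> H n"
      unfolding H_def by (intro mult_right_mono mult_nonneg_nonneg) (auto simp: K0)
    finally show ?thesis .
  qed
  have hd: "cmod (h n p - h n q) \<le> H n * dist p q powr (3/4)"
    if p: "p \<in> {0..1} \<times> {0..1}" and q: "q \<in> {0..1} \<times> {0..1}" for n p q
  proof -
    obtain x y x' y' where e: "p = (x, y)" "q = (x', y')" by (metis surj_pair)
    define d where "d = dist p q"
    have d: "\<bar>x - x'\<bar> \<le> d" "\<bar>y - y'\<bar> \<le> d" "d \<ge> 0"
      by (simp_all add: e d_def dist_prod_def dist_real_def real_le_rsqrt)
    have xy: "x \<in> {0..1}" "y \<in> {0..1}" "x' \<in> {0..1}" "y' \<in> {0..1}" using p q by (auto simp: e)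
    have "\<bar>X n x - X n x'\<bar> \<le> (sqrt 2 * \<mu> n) * \<bar>x - x'\<bar>"
      by (rule lipschitz_unit[OF ode_pair_DERIV(1)[OF b(1)] eigensystem_deriv_bound[OF es] xy(1,3)])
    also have "\<dots> \<le> (2 * (1 + \<mu> n)) * d"
      using s2 mu0[of n] d by (intro mult_mono) (auto intro!: mult_mono)
    finally have dX: "\<bar>X n x - X n x'\<bar> \<le> (2 * (1 + \<mu> n)) * d" .
    have "\<bar>Y n y - Y n y'\<bar> \<le> (K n * (1 + \<mu> n)) * \<bar>y - y'\<bar>"
      by (rule lipschitz_unit[OF ode_pair_DERIV(1)[OF Y] K(2) xy(2,4)])
    also have "\<dots> \<le> (K n * (1 + \<mu> n)) * d"
      using K0[of n] mu0[of n] d by (intro mult_mono) auto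
    finally have dY: "\<bar>Y n y - Y n y'\<bar> \<le> (K n * (1 + \<mu> n)) * d" .
    have "\<bar>X n x * Y n y - X n x' * Y n y'\<bar> = \<bar>(X n x - X n x') * Y n y + X n x' * (Y n y - Y n y')\<bar>"
      by (simp add: algebra_simps)
    also have "\<dots> \<le> \<bar>X n x - X n x'\<bar> * \<bar>Y n y\<bar> + \<bar>X n x'\<bar> * \<bar>Y n y - Y n y'\<bar>"
      by (rule order_trans[OF abs_triangle_ineq]) (simp add: abs_mult)
    also have "\<dots> \<le> ((2 * (1 + \<mu> n)) * d) * K n + 2 * ((K n * (1 + \<mu> n)) * d)"
      using b(5)[of n x'] s2 K0[of n] mu0[of n] d
      by (intro add_mono mult_mono dX dY K(1) xy) auto
    finally have 1: "\<bar>X n x * Y n y - X n x' * Y n y'\<bar> \<le> 4 * K n * ((1 + \<mu> n) * d)"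
      by (simp add: algebra_simps)
    have 2: "\<bar>X n x * Y n y - X n x' * Y n y'\<bar> \<le> 4 * K n * 1"
      using XY[OF xy(2), of n x] XY[OF xy(4), of n x'] by linarith
    have "\<bar>X n x * Y n y - X n x' * Y n y'\<bar> \<le> 4 * K n * min 1 ((1 + \<mu> n) * d)"
      using 1 2 by (auto simp: min_def)
    also have "\<dots> \<le> 4 * K n * ((1 + \<mu> n) * d) powr (3/4)"
      using K0[of n] mu0[of n] d by (intro mult_left_mono min_le_powr) auto
    also have "\<dots> = 4 * K n * (1 + \<mu> n) powr (3/4) * d powr (3/4)"
      using mu0[of n] d by (simp add: powr_mult)
    finally have "cmod (c n) * \<bar>X n x * Y n y - X n x' * Y n y'\<bar>
        \<le> cmod (c n) * (4 * K n * (1 + \<mu> n) powr (3/4) * d powr (3/4))"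
      by (rule mult_left_mono) simp
    moreover have "h n p - h n q = c n * of_real (X n x * Y n y - X n x' * Y n y')"
      by (simp add: h_def e algebra_simps)
    then have "cmod (h n p - h n q) = cmod (c n) * \<bar>X n x * Y n y - X n x' * Y n y'\<bar>"
      by (simp only: norm_mult norm_of_real)
    ultimately show ?thesis by (simp add: H_def d_def mult_ac)
  qed
  \<comment> \<open>Off the closed square the series may diverge, but w stays measurable and the
    boundary measure does not see those points.\<close>
  define w where "w p = (\<Sum>n. h n p)" for p
  have sh: "summable (\<lambda>n. h n p)" if "p \<in> {0..1} \<times> {0..1}" for p
    by (rule summable_comparison_test'[OF sH, of 0]) (use hb[OF that] in auto)
  have hc: "continuous_on UNIV (h n)" for n
    unfolding h_def by (intro continuous_intros continuous_on_compose2[OF Xc] continuous_on_compose2[OF Yc]) auto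
  have [measurable]: "h n \<in> borel_measurable borel" for n
    by (rule borel_measurable_continuous_onI[OF hc])
  have wm [measurable]: "w \<in> borel_measurable borel" unfolding w_def by measurable
  have ss: "sepsum c X Y N = (\<lambda>p. \<Sum>n<N. h n p)" for N by (simp add: sepsum_def h_def fun_eq_iff)
  have tail: "cmod ((\<Sum>n<N. h n p) - w p) \<le> (\<Sum>n. H (n + N))" if p: "p \<in> {0..1} \<times> {0..1}" for N p
  proof -
    have "w p = (\<Sum>n. h (n + N) p) + (\<Sum>n<N. h n p)"
      unfolding w_def by (rule suminf_split_initial_segment[OF sh[OF p]])
    then have "cmod ((\<Sum>n<N. h n p) - w p) = cmod (\<Sum>n. h (n + N) p)"
      by (simp add: norm_minus_commute)
    also have "\<dots> \<le> (\<Sum>n. H (n + N))"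
      by (rule norm_suminf_le) (use hb[OF p] sH in \<open>auto simp: summable_iff_shift\<close>)
    finally show ?thesis .
  qed
  have wb: "cmod (w p) \<le> (\<Sum>n. H n)" if "p \<in> {0..1} \<times> {0..1}" for p
    using tail[OF that, of 0] by simp
  have wL: "w \<in> L2 bd_measure" by (rule L2_bd_bounded(1)[OF wm wb])
  have "L2_tendsto bd_measure (sepsum c X Y) w"
    unfolding L2_tendsto_iff ss
  proof (intro conjI allI wL)
    show "(\<lambda>p. \<Sum>n<N. h n p) \<in> L2 bd_measure" for N
      by (rule L2_bd_continuous(1)) (intro continuous_intros hc)
    have "(\<lambda>N. 4 * (\<Sum>n. H (n + N))\<^sup>2) \<longlonglongrightarrow> 4 * 0\<^sup>2"
      by (intro tendsto_intros suminf_exist_split2 sH)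
    then have lim: "(\<lambda>N. 4 * (\<Sum>n. H (n + N))\<^sup>2) \<longlonglongrightarrow> 0" by simp
    have "sqn bd_measure (\<lambda>p. (\<Sum>n<N. h n p) - w p) \<le> 4 * (\<Sum>n. H (n + N))\<^sup>2" for N
      by (rule L2_bd_bounded(2)[OF _ tail]) measurable
    then show "(\<lambda>N. sqn bd_measure (\<lambda>p. (\<Sum>n<N. h n p) - w p)) \<longlonglongrightarrow> 0"
      by (intro tendsto_sandwich[OF _ _ tendsto_const lim] always_eventually) auto
  qed
  moreover have "w \<in> H_half_bd"
  proof (rule hoelder_in_H_half[OF wL])
    fix p q :: "real \<times> real" assume p: "p \<in> {0..1} \<times> {0..1}" and q: "q \<in> {0..1} \<times> {0..1}"
    have "w p - w q = (\<Sum>n. h n p - h n q)"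
      unfolding w_def by (rule suminf_diff[OF sh[OF p] sh[OF q]])
    also have "cmod \<dots> \<le> (\<Sum>n. H n * dist p q powr (3/4))"
      by (rule norm_suminf_le) (use hd[OF p q] sH in \<open>auto intro: summable_mult2\<close>)
    also have "\<dots> = (\<Sum>n. H n) * dist p q powr (3/4)"
      by (rule suminf_mult2[symmetric, OF sH])
    finally show "cmod (w p - w q) \<le> (\<Sum>n. H n) * dist p q powr (3/4)" .
  qed
  ultimately show ?thesis by blast
qed

section \<open>The series solution\<close>

text \<open>The trace is the limit on the whole boundary; on one edge it is recognised by uniqueness
  of L2 limits there.\<close>

lemma has_trace_edge:
  assumes "\<And>j. smooth (\<phi> j)" "H1_tendsto \<Omega> \<phi> u" "\<gamma> \<in> edges"
    and "L2_tendsto (lebesgue_on {0<..<1}) (\<lambda>j t. \<phi> j (\<gamma> t)) g"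
  shows "\<exists>w. has_trace u w \<and> (AE t in lebesgue_on {0<..<1}. w (\<gamma> t) = g t)"
proof -
  obtain w where w: "L2_tendsto bd_measure \<phi> w"
    using H1_tendsto_trace[OF assms(1,2)] by blast
  have "AE t in lebesgue_on {0<..<1}. w (\<gamma> t) = g t"
    by (rule L2_tendsto_unique[OF L2_tendsto_edge[OF w assms(3)] assms(4)])
  then show ?thesis using has_traceI[OF assms(1,2) w] by blast
qed

lemma sepsum_uminus: "sepsum (\<lambda>n. - c n) F G N p = - 1 * sepsum c F G N p"
  by (simp add: sepsum_def sum_negf)

lemma bvp_sol_boundary:
  assumes "bvp_den B1 B3 l \<noteq> 0"
  shows "B1 = Dirichlet \<Longrightarrow> bvp_sol B1 B3 l 0 = 1" "B1 = Neumann \<Longrightarrow> bvp_sol' B1 B3 l 0 = - 1"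
    and "B3 = Dirichlet \<Longrightarrow> bvp_sol B1 B3 l 1 = 0" "B3 = Neumann \<Longrightarrow> bvp_sol' B1 B3 l 1 = 0"
  using assms by (cases B1; cases B3; auto simp: bvp_sol_def bvp_sol'_def bvp_den_def)+

definition data_order :: "bc \<Rightarrow> real" where
  "data_order B = (case B of Dirichlet \<Rightarrow> 3/2 | Neumann \<Rightarrow> 1/2)"

text \<open>The origin of the two orders: the most singular second derivatives carry w^2 * m^3,
  which is m^3 for Dirichlet data and m for Neumann data.\<close>

lemma bc_weight_data_order:
  assumes "0 < m"
  shows "(bc_weight B m)\<^sup>2 * m ^ 3 = m powr (2 * data_order B)"
  using assms powr_realpow[of m 3]
  by (cases B) (simp_all add: bc_weight_def data_order_def power2_eq_square power3_eq_cube)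

locale helmholtz_series =
  fixes k :: real and B1 B3 :: bc and X :: "nat \<Rightarrow> real \<Rightarrow> real" and g :: "real \<Rightarrow> complex"
    and m :: "nat \<Rightarrow> real"
  assumes k_pos: "k > 0"
    and m_eq: "m = mu k B1 B3"
    and eigensystem: "eigensystem m X"
    and data: "g \<in> Z_space m X (data_order B1)"
begin

definition c where "c = coeff X g"
definition X1 where "X1 n = deriv (X n)"
definition X2 where "X2 n x = - (m n)\<^sup>2 * X n x"
definition l where "l n = (m n)\<^sup>2 - k\<^sup>2"
definition Y where "Y n = bvp_sol B1 B3 (l n)"
definition Y1 where "Y1 n = bvp_sol' B1 B3 (l n)"
definition Y2 where "Y2 n y = l n * Y n y"

lemmas X_basic = eigensystem_basic[OF eigensystem]
lemmas X_orthogonal = eigensystem_orthogonal[OF eigensystem]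

lemma X_ode: "ode_pair (- (m n)\<^sup>2) (X n) (X1 n)"
  unfolding X1_def by (rule X_basic(1))

lemma X1_ode: "ode_pair (- (m n)\<^sup>2) (X1 n) (X2 n)"
  using ode_pair_deriv[OF X_ode] by (simp add: X2_def[abs_def])

lemma Y_ode: "ode_pair (l n) (Y n) (Y1 n)"
  unfolding Y_def Y1_def by (rule ode_pair_bvp_sol)

lemma Y1_ode: "ode_pair (l n) (Y1 n) (Y2 n)"
  using ode_pair_deriv[OF Y_ode] by (simp add: Y2_def[abs_def])

lemma X_continuous: "continuous_on S (X n)" "continuous_on S (X1 n)" "continuous_on S (X2 n)"
  using ode_pair_continuous[OF X_ode] ode_pair_continuous[OF X1_ode] by auto

lemma Y_continuous: "continuous_on S (Y n)" "continuous_on S (Y1 n)" "continuous_on S (Y2 n)"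
  using ode_pair_continuous[OF Y_ode] ode_pair_continuous[OF Y1_ode] by auto

lemma den_nonzero: "bvp_den B1 B3 (l n) \<noteq> 0"
  unfolding l_def by (subst m_eq)+ (rule bvp_den_nonzero)

lemma g_L2: "g \<in> L2 (lebesgue_on {0<..<1})"
  and data_summable: "summable (\<lambda>n. (cmod (c n))\<^sup>2 * m n powr (2 * data_order B1))"
  using data by (auto simp: Z_space_def c_def)

lemma eventually_large: "eventually (\<lambda>n. 2 * k \<le> m n \<and> 4 \<le> m n) sequentially"
proof (rule eventually_sequentiallyI[of "nat \<lceil>max (2 * k) 4\<rceil>"])
  fix n assume "nat \<lceil>max (2 * k) 4\<rceil> \<le> n"
  then have "max (2 * k) 4 \<le> real n" by linarith
  then show "2 * k \<le> m n \<and> 4 \<le> m n" using X_basic(9)[of n] by linarith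
qed

text \<open>The estimates for \<open>bvp_sol\<close> hold for large frequencies only. The finitely
  many other modes, among them possibly m 0 = 0, do not affect convergence.\<close>

lemma summable_by_weight:
  assumes "\<And>n. 0 \<le> t n"
    and "\<And>n. 2 * k \<le> m n \<Longrightarrow> 4 \<le> m n \<Longrightarrow> t n \<le> C * ((bc_weight B1 (m n))\<^sup>2 * m n ^ 3)"
  shows "summable (\<lambda>n. (cmod (c n))\<^sup>2 * t n)"
proof (rule summable_comparison_test_ev[OF _ summable_mult[OF data_summable, of C]])
  show "eventually (\<lambda>n. norm ((cmod (c n))\<^sup>2 * t n)
      \<le> C * ((cmod (c n))\<^sup>2 * m n powr (2 * data_order B1))) sequentially"
    using eventually_large
  proof eventually_elim
    case (elim n)
    have "(cmod (c n))\<^sup>2 * t n \<le> (cmod (c n))\<^sup>2 * (C * m n powr (2 * data_order B1))"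
      using assms(2)[of n] elim bc_weight_data_order[of "m n" B1] by (intro mult_left_mono) auto
    then show ?case using assms(1)[of n] by (simp add: abs_mult mult_ac)
  qed
qed

lemma coeff_summable: "summable (\<lambda>n. (cmod (c n))\<^sup>2)"
proof -
  have "summable (\<lambda>n. (cmod (c n))\<^sup>2 * 1)"
  proof (rule summable_by_weight[where C = 1])
    fix n assume "4 \<le> m n"
    then have "1 \<le> m n powr (2 * data_order B1)"
      by (intro ge_one_powr_ge_zero) (auto simp: data_order_def split: bc.split)
    then show "1 \<le> 1 * ((bc_weight B1 (m n))\<^sup>2 * m n ^ 3)"
      using bc_weight_data_order[of "m n" B1] \<open>4 \<le> m n\<close> by simp
  qed simp
  then show ?thesis by simp
qed

lemma X_norms:
  shows "integral {0..1} (\<lambda>x. (X n x)\<^sup>2) \<le> 1"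
    and "integral {0..1} (\<lambda>x. (X1 n x)\<^sup>2) \<le> (m n)\<^sup>2"
    and "integral {0..1} (\<lambda>x. (X2 n x)\<^sup>2) \<le> (m n) ^ 4"
proof -
  show 1: "integral {0..1} (\<lambda>x. (X n x)\<^sup>2) \<le> 1" by (rule X_orthogonal(5))
  show "integral {0..1} (\<lambda>x. (X1 n x)\<^sup>2) \<le> (m n)\<^sup>2" unfolding X1_def by (rule X_orthogonal(3))
  have "integral {0..1} (\<lambda>x. (X2 n x)\<^sup>2) = (m n) ^ 4 * integral {0..1} (\<lambda>x. (X n x)\<^sup>2)"
    by (simp add: X2_def power_mult_distrib flip: power_mult)
  also have "\<dots> \<le> (m n) ^ 4 * 1" by (intro mult_left_mono 1) simp
  finally show "integral {0..1} (\<lambda>x. (X2 n x)\<^sup>2) \<le> (m n) ^ 4" by simp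
qed

lemma Y_norms:
  assumes "2 * k \<le> m n" "4 \<le> m n"
  shows "integral {0..1} (\<lambda>y. (Y n y)\<^sup>2) \<le> 64 * (bc_weight B1 (m n))\<^sup>2 / m n"
    and "integral {0..1} (\<lambda>y. (Y1 n y)\<^sup>2) \<le> 64 * (bc_weight B1 (m n))\<^sup>2 * m n"
    and "integral {0..1} (\<lambda>y. (Y2 n y)\<^sup>2) \<le> 64 * (bc_weight B1 (m n))\<^sup>2 * m n ^ 3"
  unfolding Y_def Y1_def Y2_def l_def by (rule bvp_sol_integral_bound[OF k_pos assms])+

lemma series_converges:
  assumes F: "F \<in> {X, X1, X2}" and G: "\<And>n. continuous_on UNIV (G n)"
    and bound: "\<And>n. 2 * k \<le> m n \<Longrightarrow> 4 \<le> m n \<Longrightarrow>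
      integral {0..1} (\<lambda>x. (F n x)\<^sup>2) * integral {0..1} (\<lambda>y. (G n y)\<^sup>2)
        \<le> 64 * ((bc_weight B1 (m n))\<^sup>2 * m n ^ 3)"
  shows "\<exists>v. L2_tendsto (lebesgue_on \<Omega>) (sepsum c F G) v"
proof (rule sepsum_converges)
  show Fc: "continuous_on UNIV (F n)" for n using F X_continuous by auto
  show "integral {0..1} (\<lambda>x. F n x * F n' x) = 0" if "n \<noteq> n'" for n n'
  proof -
    have "X2 n x * X2 n' x = (m n)\<^sup>2 * (m n')\<^sup>2 * (X n x * X n' x)" for x
      by (simp add: X2_def)
    then show ?thesis using F X_orthogonal(1,2)[OF that] by (auto simp: X1_def)
  qed
  have "summable (\<lambda>n. (cmod (c n))\<^sup>2 * (integral {0..1} (\<lambda>x. (F n x)\<^sup>2) * integral {0..1} (\<lambda>y. (G n y)\<^sup>2)))"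
  proof (rule summable_by_weight[OF _ bound])
    show "0 \<le> integral {0..1} (\<lambda>x. (F n x)\<^sup>2) * integral {0..1} (\<lambda>y. (G n y)\<^sup>2)" for n
      by (intro mult_nonneg_nonneg integral_nonneg integrable_continuous_interval continuous_intros
          continuous_on_subset[OF Fc] continuous_on_subset[OF G]) auto
  qed
  then show "summable (\<lambda>n. (cmod (c n))\<^sup>2 * integral {0..1} (\<lambda>x. (F n x)\<^sup>2) * integral {0..1} (\<lambda>y. (G n y)\<^sup>2))"
    by (simp add: mult.assoc)
qed (rule G)

lemma product_bound:
  fixes A B a b w t :: real
  assumes "0 \<le> A" "A \<le> a" "0 \<le> B" "B \<le> 64 * w * b" "0 \<le> w" "0 \<le> b" "a * b \<le> t"
  shows "A * B \<le> 64 * (w * t)"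
proof -
  have "A * B \<le> a * (64 * w * b)" using assms by (intro mult_mono) auto
  also have "\<dots> = (64 * w) * (a * b)" by simp
  also have "\<dots> \<le> (64 * w) * t" using assms by (intro mult_left_mono) auto
  finally show ?thesis by simp
qed

lemma integral_square_nonneg: "0 \<le> integral {0..1} (\<lambda>x. (f x)\<^sup>2)" for f :: "real \<Rightarrow> real"
  by (cases "(\<lambda>x. (f x)\<^sup>2) integrable_on {0..1}") (auto intro: integral_nonneg simp: not_integrable_integral)

text \<open>With i derivatives in x and j in y, the product of squared norms is of order w^2 * m^(2
  * (i + j) - 1). For i + j \<le> 2 this is at most w^2 * m^3, and the second derivatives exhaust
  the bound.\<close>

lemma all_series_converge:
  shows "\<exists>v. L2_tendsto (lebesgue_on \<Omega>) (sepsum c X Y) v"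
    and "\<exists>v. L2_tendsto (lebesgue_on \<Omega>) (sepsum c X1 Y) v"
    and "\<exists>v. L2_tendsto (lebesgue_on \<Omega>) (sepsum c X Y1) v"
    and "\<exists>v. L2_tendsto (lebesgue_on \<Omega>) (sepsum c X2 Y) v"
    and "\<exists>v. L2_tendsto (lebesgue_on \<Omega>) (sepsum c X1 Y1) v"
    and "\<exists>v. L2_tendsto (lebesgue_on \<Omega>) (sepsum c X Y2) v"
proof -
  have p: "t * m n ^ i \<le> t * m n ^ j" if "i \<le> j" "4 \<le> m n" "0 \<le> t" for i j n and t :: real
    using that by (intro mult_left_mono power_increasing) auto
  note pb = product_bound[OF integral_square_nonneg _ integral_square_nonneg _ zero_le_power2]
  note bounds = X_norms Y_norms[unfolded divide_inverse]
  show "\<exists>v. L2_tendsto (lebesgue_on \<Omega>) (sepsum c X Y) v"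
  proof (rule series_converges)
    fix n assume n: "2 * k \<le> m n" "4 \<le> m n"
    have "inverse (m n) \<le> 1" "1 \<le> m n ^ 3" using n by (auto simp: inverse_le_1_iff intro: one_le_power)
    then have "1 * inverse (m n) \<le> m n ^ 3" by linarith
    then show "integral {0..1} (\<lambda>x. (X n x)\<^sup>2) * integral {0..1} (\<lambda>y. (Y n y)\<^sup>2)
        \<le> 64 * ((bc_weight B1 (m n))\<^sup>2 * m n ^ 3)"
      using n by (intro pb[OF bounds(1) bounds(4)[OF n]]) auto
  qed (auto intro: Y_continuous)
  show "\<exists>v. L2_tendsto (lebesgue_on \<Omega>) (sepsum c X1 Y) v"
  proof (rule series_converges)
    fix n assume n: "2 * k \<le> m n" "4 \<le> m n"
    then have "(m n)\<^sup>2 * inverse (m n) = m n ^ 1" by (simp add: power2_eq_square)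
    then show "integral {0..1} (\<lambda>x. (X1 n x)\<^sup>2) * integral {0..1} (\<lambda>y. (Y n y)\<^sup>2)
        \<le> 64 * ((bc_weight B1 (m n))\<^sup>2 * m n ^ 3)"
      using n p[of 1 3 n 1] by (intro pb[OF bounds(2) bounds(4)[OF n]]) auto
  qed (auto intro: Y_continuous)
  show "\<exists>v. L2_tendsto (lebesgue_on \<Omega>) (sepsum c X Y1) v"
  proof (rule series_converges)
    fix n assume n: "2 * k \<le> m n" "4 \<le> m n"
    show "integral {0..1} (\<lambda>x. (X n x)\<^sup>2) * integral {0..1} (\<lambda>y. (Y1 n y)\<^sup>2)
        \<le> 64 * ((bc_weight B1 (m n))\<^sup>2 * m n ^ 3)"
      using n p[of 1 3 n 1] by (intro pb[OF bounds(1) bounds(5)[OF n]]) auto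
  qed (auto intro: Y_continuous)
  show "\<exists>v. L2_tendsto (lebesgue_on \<Omega>) (sepsum c X2 Y) v"
  proof (rule series_converges)
    fix n assume n: "2 * k \<le> m n" "4 \<le> m n"
    then have "m n ^ 4 * inverse (m n) = m n ^ 3" by (simp add: power4_eq_xxxx power3_eq_cube)
    then show "integral {0..1} (\<lambda>x. (X2 n x)\<^sup>2) * integral {0..1} (\<lambda>y. (Y n y)\<^sup>2)
        \<le> 64 * ((bc_weight B1 (m n))\<^sup>2 * m n ^ 3)"
      using n by (intro pb[OF bounds(3) bounds(4)[OF n]]) auto
  qed (auto intro: Y_continuous)
  show "\<exists>v. L2_tendsto (lebesgue_on \<Omega>) (sepsum c X1 Y1) v"
  proof (rule series_converges)
    fix n assume n: "2 * k \<le> m n" "4 \<le> m n"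
    then have "(m n)\<^sup>2 * m n = m n ^ 3" by (simp add: power2_eq_square power3_eq_cube)
    then show "integral {0..1} (\<lambda>x. (X1 n x)\<^sup>2) * integral {0..1} (\<lambda>y. (Y1 n y)\<^sup>2)
        \<le> 64 * ((bc_weight B1 (m n))\<^sup>2 * m n ^ 3)"
      using n by (intro pb[OF bounds(2) bounds(5)[OF n]]) auto
  qed (auto intro: Y_continuous)
  show "\<exists>v. L2_tendsto (lebesgue_on \<Omega>) (sepsum c X Y2) v"
  proof (rule series_converges)
    fix n assume n: "2 * k \<le> m n" "4 \<le> m n"
    show "integral {0..1} (\<lambda>x. (X n x)\<^sup>2) * integral {0..1} (\<lambda>y. (Y2 n y)\<^sup>2)
        \<le> 64 * ((bc_weight B1 (m n))\<^sup>2 * m n ^ 3)"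
      using n by (intro pb[OF bounds(1) bounds(6)[OF n]]) auto
  qed (auto intro: Y_continuous)
qed

lemma hoelder_trace: "\<exists>w. L2_tendsto bd_measure (sepsum c X Y) w \<and> w \<in> H_half_bd"
proof -
  define large where "large n \<longleftrightarrow> 2 * k \<le> m n \<and> 4 \<le> m n" for n
  have m0: "m n \<ge> 0" for n by (rule X_basic(7))
  \<comment> \<open>Any bound obtained from compactness will do for the modes of small frequency, to
    which the decay estimate does not apply.\<close>
  have "\<exists>K. \<forall>y\<in>{0..1}. \<bar>Y n y\<bar> \<le> K \<and> \<bar>Y1 n y\<bar> \<le> K * (1 + m n)" for n
  proof -
    have "bounded (Y n ` {0..1})" "bounded (Y1 n ` {0..1})"
      by (intro compact_imp_bounded compact_continuous_image Y_continuous compact_Icc)+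
    then obtain b1 b2 where b: "\<forall>y\<in>{0..1}. \<bar>Y n y\<bar> \<le> b1" "\<forall>y\<in>{0..1}. \<bar>Y1 n y\<bar> \<le> b2"
      unfolding bounded_iff by auto
    have "\<bar>Y1 n y\<bar> \<le> max b1 b2 * (1 + m n)" if "y \<in> {0..1}" for y
    proof -
      have le: "\<bar>Y1 n y\<bar> \<le> max b1 b2" using b(2) that by fastforce
      then have "0 \<le> max b1 b2" by linarith
      then have "max b1 b2 * 1 \<le> max b1 b2 * (1 + m n)" using m0[of n] by (intro mult_left_mono) auto
      then show ?thesis using le by linarith
    qed
    moreover have "\<bar>Y n y\<bar> \<le> max b1 b2" if "y \<in> {0..1}" for y
      using b(1) that by fastforce
    ultimately show ?thesis by blast
  qed
  then obtain K0 where K0: "\<And>n y. y \<in> {0..1} \<Longrightarrow> \<bar>Y n y\<bar> \<le> K0 n \<and> \<bar>Y1 n y\<bar> \<le> K0 n * (1 + m n)"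
    by metis
  define K where "K n = (if large n then 8 * bc_weight B1 (m n) else K0 n)" for n
  have w0: "bc_weight B1 (m n) \<ge> 0" for n using m0[of n] by (auto simp: bc_weight_def split: bc.split)
  have K: "\<bar>Y n y\<bar> \<le> K n \<and> \<bar>Y1 n y\<bar> \<le> K n * (1 + m n)" if y: "y \<in> {0..1}" for n y
  proof (cases "large n")
    case True
    then have n: "2 * k \<le> m n" "4 \<le> m n" by (auto simp: large_def)
    have e: "exp (- (m n * y / 2)) \<le> 1" using m0[of n] y by simp
    have "8 * bc_weight B1 (m n) * exp (- (m n * y / 2)) \<le> 8 * bc_weight B1 (m n)"
      using e w0[of n] by (intro mult_left_le) auto
    moreover have "8 * bc_weight B1 (m n) * m n * exp (- (m n * y / 2)) \<le> 8 * bc_weight B1 (m n) * m n"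
      using e w0[of n] m0[of n] by (intro mult_left_le) auto
    moreover have "8 * bc_weight B1 (m n) * m n \<le> 8 * bc_weight B1 (m n) * (1 + m n)"
      using w0[of n] by (intro mult_left_mono) auto
    ultimately show ?thesis
      using bvp_sol_bound[OF k_pos n y, of B1 B3] True by (auto simp: K_def Y_def Y1_def l_def)
  next
    case False
    then show ?thesis using K0[OF y] by (simp add: K_def)
  qed
  have "summable (\<lambda>n. cmod (c n) * K n * (1 + m n) powr (3/4))"
  proof (rule summable_comparison_test_ev)
    show "summable (\<lambda>n. 8 * ((cmod (c n))\<^sup>2 * m n powr (2 * data_order B1) + real n powr (-3/2)))"
      by (intro summable_mult summable_add data_summable) (simp add: summable_real_powr_iff)
    show "eventually (\<lambda>n. norm (cmod (c n) * K n * (1 + m n) powr (3/4))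
        \<le> 8 * ((cmod (c n))\<^sup>2 * m n powr (2 * data_order B1) + real n powr (-3/2))) sequentially"
      using eventually_large eventually_gt_at_top[of 0]
    proof eventually_elim
      case (elim n)
      then have n: "4 \<le> m n" "0 < m n" by auto
      define W where "W = bc_weight B1 (m n)"
      have W: "W \<ge> 0" "W\<^sup>2 * m n ^ 3 = m n powr (2 * data_order B1)"
        using w0[of n] bc_weight_data_order[OF n(2)] by (auto simp: W_def)
      have "(1 + m n) powr (3/4) \<le> (2 * m n) powr (3/4)" using n by (intro powr_mono2) auto
      also have "\<dots> = 2 powr (3/4) * m n powr (3/4)" using n by (simp add: powr_mult)
      also have "\<dots> \<le> 2 * m n powr (3/4)"
        using powr_mono[of "3/4" 1 "2::real"] by (intro mult_right_mono) auto
      finally have "(1 + m n) powr (3/4) \<le> 2 * m n powr (3/4)" .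
      then have "cmod (c n) * K n * (1 + m n) powr (3/4) \<le> cmod (c n) * (8 * W) * (2 * m n powr (3/4))"
        using elim W by (intro mult_mono) (auto simp: K_def large_def W_def)
      \<comment> \<open>Splitting m^(3/4) as m^(3/2) * m^(-3/4) prepares 2ab \<le> a^2 + b^2: the
        first square is summable by the data condition, the second is at most n^(-3/2).\<close>
      also have "\<dots> = 8 * (2 * (cmod (c n) * W * m n powr (3/2)) * m n powr (-3/4))"
        using n by (simp add: mult.assoc flip: powr_add)
      also have "\<dots> \<le> 8 * ((cmod (c n) * W * m n powr (3/2))\<^sup>2 + (m n powr (-3/4))\<^sup>2)"
        by (intro mult_left_mono sum_squares_bound) auto
      also have "(cmod (c n) * W * m n powr (3/2))\<^sup>2 = (cmod (c n))\<^sup>2 * m n powr (2 * data_order B1)"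
      proof -
        have "(m n powr (3/2))\<^sup>2 = m n ^ 3"
          using n powr_realpow[of "m n" 3] by (simp add: power2_eq_square flip: powr_add)
        then show ?thesis by (simp add: power_mult_distrib mult.assoc flip: W(2))
      qed
      also have "(m n powr (-3/4))\<^sup>2 = m n powr (-3/2)"
        by (simp add: power2_eq_square flip: powr_add)
      also have "m n powr (-3/2) \<le> real n powr (-3/2)"
        using X_basic(9)[of n] elim by (intro powr_mono2') auto
      finally show ?case using elim W by (simp add: K_def large_def W_def abs_mult)
    qed
  qed
  then show ?thesis
    by (intro sepsum_hoelder_trace[where K = K, OF eigensystem Y_ode]) (use K in auto)
qed

lemma expansion: "L2_tendsto (lebesgue_on {0<..<1}) (\<lambda>N x. \<Sum>n<N. c n * of_real (X n x)) g"
  using eigensystem_expansion[OF eigensystem g_L2] coeff_summable by (simp add: c_def)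

lemma solution:
  assumes u: "L2_tendsto (lebesgue_on \<Omega>) (sepsum c X Y) u"
  shows "weak_helmholtz k u" and "bc_\<Gamma>1 B1 u g" and "bc_\<Gamma>3 B3 u (\<lambda>x. 0)" and "u \<in> H1 \<Omega>"
    and "\<exists>w. has_trace u w \<and> w \<in> H_half_bd"
    and "\<exists>ux w. weak_deriv \<Omega> (1, 0) u ux \<and> has_trace ux w \<and> w \<in> L2 bd_measure"
proof -
  let ?M = "lebesgue_on \<Omega>"
  obtain u10 where u10: "L2_tendsto ?M (sepsum c X1 Y) u10" using all_series_converge(2) by blast
  obtain u01 where u01: "L2_tendsto ?M (sepsum c X Y1) u01" using all_series_converge(3) by blast
  obtain u20 where u20: "L2_tendsto ?M (sepsum c X2 Y) u20" using all_series_converge(4) by blast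
  obtain u11 where u11: "L2_tendsto ?M (sepsum c X1 Y1) u11" using all_series_converge(5) by blast
  obtain u02 where u02: "L2_tendsto ?M (sepsum c X Y2) u02" using all_series_converge(6) by blast
  note D = ode_pair_DERIV(1)
  have d: "dir_deriv (1, 0) (sepsum a X Y N) = sepsum a X1 Y N"
    "dir_deriv (0, 1) (sepsum a X Y N) = sepsum a X Y1 N"
    "dir_deriv (1, 0) (sepsum a X1 Y N) = sepsum a X2 Y N"
    "dir_deriv (0, 1) (sepsum a X1 Y N) = sepsum a X1 Y1 N"
    "dir_deriv (1, 0) (sepsum a X Y1 N) = sepsum a X1 Y1 N"
    "dir_deriv (0, 1) (sepsum a X Y1 N) = sepsum a X Y2 N" for a N
    by (rule dir_deriv_sepsum[OF D[OF X_ode] D[OF Y_ode]] dir_deriv_sepsum[OF D[OF X1_ode] D[OF Y_ode]]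
        dir_deriv_sepsum[OF D[OF X_ode] D[OF Y1_ode]])+
  have sm: "smooth (sepsum a X Y N)" "smooth (sepsum a X1 Y N)" "smooth (sepsum a X Y1 N)" for a N
    by (rule sepsum_smooth[OF X_ode Y_ode] sepsum_smooth[OF X1_ode Y_ode] sepsum_smooth[OF X_ode Y1_ode])+
  have Hu: "H1_tendsto \<Omega> (sepsum c X Y) u"
    by (rule H1_tendsto_OmegaI[OF sm(1) u, where ux = u10 and uy = u01]) (simp_all add: d u10 u01)
  have H10: "H1_tendsto \<Omega> (sepsum c X1 Y) u10"
    by (rule H1_tendsto_OmegaI[OF sm(2) u10, where ux = u20 and uy = u11]) (simp_all add: d u20 u11)
  have H01: "H1_tendsto \<Omega> (sepsum c X Y1) u01"
    by (rule H1_tendsto_OmegaI[OF sm(3) u01, where ux = u11 and uy = u02]) (simp_all add: d u11 u02)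
  have neg: "L2_tendsto ?M (sepsum (\<lambda>n. - c n) F G) (\<lambda>p. - v p)" if "L2_tendsto ?M (sepsum c F G) v" for F G v
    using L2_tendsto_cmult[OF that, of "- 1"] by (simp add: sepsum_uminus[abs_def])
  have Hn01: "H1_tendsto \<Omega> (sepsum (\<lambda>n. - c n) X Y1) (\<lambda>p. - u01 p)"
    by (rule H1_tendsto_OmegaI[OF sm(3) neg[OF u01], where ux = "\<lambda>p. - u11 p" and uy = "\<lambda>p. - u02 p"])
      (simp_all add: d neg u11 u02)
  note C1 = smooth_C_k[OF sm(1)] smooth_C_k[OF sm(2)] smooth_C_k[OF sm(3)]
  have e: "(1, 0) \<in> (Basis :: (real \<times> real) set)" "(0, 1) \<in> (Basis :: (real \<times> real) set)"
    by (auto simp: Basis_real_pair)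
  have wd10: "weak_deriv \<Omega> (1, 0) u u10"
    by (rule weak_deriv_limit[OF C1(1) e(1) u]) (simp add: d u10)
  have wd01: "weak_deriv \<Omega> (0, 1) u u01"
    by (rule weak_deriv_limit[OF C1(1) e(2) u]) (simp add: d u01)
  have wd20: "weak_deriv \<Omega> (1, 0) u10 u20"
    by (rule weak_deriv_limit[OF C1(2) e(1) u10]) (simp add: d u20)
  have wd02: "weak_deriv \<Omega> (0, 1) u01 u02"
    by (rule weak_deriv_limit[OF C1(3) e(2) u01]) (simp add: d u02)
  have "AE p in ?M. u20 p + u02 p + of_real (k\<^sup>2) * u p = 0"
  proof (rule L2_tendsto_unique)
    show "L2_tendsto ?M (\<lambda>N p. sepsum c X2 Y N p + sepsum c X Y2 N p + of_real (k\<^sup>2) * sepsum c X Y N p)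
        (\<lambda>p. u20 p + u02 p + of_real (k\<^sup>2) * u p)"
      by (intro L2_tendsto_add L2_tendsto_cmult u20 u02 u)
    \<comment> \<open>Every term cancels, because - \<mu>^2 + (\<mu>^2 - k^2) + k^2 = 0.\<close>
    have "sepsum c X2 Y N p + sepsum c X Y2 N p + of_real (k\<^sup>2) * sepsum c X Y N p = 0" for N p
      unfolding sepsum_def sum_distrib_left sum.distrib[symmetric]
      by (rule sum.neutral) (simp add: X2_def Y2_def l_def algebra_simps)
    then show "L2_tendsto ?M (\<lambda>N p. sepsum c X2 Y N p + sepsum c X Y2 N p + of_real (k\<^sup>2) * sepsum c X Y N p)
        (\<lambda>p. 0)"
      by (simp add: L2_tendsto_const)
  qed
  then show "weak_helmholtz k u"
    unfolding weak_helmholtz_def using wd10 wd20 wd01 wd02 by blast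
  have bd: "(\<lambda>t. (t, 0)) \<in> edges" "(\<lambda>t. (t, 1)) \<in> edges" by (auto simp: edges_def)
  note bv = bvp_sol_boundary[OF den_nonzero, folded Y_def Y1_def]
  show "bc_\<Gamma>1 B1 u g"
  proof (cases B1)
    case Dirichlet
    have "L2_tendsto (lebesgue_on {0<..<1}) (\<lambda>N t. sepsum c X Y N (t, 0)) g"
      using expansion by (simp add: sepsum_def bv(1)[OF Dirichlet])
    from has_trace_edge[OF sm(1) Hu bd(1) this] show ?thesis
      by (simp add: boundary_cond_def Dirichlet)
  next
    case Neumann
    \<comment> \<open>The normal points downwards, so the approximants of the normal derivative
      carry - c n; with Y' = -1 at 0 they reproduce the expansion of the datum.\<close>
    have "L2_tendsto (lebesgue_on {0<..<1}) (\<lambda>N t. sepsum (\<lambda>n. - c n) X Y1 N (t, 0)) g"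
      using expansion by (simp add: sepsum_def bv(2)[OF Neumann])
    from has_trace_edge[OF sm(3) Hn01 bd(1) this] weak_deriv_uminus[OF wd01] show ?thesis
      by (auto simp: boundary_cond_def Neumann)
  qed
  show "bc_\<Gamma>3 B3 u (\<lambda>x. 0)"
  proof (cases B3)
    case Dirichlet
    \<comment> \<open>Every partial sum satisfies the homogeneous condition exactly, so on this edge
      the approximating sequence is constantly 0.\<close>
    have "L2_tendsto (lebesgue_on {0<..<1}) (\<lambda>N t. sepsum c X Y N (t, 1)) (\<lambda>x. 0)"
      by (simp add: sepsum_def bv(3)[OF Dirichlet] L2_tendsto_const)
    from has_trace_edge[OF sm(1) Hu bd(2) this] show ?thesis
      by (simp add: boundary_cond_def Dirichlet)
  next
    case Neumann
    have "L2_tendsto (lebesgue_on {0<..<1}) (\<lambda>N t. sepsum c X Y1 N (t, 1)) (\<lambda>x. 0)"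
      by (simp add: sepsum_def bv(4)[OF Neumann] L2_tendsto_const)
    from has_trace_edge[OF sm(3) H01 bd(2) this] wd01 show ?thesis
      by (auto simp: boundary_cond_def Neumann)
  qed
  show "u \<in> H1 \<Omega>" by (rule H1_tendsto_imp_H1[OF Hu])
  show "\<exists>w. has_trace u w \<and> w \<in> H_half_bd"
    using hoelder_trace has_traceI[OF sm(1) Hu] by blast
  obtain w where w: "L2_tendsto bd_measure (sepsum c X1 Y) w" using H1_tendsto_trace[OF sm(2) H10] by blast
  then show "\<exists>ux w. weak_deriv \<Omega> (1, 0) u ux \<and> has_trace ux w \<and> w \<in> L2 bd_measure"
    using wd10 has_traceI[OF sm(2) H10 w] L2_tendstoD(2)[OF w] by blast
qed

text \<open>Uniqueness identifies arbitrary solutions with the explicit ones on [0,1], which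
  contains every y that occurs in the open square.\<close>

lemma L2_sums_iff:
  assumes "\<And>n. bvp_solution k (m n) B1 B3 (Z n)"
  shows "L2_sums (series_term X Z g) u \<longleftrightarrow> L2_tendsto (lebesgue_on \<Omega>) (sepsum c X Y) u"
  unfolding L2_sums_def
proof (rule L2_tendsto_cong)
  fix N :: nat and p :: "real \<times> real" assume "p \<in> space (lebesgue_on \<Omega>)"
  then have "snd p \<in> {0..1}" by (auto simp: \<Omega>_def)
  then have "Z n (snd p) = Y n (snd p)" for n
    using bvp_solution_unique[OF den_nonzero[unfolded l_def] assms] by (simp add: Y_def l_def)
  then show "(\<Sum>n<N. series_term X Z g n p) = sepsum c X Y N p"
    by (simp add: sepsum_def series_term_def c_def case_prod_beta)
qed simp

end

theorem proposition2p8: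
  fixes k :: real and B1 B3 :: bc and X :: "nat \<Rightarrow> real \<Rightarrow> real" and g1 :: "real \<Rightarrow> complex"
  assumes "k > 0"
    and "eigensystem (mu k B1 B3) X"
    and "B1 = Neumann \<Longrightarrow> g1 \<in> Z_space (mu k B1 B3) X (1/2)"
    and "B1 = Dirichlet \<Longrightarrow> g1 \<in> Z_space (mu k B1 B3) X (3/2)"
  shows
    "(\<forall>n. \<exists>Yn. bvp_solution k (mu k B1 B3 n) B1 B3 Yn \<and>
        (\<forall>Z. bvp_solution k (mu k B1 B3 n) B1 B3 Z \<longrightarrow> (\<forall>y\<in>{0..1}. Z y = Yn y))) \<and>
     (\<forall>Y. (\<forall>n. bvp_solution k (mu k B1 B3 n) B1 B3 (Y n)) \<longrightarrow>
        (\<exists>u. L2_sums (series_term X Y g1) u) \<and>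
        (\<forall>u. L2_sums (series_term X Y g1) u \<longrightarrow>
           weak_helmholtz k u \<and>
           bc_\<Gamma>1 B1 u g1 \<and>
           bc_\<Gamma>3 B3 u (\<lambda>x. 0) \<and>
           u \<in> H1 \<Omega> \<and>
           (\<exists>w. has_trace u w \<and> w \<in> H_half_bd) \<and>
           (\<exists>ux w. weak_deriv \<Omega> (1, 0) u ux \<and> has_trace ux w \<and> w \<in> L2 bd_measure)))"
proof -
  have "g1 \<in> Z_space (mu k B1 B3) X (data_order B1)"
    using assms(3,4) by (cases B1) (simp_all add: data_order_def)
  then interpret helmholtz_series k B1 B3 X g1 "mu k B1 B3"
    by unfold_locales (use assms(1,2) in auto)
  show ?thesis
  proof (intro conjI allI impI)
    show "\<exists>Yn. bvp_solution k (mu k B1 B3 n) B1 B3 Yn \<and>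
        (\<forall>Z. bvp_solution k (mu k B1 B3 n) B1 B3 Z \<longrightarrow> (\<forall>y\<in>{0..1}. Z y = Yn y))" for n
      using bvp_solution_bvp_sol[OF den_nonzero[unfolded l_def]]
        bvp_solution_unique[OF den_nonzero[unfolded l_def]] by blast
  next
    fix Z assume "\<forall>n. bvp_solution k (mu k B1 B3 n) B1 B3 (Z n)"
    then have iff: "L2_sums (series_term X Z g1) u \<longleftrightarrow> L2_tendsto (lebesgue_on \<Omega>) (sepsum c X Y) u" for u
      by (intro L2_sums_iff) blast
    show "\<exists>u. L2_sums (series_term X Z g1) u"
      unfolding iff by (rule all_series_converge(1))
    fix u assume "L2_sums (series_term X Z g1) u"
    note sol = solution[OF this[unfolded iff]]
    show "weak_helmholtz k u" "bc_\<Gamma>1 B1 u g1" "bc_\<Gamma>3 B3 u (\<lambda>x. 0)" "u \<in> H1 \<Omega>"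
      "\<exists>w. has_trace u w \<and> w \<in> H_half_bd"
      "\<exists>ux w. weak_deriv \<Omega> (1, 0) u ux \<and> has_trace ux w \<and> w \<in> L2 bd_measure"
      by (rule sol)+
  qed
qed

end
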